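(* Let $0<c<1/4$, $\omega>0$ and $1<p<5$. Let $\mu=\frac m\omega\frac{p+3}{p-1}$ and $\Gamma=\{u\in H^1_0(\mathbb{R}^+):\|u\|_{L^2}^2=\mu\}$. Then $u\in H^1_0(\mathbb{R}^+)$ is a ground state solution of $\varphi''+\frac{c}{x^2}\varphi-\omega\varphi+|\varphi|^{p-1}\varphi=0$ if and only if $u$ solves the minimization problem $$u\in\Gamma,\qquad S(u)=\inf\{S(v):v\in\Gamma\}.$$
   Context: $\mathbb{R}^+=(0,\infty)$; functions are complex valued. For $u\in H^1_0(\mathbb{R}^+)$ set $H(u)=\int_0^\infty\left(|u'|^2-\frac{c}{x^2}|u|^2\right)dx$, $S(u)=\frac12H(u)+\frac\omega2\|u\|_{L^2}^2-\frac1{p+1}\|u\|_{L^{p+1}}^{p+1}$, $J(u)=H(u)+\omega\|u\|_{L^2}^2-\|u\|_{L^{p+1}}^{p+1}$, and $m=\inf\{S(u):u\in H^1_0(\mathbb{R}^+)\setminus\{0\},\ J(u)=0\}$. Set $\mathcal{A}=\{u\in H^1_0(\mathbb{R}^+)\setminus\{0\}: u''+\frac{c}{x^2}u-\omega u+|u|^{p-1}u=0\text{ in }H^{-1}(\mathbb{R}^+)\}$. A ground state is an element of $\mathcal{G}=\{u\in\mathcal{A}:S(u)\le S(v)\text{ for all }v\in\mathcal{A}\}$; the constant $\mu$ is the common value of $\|u\|_{L^2}^2$ for $u\in\mathcal{G}$. *)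

theory Defs
  imports "HOL-Analysis.Analysis"
begin

text \<open>
  Lebesgue and Sobolev functions on the open half-line are represented by total functions
  \<open>real \<Rightarrow> complex\<close>, without passing to equivalence classes. Every notion below (except for
  test functions) depends only on the almost-everywhere class of the restriction
  to \<open>{0<..}\<close>; "nonzero" therefore means "not almost everywhere zero".
\<close>

abbreviation halfline :: "real measure" where
  "halfline \<equiv> lebesgue_on {0<..}"

definition L2 :: "(real \<Rightarrow> complex) set" where
  "L2 = {u. u \<in> borel_measurable halfline \<and> integrable halfline (\<lambda>x. (cmod (u x))\<^sup>2)}"

definition Lnorm :: "real \<Rightarrow> (real \<Rightarrow> complex) \<Rightarrow> real" where
  "Lnorm q u = (\<integral>x. cmod (u x) powr q \<partial>halfline) powr (1 / q)"

text \<open>Test functions, \<open>C\<^sub>c\<^sup>\<infinity>(0,\<infinity>)\<close>, extended by zero; \<open>D n\<close> is the \<open>n\<close>-th derivative.\<close>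

definition smooth_fun :: "(real \<Rightarrow> complex) \<Rightarrow> bool" where
  "smooth_fun \<phi> \<longleftrightarrow> (\<exists>D :: nat \<Rightarrow> real \<Rightarrow> complex. D 0 = \<phi> \<and>
     (\<forall>n x. (D n has_vector_derivative D (Suc n) x) (at x)))"

definition test_funs :: "(real \<Rightarrow> complex) set" where
  "test_funs = {\<phi>. smooth_fun \<phi> \<and> compact (closure {x. \<phi> x \<noteq> 0}) \<and>
     closure {x. \<phi> x \<noteq> 0} \<subseteq> {0<..}}"

definition has_weak_deriv :: "(real \<Rightarrow> complex) \<Rightarrow> (real \<Rightarrow> complex) \<Rightarrow> bool" where
  "has_weak_deriv u v \<longleftrightarrow> (\<forall>\<phi>\<in>test_funs.
     (\<integral>x. u x * vector_derivative \<phi> (at x) \<partial>halfline) = - (\<integral>x. v x * \<phi> x \<partial>halfline))"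

definition H1 :: "(real \<Rightarrow> complex) set" where
  "H1 = {u \<in> L2. \<exists>v\<in>L2. has_weak_deriv u v}"

text \<open>The weak derivative is unique up to null sets, so the choice below is immaterial.\<close>

definition wderiv :: "(real \<Rightarrow> complex) \<Rightarrow> real \<Rightarrow> complex" where
  "wderiv u = (SOME v. v \<in> L2 \<and> has_weak_deriv u v)"

definition H1_norm :: "(real \<Rightarrow> complex) \<Rightarrow> real" where
  "H1_norm u = sqrt ((Lnorm 2 u)\<^sup>2 + (Lnorm 2 (wderiv u))\<^sup>2)"

text \<open>The closure of the test functions in \<open>H\<^sup>1\<close>.\<close>

definition H10 :: "(real \<Rightarrow> complex) set" where
  "H10 = {u \<in> H1. \<forall>e>0. \<exists>\<phi>\<in>test_funs. H1_norm (\<lambda>x. u x - \<phi> x) < e}"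

definition H10_nonzero :: "(real \<Rightarrow> complex) set" where
  "H10_nonzero = {u \<in> H10. \<not> (AE x in halfline. u x = 0)}"

definition H_fun :: "real \<Rightarrow> (real \<Rightarrow> complex) \<Rightarrow> real" where
  "H_fun c u = (\<integral>x. (cmod (wderiv u x))\<^sup>2 - c / x\<^sup>2 * (cmod (u x))\<^sup>2 \<partial>halfline)"

definition S_fun :: "real \<Rightarrow> real \<Rightarrow> real \<Rightarrow> (real \<Rightarrow> complex) \<Rightarrow> real" where
  "S_fun c \<omega> p u = 1 / 2 * H_fun c u + \<omega> / 2 * (Lnorm 2 u)\<^sup>2
     - 1 / (p + 1) * Lnorm (p + 1) u powr (p + 1)"

definition J_fun :: "real \<Rightarrow> real \<Rightarrow> real \<Rightarrow> (real \<Rightarrow> complex) \<Rightarrow> real" where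
  "J_fun c \<omega> p u = H_fun c u + \<omega> * (Lnorm 2 u)\<^sup>2 - Lnorm (p + 1) u powr (p + 1)"

text \<open>For \<open>0 < c < 1/4\<close>, \<open>\<omega> > 0\<close>, \<open>p > 1\<close> the set below is nonempty and bounded below by \<open>0\<close>,
  so the real-valued infimum is the intended one.\<close>

definition m_inf :: "real \<Rightarrow> real \<Rightarrow> real \<Rightarrow> real" where
  "m_inf c \<omega> p = Inf (S_fun c \<omega> p ` {u \<in> H10_nonzero. J_fun c \<omega> p u = 0})"

text \<open>
  Elements of \<open>H\<^sup>-\<^sup>1\<close>, the dual of \<open>H\<^sup>1\<^sub>0\<close>, are given by their values on \<open>H10\<close>, extending the
  distributional pairing without complex conjugation: a function \<open>f\<close> acts by \<open>v \<mapsto> \<integral> f v\<close>,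
  and the distributional derivative of \<open>f \<in> L\<^sup>2\<close> acts by \<open>v \<mapsto> - \<integral> f v'\<close>.
\<close>

definition pairing :: "(real \<Rightarrow> complex) \<Rightarrow> (real \<Rightarrow> complex) \<Rightarrow> complex" where
  "pairing f v = (\<integral>x. f x * v x \<partial>halfline)"

definition deriv_pairing :: "(real \<Rightarrow> complex) \<Rightarrow> (real \<Rightarrow> complex) \<Rightarrow> complex" where
  "deriv_pairing f v = - (\<integral>x. f x * wderiv v x \<partial>halfline)"

definition solves_in_Hm1 :: "real \<Rightarrow> real \<Rightarrow> real \<Rightarrow> (real \<Rightarrow> complex) \<Rightarrow> bool" where
  "solves_in_Hm1 c \<omega> p u \<longleftrightarrow> (\<forall>v\<in>H10.
       deriv_pairing (wderiv u) v
     + pairing (\<lambda>x. complex_of_real (c / x\<^sup>2) * u x) v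
     - complex_of_real \<omega> * pairing u v
     + pairing (\<lambda>x. complex_of_real (cmod (u x) powr (p - 1)) * u x) v = 0)"

definition solution_set :: "real \<Rightarrow> real \<Rightarrow> real \<Rightarrow> (real \<Rightarrow> complex) set" where
  "solution_set c \<omega> p = {u \<in> H10_nonzero. solves_in_Hm1 c \<omega> p u}"

definition ground_states :: "real \<Rightarrow> real \<Rightarrow> real \<Rightarrow> (real \<Rightarrow> complex) set" where
  "ground_states c \<omega> p = {u \<in> solution_set c \<omega> p.
     \<forall>v \<in> solution_set c \<omega> p. S_fun c \<omega> p u \<le> S_fun c \<omega> p v}"

end

theory Submission
  imports Defs "HOL-Complex_Analysis.Great_Picard"
begin

text \<open>
  Write \<open>Q = H + \<omega> \<parallel>u\<parallel>\<^sup>2\<close> and \<open>P = \<parallel>u\<parallel>\<^bsub>p+1\<^esub>\<^bsup>p+1\<^esup>\<close>. The two-parameter family \<open>a u(l x)\<close> acts on the triple of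
  \<open>H\<close>, the mass and \<open>P\<close> by powers of \<open>a\<close> and \<open>l\<close>, so minimizing \<open>S\<close> on the Nehari manifold \<open>Q = P\<close> and at the
  fixed mass \<open>\<mu>\<close> are both the problem of minimizing \<open>Q / P\<^bsup>2/(p+1)\<^esup>\<close>; the equality case is Bernoulli's
  inequality with exponent \<open>(p - 1) / 4 < 1\<close>. Nehari minimizers solve the equation because \<open>Q\<close> is
  quadratic and \<open>P\<close> lies above its tangents, and every solution satisfies \<open>Q = P\<close>. Hence ground states are
  Nehari minimizers as soon as a minimizer of \<open>Q / P\<^bsup>2/(p+1)\<^esup>\<close> exists.

  For the existence, take a minimizing sequence of test functions with \<open>P = 1\<close> that converges pointwise.
  Localizing with \<open>sech\<^sup>2 + tanh\<^sup>2 = 1\<close> shows that the limit carries either no or all of \<open>P\<close>. In the latter case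
  the parallelogram identity makes the sequence Cauchy. In the former case the infimum is at least the
  sharp constant of the problem with \<open>c = 0\<close> on the whole line, which follows from Nagy's calibration argument;
  but a soliton truncated far from the origin does better, since the potential gains \<open>1 / T\<^sup>2\<close> and
  the truncation costs only \<open>exp (- 2 sqrt \<omega> T)\<close>.
\<close>

text \<open>The obstacle is loss of compactness: a minimizing sequence may slide to infinity, where
  the potential disappears. So the constant of the problem without potential must be known from both
  sides: as a lower bound for functions on \<open>[R, \<infinity>)\<close> that need not vanish at
  \<open>R\<close>, and as the limit of quotients of truncated solitons. Here \<open>c > 0\<close>
  makes the potential a gain, and \<open>c < 1/4\<close> lets Hardy's inequality keep
  \<open>Q\<close> comparable to the squared \<open>H1\<close> norm.

  Weak limits do not occur. Test functions have genuine point values and are uniformly Hoelder along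
  the sequence, so a subsequence converges at every point, and local parts of \<open>P\<close> pass
  to the limit by dominated convergence.

  The mass \<open>\<mu>\<close> is forced: a Nehari minimizer is critical along
  \<open>u(l x)\<close>, which splits the common value of \<open>Q\<close> and \<open>P\<close> into
  \<open>H = m\<close> and \<open>\<omega> * \<mu>\<close>. Conversely, at mass \<open>\<mu>\<close>
  the best dilation gives \<open>P \<le> P0 * (H / m) powr ((p - 1) / 4)\<close>; the power is
  strictly concave because \<open>p < 5\<close>, and comparing it with its tangent at
  \<open>H = m\<close> yields \<open>S \<ge> m\<close>.\<close>

section \<open>Smooth functions\<close>

text \<open>Iterating a choice of derivative inside \<open>C\<close> produces the sequence that
  \<open>smooth_fun\<close> asks for. Smoothness of an explicit family thus reduces to one
  differentiation rule that stays in the family.\<close>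

lemma smooth_fun_coinduct:
  assumes step: "\<And>f. f \<in> C \<Longrightarrow> \<exists>f'\<in>C. \<forall>x. (f has_vector_derivative f' x) (at x)"
    and f: "f \<in> C"
  shows "smooth_fun f"
proof -
  define d where "d f = (SOME f'. f' \<in> C \<and> (\<forall>x. (f has_vector_derivative f' x) (at x)))"
    for f :: "real \<Rightarrow> complex"
  have d: "d g \<in> C \<and> (\<forall>x. (g has_vector_derivative d g x) (at x))" if "g \<in> C" for g
    unfolding d_def using step[OF that] by (rule someI2_bex) blast
  have D: "(d ^^ n) f \<in> C" for n
    by (induction n) (use f d in auto)
  show ?thesis
    unfolding smooth_fun_def
    by (rule exI[of _ "\<lambda>n. (d ^^ n) f"]) (use D d in auto)
qed

abbreviation dv :: "(real \<Rightarrow> complex) \<Rightarrow> real \<Rightarrow> complex" where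
  "dv \<phi> x \<equiv> vector_derivative \<phi> (at x)"

lemma smooth_fun_has_deriv: "smooth_fun f \<Longrightarrow> (f has_vector_derivative dv f x) (at x)"
  unfolding smooth_fun_def by (metis vector_derivative_at)

lemma smooth_fun_dv: "smooth_fun f \<Longrightarrow> smooth_fun (dv f)"
proof -
  assume "smooth_fun f"
  then obtain D where D: "D 0 = f" "\<And>n x. (D n has_vector_derivative D (Suc n) x) (at x)"
    unfolding smooth_fun_def by auto
  have "dv f = D 1"
    using D(2)[of 0] by (auto intro!: vector_derivative_at simp: D(1))
  then show ?thesis
    unfolding smooth_fun_def by (intro exI[of _ "\<lambda>n. D (Suc n)"]) (use D in auto)
qed

lemma smooth_fun_continuous: "smooth_fun f \<Longrightarrow> continuous_on A f"
  by (meson continuous_at_imp_continuous_on has_vector_derivative_continuous smooth_fun_has_deriv)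

lemma smooth_fun_const [simp]: "smooth_fun (\<lambda>x. c)"
proof -
  have "(\<lambda>x. c) \<in> range (\<lambda>c (x::real). c :: complex)" by auto
  then show ?thesis
    by (rule smooth_fun_coinduct[rotated]) (auto intro!: exI[of _ 0])
qed

lemma smooth_fun_add:
  assumes "smooth_fun f" "smooth_fun g"
  shows "smooth_fun (\<lambda>x. f x + g x)"
proof -
  have "(\<lambda>x. f x + g x) \<in> {\<lambda>x. f x + g x | f g. smooth_fun f \<and> smooth_fun g}"
    using assms by auto
  then show ?thesis
  proof (rule smooth_fun_coinduct[rotated], safe)
    fix f g assume "smooth_fun f" "smooth_fun g"
    then show "\<exists>f'\<in>{\<lambda>x. f x + g x | f g. smooth_fun f \<and> smooth_fun g}.
      \<forall>x. ((\<lambda>x. f x + g x) has_vector_derivative f' x) (at x)"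
      by (intro bexI[of _ "\<lambda>x. dv f x + dv g x"])
        (auto intro!: has_vector_derivative_add smooth_fun_has_deriv smooth_fun_dv)
  qed
qed

text \<open>The derivative of a product is a sum of two products, so products alone are not closed
  under differentiation; their finite sums are.\<close>

inductive_set product_sums :: "(real \<Rightarrow> complex) set" where
  mult: "smooth_fun f \<Longrightarrow> smooth_fun g \<Longrightarrow> (\<lambda>x. f x * g x) \<in> product_sums"
| add: "f \<in> product_sums \<Longrightarrow> g \<in> product_sums \<Longrightarrow> (\<lambda>x. f x + g x) \<in> product_sums"

lemma smooth_fun_mult:
  assumes "smooth_fun f" "smooth_fun g"
  shows "smooth_fun (\<lambda>x. f x * g x)"
proof (rule smooth_fun_coinduct[of product_sums])
  show "\<exists>f'\<in>product_sums. \<forall>x. (f has_vector_derivative f' x) (at x)" if "f \<in> product_sums" for f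
    using that
  proof induction
    case (mult f g)
    show ?case
      by (rule bexI[of _ "\<lambda>x. f x * dv g x + dv f x * g x"])
        (use mult in \<open>auto intro!: has_vector_derivative_mult smooth_fun_has_deriv smooth_fun_dv
           product_sums.intros\<close>)
  next
    case (add f g)
    then obtain f' g' where "f' \<in> product_sums" "\<And>x. (f has_vector_derivative f' x) (at x)"
      "g' \<in> product_sums" "\<And>x. (g has_vector_derivative g' x) (at x)" by blast
    then show ?case
      by (intro bexI[of _ "\<lambda>x. f' x + g' x"])
        (auto intro!: has_vector_derivative_add product_sums.intros)
  qed
qed (use assms in \<open>auto intro: product_sums.intros\<close>)

lemma smooth_fun_cnj:
  assumes "smooth_fun f"
  shows "smooth_fun (\<lambda>x. cnj (f x))"
proof -
  have "(\<lambda>x. cnj (f x)) \<in> {\<lambda>x. cnj (f x) | f. smooth_fun f}"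
    using assms by auto
  then show ?thesis
  proof (rule smooth_fun_coinduct[rotated], safe)
    fix f assume "smooth_fun f"
    then show "\<exists>f'\<in>{\<lambda>x. cnj (f x) | f. smooth_fun f}.
      \<forall>x. ((\<lambda>x. cnj (f x)) has_vector_derivative f' x) (at x)"
      by (intro bexI[of _ "\<lambda>x. cnj (dv f x)"])
        (auto intro!: has_vector_derivative_cnj smooth_fun_has_deriv smooth_fun_dv)
  qed
qed

lemma has_vector_derivative_affine:
  assumes "(f has_vector_derivative f') (at (a * x + b))"
  shows "((\<lambda>x. f (a * x + b)) has_vector_derivative a *\<^sub>R f') (at x)"
proof -
  have "((\<lambda>x. a * x + b) has_vector_derivative a) (at x)"
    by (auto intro!: derivative_eq_intros)
  from vector_diff_chain_at[OF this assms] show ?thesis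
    by (simp add: o_def)
qed

lemma smooth_fun_affine:
  assumes "smooth_fun f"
  shows "smooth_fun (\<lambda>x. f (a * x + b))"
proof -
  have "(\<lambda>x. f (a * x + b)) \<in> {\<lambda>x. f (a * x + b) | f. smooth_fun f}"
    using assms by auto
  then show ?thesis
  proof (rule smooth_fun_coinduct[rotated], safe)
    fix f assume f: "smooth_fun f"
    show "\<exists>f'\<in>{\<lambda>x. f (a * x + b) | f. smooth_fun f}.
      \<forall>x. ((\<lambda>x. f (a * x + b)) has_vector_derivative f' x) (at x)"
    proof (rule bexI[of _ "\<lambda>x. a *\<^sub>R dv f (a * x + b)"])
      show "(\<lambda>x. a *\<^sub>R dv f (a * x + b)) \<in> {\<lambda>x. f (a * x + b) | f. smooth_fun f}"
        using smooth_fun_mult[OF smooth_fun_const[of "of_real a"] smooth_fun_dv[OF f]]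
        by (auto simp: scaleR_conv_of_real)
    qed (use f in \<open>auto intro!: has_vector_derivative_affine smooth_fun_has_deriv\<close>)
  qed
qed

lemma smooth_fun_scale: "smooth_fun f \<Longrightarrow> smooth_fun (\<lambda>x. c * f x)"
  by (intro smooth_fun_mult smooth_fun_const)

section \<open>Flat functions, bumps and smooth plateaus\<close>

definition flat_exp :: "real poly \<Rightarrow> real \<Rightarrow> real" where
  "flat_exp q t = (if t > 0 then poly q (1 / t) * exp (- (1 / t)) else 0)"

text \<open>In the variable \<open>s = 1 / t\<close> this is the decay of a polynomial times
  \<open>exp (- s)\<close>, the division by \<open>t\<close> raising the degree by one. The quotient
  is the difference quotient at \<open>0\<close>, the only delicate point.\<close>

lemma flat_exp_div_tendsto_0: "((\<lambda>t. flat_exp q t / t) \<longlongrightarrow> 0) (at 0)"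
proof -
  have aux: "((\<lambda>s. poly r s * exp (- s)) \<longlongrightarrow> 0) at_top" for r :: "real poly"
  proof -
    have "((\<lambda>s. \<Sum>i\<le>degree r. coeff r i * (s ^ i / exp s)) \<longlongrightarrow> (\<Sum>i\<le>degree r. coeff r i * 0)) at_top"
      by (intro tendsto_intros tendsto_power_div_exp_0)
    moreover have "(\<lambda>s. \<Sum>i\<le>degree r. coeff r i * (s ^ i / exp s)) = (\<lambda>s. poly r s * exp (- s))"
      by (auto simp: poly_altdef sum_distrib_right exp_minus divide_simps)
    ultimately show ?thesis by simp
  qed
  have "((\<lambda>t. poly (q * [:0,1:]) (inverse t) * exp (- (inverse t))) \<longlongrightarrow> 0) (at_right 0)"
    using filterlim_compose[OF aux filterlim_inverse_at_top_right] .
  moreover have "\<forall>\<^sub>F t in at_right 0. poly (q * [:0,1:]) (inverse t) * exp (- (inverse t)) = flat_exp q t / t"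
  proof (rule eventually_mono[OF eventually_at_right_less[of "0::real"]])
    fix t :: real assume "0 < t"
    then have "flat_exp q t / t = poly q (1 / t) * exp (- (1 / t)) * (1 / t)"
      by (simp only: flat_exp_def if_True) simp
    also have "\<dots> = poly (q * [:0,1:]) (inverse t) * exp (- (inverse t))"
      by (simp only: inverse_eq_divide poly_mult poly_pCons poly_0 mult_zero_right add_0_left mult_1_right mult_ac add_0_right mult_zero_left)
    finally show "poly (q * [:0,1:]) (inverse t) * exp (- (inverse t)) = flat_exp q t / t" ..
  qed
  ultimately have r: "((\<lambda>t. flat_exp q t / t) \<longlongrightarrow> 0) (at_right 0)"
    by (rule Lim_transform_eventually)
  have l: "((\<lambda>t. flat_exp q t / t) \<longlongrightarrow> 0) (at_left 0)"
    by (rule tendsto_eventually) (auto simp: flat_exp_def eventually_at_left_field intro!: exI[of _ "-1"])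
  from r l show ?thesis
    by (simp add: filterlim_at_split)
qed

text \<open>For \<open>s = 1 / t\<close> the derivative in \<open>t\<close> is \<open>- s^2\<close>
  times the derivative in \<open>s\<close>; applied to \<open>q(s) * exp (- s)\<close> it gives
  \<open>s^2 * (q - q') * exp (- s)\<close>. Keeping the polynomial as a parameter closes the family
  under differentiation.\<close>

lemma flat_exp_has_derivative:
  "(flat_exp q has_real_derivative flat_exp ([:0,0,1:] * (q - pderiv q)) t) (at t)"
proof (cases t "0::real" rule: linorder_cases)
  case less
  have "((\<lambda>t. 0) has_real_derivative 0) (at t)" by simp
  then have "(flat_exp q has_real_derivative 0) (at t)"
    by (rule has_field_derivative_transform_within_open[where S="{..<0}"])
      (use less in \<open>auto simp: flat_exp_def\<close>)
  then show ?thesis using less by (simp add: flat_exp_def)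
next
  case equal
  show ?thesis
    using flat_exp_div_tendsto_0[of q]
    by (simp add: equal has_field_derivative_iff flat_exp_def[of _ 0])
next
  case greater
  have "((\<lambda>t. poly q (1/t) * exp (- (1/t))) has_real_derivative
     poly (pderiv q) (1/t) * (-1/t\<^sup>2) * exp (- (1/t)) + poly q (1/t) * (exp (- (1/t)) * (1/t\<^sup>2))) (at t)"
    using greater
    by (auto intro!: derivative_eq_intros DERIV_chain2[OF poly_DERIV] simp: power2_eq_square field_simps)
  then have "(flat_exp q has_real_derivative
     poly (pderiv q) (1/t) * (-1/t\<^sup>2) * exp (- (1/t)) + poly q (1/t) * (exp (- (1/t)) * (1/t\<^sup>2))) (at t)"
    by (rule has_field_derivative_transform_within_open[where S="{0<..}"])
      (use greater in \<open>auto simp: flat_exp_def\<close>)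
  moreover have "poly (pderiv q) (1/t) * (-1/t\<^sup>2) * exp (- (1/t)) + poly q (1/t) * (exp (- (1/t)) * (1/t\<^sup>2))
     = flat_exp ([:0,0,1:] * (q - pderiv q)) t"
    using greater by (simp add: flat_exp_def power2_eq_square field_simps)
  ultimately show ?thesis by simp
qed

lemma smooth_fun_flat_exp: "smooth_fun (\<lambda>t. of_real (flat_exp q t))"
proof -
  have "(\<lambda>t. of_real (flat_exp q t)) \<in> range (\<lambda>q t. complex_of_real (flat_exp q t))" by auto
  then show ?thesis
  proof (rule smooth_fun_coinduct[rotated], safe)
    fix q
    show "\<exists>f'\<in>range (\<lambda>q t. complex_of_real (flat_exp q t)).
      \<forall>x. ((\<lambda>t. complex_of_real (flat_exp q t)) has_vector_derivative f' x) (at x)"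
      by (rule bexI[OF _ rangeI[of _ "[:0,0,1:] * (q - pderiv q)"]])
        (intro allI has_vector_derivative_of_real
          flat_exp_has_derivative)
  qed
qed

definition bump :: "real \<Rightarrow> real" where
  "bump t = flat_exp 1 t"

lemma bump_eq: "bump t = (if t > 0 then exp (- (1 / t)) else 0)"
  by (simp add: bump_def flat_exp_def)

lemma bump_nonneg [simp]: "0 \<le> bump t" and bump_le_1 [simp]: "bump t \<le> 1"
  by (auto simp: bump_eq)

lemma smooth_fun_bump: "smooth_fun (\<lambda>t. of_real (bump t))"
  unfolding bump_def by (rule smooth_fun_flat_exp)

lemma smooth_fun_antiderivative:
  assumes "\<And>x. (f has_vector_derivative f' x) (at x)" "smooth_fun f'"
  shows "smooth_fun f"
proof (rule smooth_fun_coinduct[of "insert f {g. smooth_fun g}"])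
  show "\<exists>f'\<in>insert f {g. smooth_fun g}. \<forall>x. (g has_vector_derivative f' x) (at x)"
    if "g \<in> insert f {g. smooth_fun g}" for g
    using that assms smooth_fun_has_deriv smooth_fun_dv by fastforce
qed auto

lemma continuous_antiderivative:
  fixes g :: "real \<Rightarrow> real"
  assumes "continuous_on UNIV g"
  obtains G where "\<And>x. (G has_real_derivative g x) (at x)" "G 0 = 0"
proof -
  define F where "F x = (if x \<ge> 0 then integral {0..x} g else - integral {x..0} g)" for x
  have int: "g integrable_on {a..b}" for a b
    by (meson assms continuous_on_subset integrable_continuous_real subset_UNIV)
  \<comment> \<open>A base point to the left of both \<open>x\<close> and \<open>0\<close> turns the
    two branches of \<open>F\<close> into one integral with variable end point, up to a
    constant.\<close>
  have F: "F x = integral {a..x} g - integral {a..0} g" if "a \<le> x" "a \<le> 0" for a x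
    using Henstock_Kurzweil_Integration.integral_combine[of a 0 x g]
      Henstock_Kurzweil_Integration.integral_combine[of a x 0 g] that int
    by (auto simp: F_def algebra_simps)
  have "(F has_real_derivative g x) (at x)" for x
  proof -
    define a b where "a = min x 0 - 1" and "b = x + 1"
    have x: "x \<in> {a<..<b}" by (auto simp: a_def b_def)
    have "((\<lambda>x. integral {a..x} g) has_real_derivative g x) (at x within {a..b})"
      using integral_has_real_derivative[of a b g x] assms continuous_on_subset x by fastforce
    then have "((\<lambda>x. integral {a..x} g) has_real_derivative g x) (at x)"
      using x by (simp add: at_within_Icc_at)
    then have "((\<lambda>x. integral {a..x} g - integral {a..0} g) has_real_derivative g x) (at x)"
      by (auto intro!: derivative_eq_intros)
    then show ?thesis
      by (rule has_field_derivative_transform_within_open[where S="{a<..}"])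
        (use x in \<open>auto simp: F[symmetric] a_def\<close>)
  qed
  then show ?thesis using that[of F] by (simp add: F_def)
qed

text \<open>The antiderivative of a bump supported in \<open>[0, 1]\<close>, divided by its total
  increase \<open>G 1\<close>; the bound \<open>K\<close> is \<open>1 / G 1\<close> because the bump
  is at most \<open>1\<close>.\<close>

lemma smooth_plateau:
  obtains \<eta> \<eta>' :: "real \<Rightarrow> real" and K where "smooth_fun (\<lambda>t. of_real (\<eta> t))"
    "\<And>t. (\<eta> has_real_derivative \<eta>' t) (at t)"
    "\<And>t. t \<le> 0 \<Longrightarrow> \<eta> t = 0" "\<And>t. t \<ge> 1 \<Longrightarrow> \<eta> t = 1"
    "\<And>t. 0 \<le> \<eta> t" "\<And>t. \<eta> t \<le> 1" "\<And>t. \<bar>\<eta>' t\<bar> \<le> K" "0 \<le> K"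
proof -
  define g where "g t = bump t * bump (1 - t)" for t
  have smg: "smooth_fun (\<lambda>t. of_real (g t))"
    unfolding g_def of_real_mult
    using smooth_fun_affine[OF smooth_fun_bump, of "-1" 1]
    by (intro smooth_fun_mult smooth_fun_bump) simp
  have cont: "continuous_on UNIV g"
  proof -
    have "continuous_on UNIV (\<lambda>t. Re (of_real (g t)))"
      by (intro continuous_intros smooth_fun_continuous smg)
    then show ?thesis by simp
  qed
  obtain G where G: "\<And>x. (G has_real_derivative g x) (at x)" and G0: "G 0 = 0"
    using continuous_antiderivative[OF cont] by metis
  have g0: "0 \<le> g t" "g t \<le> 1" for t
    by (auto simp: g_def intro: mult_le_one)
  have mono: "G x \<le> G y" if "x \<le> y" for x y
    by (rule DERIV_nonneg_imp_nondecreasing[OF that]) (use G g0 in blast)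
  have const: "G x = G y" if xy: "x < y" and "\<And>t. x < t \<Longrightarrow> t < y \<Longrightarrow> g t = 0" for x y
  proof -
    obtain z where "x < z" "z < y" "G y - G x = (y - x) * g z"
      using MVT2[OF xy, of G g] G by auto
    then show ?thesis using that by simp
  qed
  have Gneg: "G t = 0" if "t \<le> 0" for t
    using const[of t 0] that G0 by (cases "t = 0") (auto simp: g_def bump_eq)
  have Gbig: "G t = G 1" if "t \<ge> 1" for t
    using const[of 1 t] that by (cases "t = 1") (auto simp: g_def bump_eq)
  have G1: "G 1 > 0"
  proof -
    obtain z where z: "1/4 < z" "z < 3/4" "G (3/4) - G (1/4) = (3/4 - 1/4) * g z"
      using MVT2[of "1/4" "3/4" G g] G by auto
    have "g z > 0" using z by (auto simp: g_def bump_eq)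
    then have "G (3/4) > G (1/4)" using z by simp
    with mono[of 0 "1/4"] mono[of "3/4" 1] G0 show ?thesis by simp
  qed
  define \<eta> where "\<eta> t = G t / G 1" for t
  have der: "(\<eta> has_real_derivative g t / G 1) (at t)" for t
    unfolding \<eta>_def by (rule DERIV_cdivide[OF G])
  have "smooth_fun (\<lambda>t. of_real (\<eta> t))"
  proof (rule smooth_fun_antiderivative)
    show "((\<lambda>t. complex_of_real (\<eta> t)) has_vector_derivative complex_of_real (g t / G 1)) (at t)" for t
      by (intro has_vector_derivative_of_real der)
    show "smooth_fun (\<lambda>t. complex_of_real (g t / G 1))"
      using smooth_fun_scale[OF smg, of "of_real (1 / G 1)"] by simp
  qed
  moreover have "\<bar>g t / G 1\<bar> \<le> 1 / G 1" for t
    using g0[of t] G1 by (simp add: divide_right_mono)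
  moreover have "0 \<le> \<eta> t" for t
    using mono[of 0 t] Gneg[of t] G0 G1 by (cases "t \<le> 0") (auto simp: \<eta>_def)
  moreover have "\<eta> t \<le> 1" for t
    using mono[of t 1] Gbig[of t] G1 by (cases "t \<le> 1") (auto simp: \<eta>_def)
  moreover have "\<eta> t = 1" if "t \<ge> 1" for t
    unfolding \<eta>_def Gbig[OF that] using G1 by simp
  moreover have "\<eta> t = 0" if "t \<le> 0" for t
    unfolding \<eta>_def Gneg[OF that] by simp
  moreover have "0 \<le> 1 / G 1" using G1 by simp
  ultimately show ?thesis
    using that[of \<eta> "\<lambda>t. g t / G 1" "1 / G 1"] der by blast
qed

text \<open>Closed under differentiation since \<open>tanh' = 1 - tanh^2\<close> and
  \<open>(cosh powr (- a))' = - a * tanh * cosh powr (- a)\<close>. One family covers the soliton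
  and, with \<open>a = 1\<close> and \<open>a = 0\<close>, the two localizing functions.\<close>

lemma smooth_fun_tanh_cosh: "smooth_fun (\<lambda>x. of_real (poly q (tanh x) * cosh x powr (- a)))"
proof -
  let ?f = "\<lambda>q x. complex_of_real (poly q (tanh x) * cosh x powr (- a))"
  have "?f q \<in> range ?f" by auto
  then show ?thesis
  proof (rule smooth_fun_coinduct[rotated], safe)
    fix q
    let ?r = "pderiv q * (1 - [:0,0,1:]) - smult a ([:0,1:] * q)"
    have "((\<lambda>x. poly q (tanh x) * cosh x powr (- a)) has_real_derivative
        poly ?r (tanh x) * cosh x powr (- a)) (at x)" for x :: real
    proof -
      have c: "cosh x > 0" by (simp add: cosh_real_pos)
      have "((\<lambda>x. poly q (tanh x)) has_real_derivative poly (pderiv q) (tanh x) * (1 - tanh x ^ 2)) (at x)"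
        using c by (intro DERIV_chain2[OF poly_DERIV]) (auto intro!: derivative_eq_intros)
      note 1 = this
      have "((\<lambda>x. cosh x powr (- a)) has_real_derivative
          (- a) * tanh x * cosh x powr (- a)) (at x)"
      proof -
        have "((\<lambda>x. cosh x powr (- a)) has_real_derivative (- a) * cosh x powr (- a - 1) * sinh x) (at x)"
          by (rule DERIV_chain2[where f="\<lambda>y. y powr (- a)"]) (use c in \<open>auto intro!: derivative_eq_intros has_real_derivative_powr\<close>)
        moreover have "cosh x powr (- a - 1) = cosh x powr (- a) / cosh x"
          using c by (simp add: powr_diff)
        ultimately show ?thesis by (simp add: tanh_def mult_ac)
      qed
      note 2 = this
      show ?thesis
        by (rule DERIV_cong[OF DERIV_mult[OF 1 2]]) (simp add: algebra_simps power2_eq_square)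
    qed
    then show "\<exists>f'\<in>range ?f. \<forall>x. (?f q has_vector_derivative f' x) (at x)"
      by (intro bexI[OF _ rangeI[of _ ?r]] allI has_vector_derivative_of_real)
  qed
qed

section \<open>Square-integrable functions on the half-line\<close>

definition sqi :: "(real \<Rightarrow> complex) \<Rightarrow> real" where
  "sqi f = (\<integral>x. (cmod (f x))\<^sup>2 \<partial>halfline)"

lemma Lnorm_2: "(Lnorm 2 u)\<^sup>2 = sqi u"
proof -
  have "0 \<le> (\<integral>x. (cmod (u x))\<^sup>2 \<partial>halfline)" by simp
  then show ?thesis
    by (simp add: Lnorm_def sqi_def powr_half_sqrt)
qed

lemma sqi_nonneg [simp]: "0 \<le> sqi f"
  by (simp add: sqi_def)

lemma L2_D:
  assumes "f \<in> L2"
  shows "f \<in> borel_measurable halfline" "integrable halfline (\<lambda>x. (cmod (f x))\<^sup>2)"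
  using assms by (auto simp: L2_def)

lemma cmod_sum_sq_le: "(cmod (a + b))\<^sup>2 \<le> 2 * (cmod a)\<^sup>2 + 2 * (cmod b)\<^sup>2"
proof -
  have "(cmod (a + b))\<^sup>2 \<le> (cmod a + cmod b)\<^sup>2"
    by (intro power_mono norm_triangle_ineq) auto
  also have "\<dots> \<le> 2 * (cmod a)\<^sup>2 + 2 * (cmod b)\<^sup>2"
    using zero_le_power2[of "cmod a - cmod b"] by (simp add: power2_eq_square algebra_simps)
  finally show ?thesis .
qed

lemma L2_dominated:
  assumes "g \<in> L2" "f \<in> borel_measurable halfline" "AE x in halfline. cmod (f x) \<le> K * cmod (g x)"
  shows "f \<in> L2"
proof -
  have "integrable halfline (\<lambda>x. (cmod (f x))\<^sup>2)"
  proof (rule Bochner_Integration.integrable_bound)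
    show "integrable halfline (\<lambda>x. K\<^sup>2 * (cmod (g x))\<^sup>2)"
      using L2_D(2)[OF assms(1)] by simp
    show "AE x in halfline. norm ((cmod (f x))\<^sup>2) \<le> norm (K\<^sup>2 * (cmod (g x))\<^sup>2)"
      using assms(3)
    proof eventually_elim
      case (elim x)
      then have "(cmod (f x))\<^sup>2 \<le> (K * cmod (g x))\<^sup>2"
        by (intro power_mono) auto
      then show ?case by (simp add: power_mult_distrib)
    qed
  qed (use assms(2) in measurable)
  then show ?thesis using assms(2) by (simp add: L2_def)
qed

lemma L2_add:
  assumes "f \<in> L2" "g \<in> L2"
  shows "(\<lambda>x. f x + g x) \<in> L2"
proof -
  note [measurable] = L2_D(1)[OF assms(1)] L2_D(1)[OF assms(2)]
  have "integrable halfline (\<lambda>x. (cmod (f x + g x))\<^sup>2)"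
    by (rule Bochner_Integration.integrable_bound[of _ "\<lambda>x. 2 * (cmod (f x))\<^sup>2 + 2 * (cmod (g x))\<^sup>2"])
      (use L2_D(2)[OF assms(1)] L2_D(2)[OF assms(2)] in \<open>auto simp: cmod_sum_sq_le\<close>)
  then show ?thesis by (simp add: L2_def)
qed

lemma L2_scale: "f \<in> L2 \<Longrightarrow> (\<lambda>x. c * f x) \<in> L2"
  by (auto simp: L2_def norm_mult power_mult_distrib)

lemma L2_cnj: "f \<in> L2 \<Longrightarrow> (\<lambda>x. cnj (f x)) \<in> L2"
proof -
  assume f: "f \<in> L2"
  have "(\<lambda>x. cnj (f x)) \<in> borel_measurable halfline"
    using borel_measurable_continuous_on[OF continuous_on_cnj[OF continuous_on_id] L2_D(1)[OF f]] by simp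
  then show ?thesis using f by (simp add: L2_def)
qed

lemma L2_diff: "f \<in> L2 \<Longrightarrow> g \<in> L2 \<Longrightarrow> (\<lambda>x. f x - g x) \<in> L2"
  using L2_add[of f "\<lambda>x. (-1) * g x"] L2_scale[of g "-1"] by simp

lemma sqi_scale: "sqi (\<lambda>x. c * f x) = (cmod c)\<^sup>2 * sqi f"
  by (simp add: sqi_def norm_mult power_mult_distrib)

lemma sqi_cnj [simp]: "sqi (\<lambda>x. cnj (f x)) = sqi f"
  by (simp add: sqi_def)

lemma sqi_cong_AE:
  assumes "AE x in halfline. f x = g x" "f \<in> borel_measurable halfline" "g \<in> borel_measurable halfline"
  shows "sqi f = sqi g"
  unfolding sqi_def using assms by (intro integral_cong_AE) auto

lemma sqi_minus_commute: "sqi (\<lambda>x. f x - g x) = sqi (\<lambda>x. g x - f x)"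
  by (simp add: sqi_def norm_minus_commute)

lemma L2_mult_integrable:
  assumes "f \<in> L2" "g \<in> L2"
  shows "integrable halfline (\<lambda>x. f x * g x)"
proof -
  note [measurable] = L2_D(1)[OF assms(1)] L2_D(1)[OF assms(2)]
  have le: "cmod (a * b) \<le> norm ((cmod a)\<^sup>2 + (cmod b)\<^sup>2)" for a b
  proof -
    have "cmod a * cmod b \<le> (cmod a)\<^sup>2 + (cmod b)\<^sup>2"
      using zero_le_power2[of "cmod a - cmod b"] zero_le_power2[of "cmod a + cmod b"]
      unfolding power2_sum power2_diff by linarith
    then show ?thesis unfolding norm_mult real_norm_def by linarith
  qed
  show ?thesis
  proof (rule Bochner_Integration.integrable_bound)
    show "integrable halfline (\<lambda>x. (cmod (f x))\<^sup>2 + (cmod (g x))\<^sup>2)"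
      by (intro Bochner_Integration.integrable_add L2_D assms)
    show "AE x in halfline. norm (f x * g x) \<le> norm ((cmod (f x))\<^sup>2 + (cmod (g x))\<^sup>2)"
      by (intro always_eventually allI le)
  qed measurable
qed

lemma L2_Cauchy_Schwarz_norm:
  assumes "f \<in> L2" "g \<in> L2"
  shows "(\<integral>x. cmod (f x) * cmod (g x) \<partial>halfline)\<^sup>2 \<le> sqi f * sqi g"
proof -
  define A where "A = (\<integral>x. cmod (f x) * cmod (g x) \<partial>halfline)"
  have A0: "0 \<le> A" by (simp add: A_def)
  have iA: "integrable halfline (\<lambda>x. cmod (f x) * cmod (g x))"
    using integrable_norm[OF L2_mult_integrable[OF assms]] by (simp add: norm_mult)
  have *: "0 \<le> sqi f - 2 * t * A + t\<^sup>2 * sqi g" for t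
  proof -
    have "0 \<le> (\<integral>x. (cmod (f x) - t * cmod (g x))\<^sup>2 \<partial>halfline)" by simp
    also have "\<dots> = (\<integral>x. (cmod (f x))\<^sup>2 - 2 * t * (cmod (f x) * cmod (g x)) + t\<^sup>2 * (cmod (g x))\<^sup>2 \<partial>halfline)"
      by (simp add: power2_eq_square algebra_simps)
    also have "\<dots> = sqi f - 2 * t * A + t\<^sup>2 * sqi g"
      unfolding A_def sqi_def using L2_D(2)[OF assms(1)] L2_D(2)[OF assms(2)] iA by simp
    finally show ?thesis .
  qed
  show ?thesis
  proof (cases "sqi g = 0")
    case True
    have "A = 0"
    proof (rule ccontr)
      assume "A \<noteq> 0"
      \<comment> \<open>For \<open>sqi g = 0\<close> the polynomial is affine in \<open>t\<close>;
        at this \<open>t\<close> the inequality reads \<open>0 \<le> -1\<close>.\<close>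
      then show False using *[of "(sqi f + 1) / (2 * A)"] True A0 by simp
    qed
    then show ?thesis using True by (simp add: A_def)
  next
    case False
    then have g: "sqi g > 0" by (simp add: order.not_eq_order_implies_strict)
    have "A\<^sup>2 / sqi g \<le> sqi f"
      using *[of "A / sqi g"] g by (simp add: power2_eq_square field_simps)
    then show ?thesis using g by (simp add: A_def field_simps)
  qed
qed

lemma L2_Cauchy_Schwarz:
  assumes "f \<in> L2" "g \<in> L2"
  shows "cmod (\<integral>x. f x * g x \<partial>halfline) \<le> sqrt (sqi f) * sqrt (sqi g)"
proof -
  have "cmod (\<integral>x. f x * g x \<partial>halfline) \<le> (\<integral>x. cmod (f x * g x) \<partial>halfline)"
    by (rule integral_norm_bound)
  also have "\<dots> \<le> sqrt (sqi f * sqi g)"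
    using L2_Cauchy_Schwarz_norm[OF assms] by (intro real_le_rsqrt) (simp add: norm_mult)
  finally show ?thesis by (simp add: real_sqrt_mult)
qed

lemma L2_triangle:
  assumes "f \<in> L2" "g \<in> L2"
  shows "sqrt (sqi (\<lambda>x. f x + g x)) \<le> sqrt (sqi f) + sqrt (sqi g)"
proof -
  have iA: "integrable halfline (\<lambda>x. cmod (f x) * cmod (g x))"
    using integrable_norm[OF L2_mult_integrable[OF assms]] by (simp add: norm_mult)
  have "sqi (\<lambda>x. f x + g x) \<le> (\<integral>x. (cmod (f x))\<^sup>2 + 2 * (cmod (f x) * cmod (g x)) + (cmod (g x))\<^sup>2 \<partial>halfline)"
    unfolding sqi_def
  proof (rule integral_mono)
    show "(cmod (f x + g x))\<^sup>2 \<le> (cmod (f x))\<^sup>2 + 2 * (cmod (f x) * cmod (g x)) + (cmod (g x))\<^sup>2" for x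
      using power_mono[OF norm_triangle_ineq[of "f x" "g x"], of 2] by (simp add: power2_sum)
  qed (use L2_D(2)[OF assms(1)] L2_D(2)[OF assms(2)] iA L2_D(2)[OF L2_add[OF assms]] in auto)
  also have "\<dots> = sqi f + 2 * (\<integral>x. cmod (f x) * cmod (g x) \<partial>halfline) + sqi g"
    unfolding sqi_def using L2_D(2)[OF assms(1)] L2_D(2)[OF assms(2)] iA by simp
  also have "\<dots> \<le> sqi f + 2 * sqrt (sqi f * sqi g) + sqi g"
    using real_le_rsqrt[OF L2_Cauchy_Schwarz_norm[OF assms]] by simp
  also have "\<dots> = (sqrt (sqi f) + sqrt (sqi g))\<^sup>2"
    by (simp add: power2_sum real_sqrt_mult)
  finally show ?thesis
    by (intro real_le_lsqrt) auto
qed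

lemma L2_triangle_diff:
  assumes "f \<in> L2" "g \<in> L2"
  shows "sqrt (sqi (\<lambda>x. f x - g x)) \<le> sqrt (sqi f) + sqrt (sqi g)"
  using L2_triangle[OF assms(1) L2_scale[OF assms(2), of "-1"]] sqi_scale[of "-1" g] by simp

lemma L2_norm_diff:
  assumes "f \<in> L2" "g \<in> L2"
  shows "\<bar>sqrt (sqi f) - sqrt (sqi g)\<bar> \<le> sqrt (sqi (\<lambda>x. f x - g x))"
  using L2_triangle[OF L2_diff[OF assms] assms(2)] L2_triangle[OF L2_diff[OF assms(2,1)] assms(1)]
  by (simp add: sqi_minus_commute[of g f])

lemma tendsto_sqi:
  assumes "\<And>n. f n \<in> L2" "g \<in> L2" "(\<lambda>n. sqi (\<lambda>x. g x - f n x)) \<longlonglongrightarrow> 0"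
  shows "(\<lambda>n. sqi (f n)) \<longlonglongrightarrow> sqi g"
proof -
  have "(\<lambda>n. sqrt (sqi (f n)) - sqrt (sqi g)) \<longlonglongrightarrow> 0"
  proof (rule Lim_null_comparison)
    show "\<forall>\<^sub>F n in sequentially. norm (sqrt (sqi (f n)) - sqrt (sqi g)) \<le> sqrt (sqi (\<lambda>x. g x - f n x))"
      using L2_norm_diff[OF assms(1,2)] by (simp add: sqi_minus_commute[of g])
    show "(\<lambda>n. sqrt (sqi (\<lambda>x. g x - f n x))) \<longlonglongrightarrow> 0"
      using tendsto_real_sqrt[OF assms(3)] by simp
  qed
  then have "(\<lambda>n. sqrt (sqi (f n))) \<longlonglongrightarrow> sqrt (sqi g)"
    by (simp add: LIM_zero_iff)
  from tendsto_power[OF this, of 2] show ?thesis by simp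
qed

lemma tendsto_L2_mult:
  assumes "\<And>n. f n \<in> L2" "g \<in> L2" "h \<in> L2" "(\<lambda>n. sqi (\<lambda>x. g x - f n x)) \<longlonglongrightarrow> 0"
  shows "(\<lambda>n. \<integral>x. f n x * h x \<partial>halfline) \<longlonglongrightarrow> (\<integral>x. g x * h x \<partial>halfline)"
proof -
  have "(\<lambda>n. (\<integral>x. f n x * h x \<partial>halfline) - (\<integral>x. g x * h x \<partial>halfline)) \<longlonglongrightarrow> 0"
  proof (rule Lim_null_comparison)
    have "(\<integral>x. f n x * h x \<partial>halfline) - (\<integral>x. g x * h x \<partial>halfline) = (\<integral>x. (f n x - g x) * h x \<partial>halfline)" for n
      using L2_mult_integrable[OF assms(1,3)] L2_mult_integrable[OF assms(2,3)]
      by (simp add: left_diff_distrib)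
    then show "\<forall>\<^sub>F n in sequentially. norm ((\<integral>x. f n x * h x \<partial>halfline) - (\<integral>x. g x * h x \<partial>halfline))
       \<le> sqrt (sqi (\<lambda>x. g x - f n x)) * sqrt (sqi h)"
      using L2_Cauchy_Schwarz[OF L2_diff[OF assms(1,2)] assms(3)]
      by (simp add: sqi_minus_commute[of g])
    show "(\<lambda>n. sqrt (sqi (\<lambda>x. g x - f n x)) * sqrt (sqi h)) \<longlonglongrightarrow> 0"
      using tendsto_mult_right[OF tendsto_real_sqrt[OF assms(4)], of "sqrt (sqi h)"] by simp
  qed
  then show ?thesis by (simp add: LIM_zero_iff)
qed

section \<open>Fatou's lemma and completeness of the space of square-integrable functions\<close>

lemma L2_Fatou:
  assumes f: "\<And>n. f n \<in> L2" and g: "g \<in> borel_measurable halfline"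
    and lim: "AE x in halfline. (\<lambda>n. f n x) \<longlonglongrightarrow> g x"
    and le: "\<And>n. n \<ge> N \<Longrightarrow> sqi (f n) \<le> e"
  shows "g \<in> L2" "sqi g \<le> e"
proof -
  have [measurable]: "f n \<in> borel_measurable halfline" for n using f L2_D by blast
  note [measurable] = g
  have e: "0 \<le> e" using le[of N] sqi_nonneg[of "f N"] by linarith
  have nn: "(\<integral>\<^sup>+x. ennreal ((cmod (f n x))\<^sup>2) \<partial>halfline) = ennreal (sqi (f n))" for n
    unfolding sqi_def using L2_D(2)[OF f] by (intro nn_integral_eq_integral) auto
  have "(\<integral>\<^sup>+x. ennreal ((cmod (g x))\<^sup>2) \<partial>halfline) = (\<integral>\<^sup>+x. liminf (\<lambda>n. ennreal ((cmod (f n x))\<^sup>2)) \<partial>halfline)"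
  proof (rule nn_integral_cong_AE, use lim in eventually_elim)
    case (elim x)
    have "(\<lambda>n. ennreal ((cmod (f n x))\<^sup>2)) \<longlonglongrightarrow> ennreal ((cmod (g x))\<^sup>2)"
      by (intro tendsto_ennrealI tendsto_power tendsto_norm elim)
    from lim_imp_Liminf[OF sequentially_bot this] show ?case by (rule sym)
  qed
  also have "\<dots> \<le> liminf (\<lambda>n. \<integral>\<^sup>+x. ennreal ((cmod (f n x))\<^sup>2) \<partial>halfline)"
    by (rule nn_integral_liminf) measurable
  also have "\<dots> \<le> ennreal e"
    unfolding nn
    by (rule Liminf_le) (use le in \<open>auto simp: eventually_sequentially intro!: exI[of _ N] ennreal_leI\<close>)
  finally have le_e: "(\<integral>\<^sup>+x. ennreal ((cmod (g x))\<^sup>2) \<partial>halfline) \<le> ennreal e" .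
  then have int: "integrable halfline (\<lambda>x. (cmod (g x))\<^sup>2)"
    by (intro integrableI_bounded) (auto simp: order_le_less_trans[of _ "ennreal e"])
  then show "g \<in> L2" using g by (simp add: L2_def)
  have "ennreal (sqi g) \<le> ennreal e"
    using le_e nn_integral_eq_integral[OF int] by (simp add: sqi_def)
  then show "sqi g \<le> e" using e by simp
qed

text \<open>Fatou's lemma for \<open>f m - f n\<close>, with \<open>n\<close> fixed and
  \<open>m\<close> tending to infinity, turns the Cauchy bound into a bound for
  \<open>g - f n\<close>.\<close>

lemma L2_Cauchy_limit:
  assumes f: "\<And>n. f n \<in> L2" and g: "g \<in> borel_measurable halfline"
    and lim: "AE x in halfline. (\<lambda>n. f n x) \<longlonglongrightarrow> g x"
    and Cauchy: "\<And>e. e > 0 \<Longrightarrow> \<exists>N. \<forall>m\<ge>N. \<forall>n\<ge>N. sqi (\<lambda>x. f m x - f n x) \<le> e"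
  shows "g \<in> L2" "(\<lambda>n. sqi (\<lambda>x. g x - f n x)) \<longlonglongrightarrow> 0"
proof -
  have *: "\<exists>N. \<forall>n\<ge>N. (\<lambda>x. g x - f n x) \<in> L2 \<and> sqi (\<lambda>x. g x - f n x) \<le> e" if e: "e > 0" for e
  proof -
    obtain N where N: "\<And>m n. m \<ge> N \<Longrightarrow> n \<ge> N \<Longrightarrow> sqi (\<lambda>x. f m x - f n x) \<le> e"
      using Cauchy[OF e] by blast
    have "(\<lambda>x. g x - f n x) \<in> L2 \<and> sqi (\<lambda>x. g x - f n x) \<le> e" if "n \<ge> N" for n
    proof -
      have 1: "(\<lambda>x. g x - f n x) \<in> borel_measurable halfline"
        using g L2_D(1)[OF f] by auto
      have 2: "AE x in halfline. (\<lambda>m. f m x - f n x) \<longlonglongrightarrow> g x - f n x"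
        using lim by eventually_elim (intro tendsto_intros)
      show ?thesis
        using L2_Fatou[of "\<lambda>m x. f m x - f n x", OF L2_diff[OF f f] 1 2 N[OF _ that]] by blast
    qed
    then show ?thesis by blast
  qed
  obtain N where "(\<lambda>x. g x - f N x) \<in> L2" using *[of 1] by auto
  from L2_add[OF this f[of N]] show "g \<in> L2" by simp
  show "(\<lambda>n. sqi (\<lambda>x. g x - f n x)) \<longlonglongrightarrow> 0"
  proof (rule LIMSEQ_I)
    fix e :: real assume "0 < e"
    then obtain N where "\<And>n. n \<ge> N \<Longrightarrow> sqi (\<lambda>x. g x - f n x) \<le> e / 2" using *[of "e/2"] by auto
    then show "\<exists>no. \<forall>n\<ge>no. norm (sqi (\<lambda>x. g x - f n x) - 0) < e"
      using \<open>0 < e\<close> by (intro exI[of _ N]) (force simp: field_simps)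
  qed
qed

lemma term_le_suminf_ennreal: "g k \<le> (\<Sum>k. g k)" for g :: "nat \<Rightarrow> ennreal"
  using sum_le_suminf[of g "{k}"] by simp

text \<open>Needed for sequences of derivatives, for which no pointwise limit is at hand. A
  subsequence with rapidly decreasing increments converges almost everywhere,
  \<open>L2_Cauchy_limit\<close> identifies its limit, and the Cauchy property carries the
  convergence over to the whole sequence.\<close>

lemma L2_complete:
  assumes f: "\<And>n. f n \<in> L2"
    and Cauchy: "\<And>e. e > 0 \<Longrightarrow> \<exists>N. \<forall>m\<ge>N. \<forall>n\<ge>N. sqi (\<lambda>x. f m x - f n x) \<le> e"
  obtains g where "g \<in> L2" "(\<lambda>n. sqi (\<lambda>x. g x - f n x)) \<longlonglongrightarrow> 0"
proof -
  have [measurable]: "f n \<in> borel_measurable halfline" for n using f L2_D by blast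
  have "\<exists>N. \<forall>m\<ge>N. \<forall>n\<ge>N. sqi (\<lambda>x. f m x - f n x) \<le> (1/4)^k" for k
    by (rule Cauchy) simp
  then obtain N where N: "\<And>k m n. m \<ge> N k \<Longrightarrow> n \<ge> N k \<Longrightarrow> sqi (\<lambda>x. f m x - f n x) \<le> (1/4)^k"
    by metis
  define r where "r k = k + (\<Sum>i\<le>k. N i)" for k
  \<comment> \<open>The summand \<open>k\<close> in \<open>r k\<close> makes it strictly increasing,
    the partial sum puts it beyond \<open>N k\<close>.\<close>
  have r: "strict_mono r"
    by (rule strict_monoI_Suc) (simp add: r_def)
  have rN: "r k \<ge> N k" for k
    using member_le_sum[of k "{..k}" N] by (simp add: r_def)
  define d where "d k x = f (r (Suc k)) x - f (r k) x" for k x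
  have dL2: "d k \<in> L2" for k unfolding d_def by (intro L2_diff f)
  have d: "sqi (d k) \<le> (1/4)^k" for k
    unfolding d_def using N[of k "r (Suc k)" "r k"] rN[of k] strict_mono_less_eq[OF r, of k "Suc k"] by simp
  have [measurable]: "d k \<in> borel_measurable halfline" for k using dL2 L2_D by blast
  \<comment> \<open>The weight \<open>2^k\<close> leaves the series of integrals convergent, as the
    increments are at most \<open>4^(-k)\<close>; finiteness of \<open>W x\<close> then forces
    \<open>cmod (d k x)\<close> to decay geometrically with ratio \<open>sqrt (1/2)\<close>.\<close>
  define W where "W x = (\<Sum>k. ennreal (2^k * (cmod (d k x))\<^sup>2))" for x
  have W: "W \<in> borel_measurable halfline"
    unfolding W_def by (intro borel_measurable_suminf_order measurable_compose[OF _ measurable_ennreal]) measurable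
  have "integral\<^sup>N halfline W
      = (\<Sum>k. \<integral>\<^sup>+x. ennreal (2^k * (cmod (d k x))\<^sup>2) \<partial>halfline)"
    unfolding W_def by (rule nn_integral_suminf) measurable
  also have "\<dots> \<le> (\<Sum>k. ennreal ((1/2)^k))"
  proof (rule suminf_le)
    fix k
    have "(\<integral>\<^sup>+x. ennreal (2^k * (cmod (d k x))\<^sup>2) \<partial>halfline) = ennreal (\<integral>x. 2^k * (cmod (d k x))\<^sup>2 \<partial>halfline)"
      using L2_D(2)[OF dL2] by (intro nn_integral_eq_integral) auto
    also have "\<dots> = ennreal (2^k * sqi (d k))" by (simp add: sqi_def)
    also have "\<dots> \<le> ennreal (2^k * (1/4)^k)"
      using d by (intro ennreal_leI mult_left_mono) auto
    also have "2^k * (1/4)^k = (1/2 :: real)^k" by (simp flip: power_mult_distrib)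
    finally show "(\<integral>\<^sup>+x. ennreal (2^k * (cmod (d k x))\<^sup>2) \<partial>halfline) \<le> ennreal ((1/2)^k)" .
  qed auto
  also have "\<dots> = ennreal (\<Sum>k. (1/2)^k)"
    by (intro suminf_ennreal2) auto
  finally have "integral\<^sup>N halfline W \<noteq> \<infinity>"
    unfolding infinity_ennreal_def by (rule neq_top_trans[OF ennreal_neq_top])
  from nn_integral_PInf_AE[OF W this]
  have ae: "AE x in halfline. W x \<noteq> \<infinity>" .
  have conv: "AE x in halfline. convergent (\<lambda>k. f (r k) x)"
    using ae
  proof eventually_elim
    case (elim x)
    then obtain C where C: "0 \<le> C" "W x = ennreal C"
      using ennreal_cases[of "W x"] unfolding infinity_ennreal_def by blast
    have "2^k * (cmod (d k x))\<^sup>2 \<le> C" for k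
    proof -
      have "ennreal (2^k * (cmod (d k x))\<^sup>2) \<le> W x"
        unfolding W_def by (rule term_le_suminf_ennreal)
      then show ?thesis using C by (simp only: ennreal_le_iff)
    qed
    then have b: "cmod (d k x) \<le> sqrt C * (sqrt (1/2))^k" for k
    proof -
      have "(cmod (d k x))\<^sup>2 \<le> C * (1/2)^k"
        using \<open>2^k * (cmod (d k x))\<^sup>2 \<le> C\<close> by (simp add: power_one_over pos_le_divide_eq mult.commute)
      then have "cmod (d k x) \<le> sqrt (C * (1/2)^k)" by (rule real_le_rsqrt)
      then show ?thesis by (simp only: real_sqrt_mult real_sqrt_power)
    qed
    have "summable (\<lambda>k. d k x)"
    proof (rule summable_comparison_test')
      show "summable (\<lambda>k. sqrt C * (sqrt (1/2))^k)"
        by (intro summable_mult summable_geometric) (simp add: real_sqrt_divide)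
    qed (use b in auto)
    then have "convergent (\<lambda>n. \<Sum>k<n. d k x)" by (simp add: summable_iff_convergent)
    then have "convergent (\<lambda>n. (\<Sum>k<n. d k x) + f (r 0) x)"
      by (intro convergent_add convergent_const)
    moreover have "(\<Sum>k<n. d k x) + f (r 0) x = f (r n) x" for n
      using sum_lessThan_telescope[of "\<lambda>k. f (r k) x" n] by (simp add: d_def)
    ultimately show ?case by simp
  qed
  define g where "g x = lim (\<lambda>k. f (r k) x)" for x
  have g: "g \<in> borel_measurable halfline" unfolding g_def by measurable
  have lim: "AE x in halfline. (\<lambda>k. f (r k) x) \<longlonglongrightarrow> g x"
    using conv by eventually_elim (simp add: g_def convergent_LIMSEQ_iff)
  have C': "\<exists>N. \<forall>m\<ge>N. \<forall>n\<ge>N. sqi (\<lambda>x. f (r m) x - f (r n) x) \<le> e" if "e > 0" for e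
    using Cauchy[OF that] strict_mono_imp_increasing[OF r] by (meson order_trans)
  note lim' = L2_Cauchy_limit[of "\<lambda>k. f (r k)", OF f g lim C']
  have "(\<lambda>n. sqrt (sqi (\<lambda>x. g x - f n x))) \<longlonglongrightarrow> 0"
  proof (rule Lim_null_comparison)
    show "\<forall>\<^sub>F n in sequentially. norm (sqrt (sqi (\<lambda>x. g x - f n x)))
       \<le> sqrt (sqi (\<lambda>x. g x - f (r n) x)) + sqrt (sqi (\<lambda>x. f (r n) x - f n x))"
    proof (intro always_eventually allI)
      fix n
      have "sqrt (sqi (\<lambda>x. (g x - f (r n) x) + (f (r n) x - f n x)))
        \<le> sqrt (sqi (\<lambda>x. g x - f (r n) x)) + sqrt (sqi (\<lambda>x. f (r n) x - f n x))"
        by (intro L2_triangle L2_diff lim'(1) f)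
      then show "norm (sqrt (sqi (\<lambda>x. g x - f n x)))
        \<le> sqrt (sqi (\<lambda>x. g x - f (r n) x)) + sqrt (sqi (\<lambda>x. f (r n) x - f n x))"
        by simp
    qed
    have "(\<lambda>n. sqi (\<lambda>x. f (r n) x - f n x)) \<longlonglongrightarrow> 0"
    proof (rule LIMSEQ_I)
      fix e :: real assume "0 < e"
      then obtain N where N: "\<And>m n. m \<ge> N \<Longrightarrow> n \<ge> N \<Longrightarrow> sqi (\<lambda>x. f m x - f n x) \<le> e / 2"
        using Cauchy[of "e/2"] by auto
      have "sqi (\<lambda>x. f (r n) x - f n x) < e" if "n \<ge> N" for n
        using N[of "r n" n] that strict_mono_imp_increasing[OF r, of n] \<open>0 < e\<close> by auto
      then show "\<exists>no. \<forall>n\<ge>no. norm (sqi (\<lambda>x. f (r n) x - f n x) - 0) < e"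
        by (intro exI[of _ N]) simp
    qed
    then show "(\<lambda>n. sqrt (sqi (\<lambda>x. g x - f (r n) x)) + sqrt (sqi (\<lambda>x. f (r n) x - f n x))) \<longlonglongrightarrow> 0"
      using tendsto_add[OF tendsto_real_sqrt[OF lim'(2)] tendsto_real_sqrt] by fastforce
  qed
  from tendsto_power[OF this, of 2] have "(\<lambda>n. sqi (\<lambda>x. g x - f n x)) \<longlonglongrightarrow> 0" by simp
  with lim'(1) show ?thesis by (rule that)
qed

section \<open>Test functions and weak derivatives\<close>

lemma test_funsI:
  assumes "smooth_fun \<phi>" "0 < a" "\<And>x. x \<notin> {a..b} \<Longrightarrow> \<phi> x = 0"
  shows "\<phi> \<in> test_funs"
proof -
  have "closure {x. \<phi> x \<noteq> 0} \<subseteq> {a..b}"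
    using assms(3) by (intro closure_minimal) (auto intro: ccontr)
  moreover have "compact ({a..b} \<inter> closure {x. \<phi> x \<noteq> 0})"
    by (intro compact_Int_closed) auto
  ultimately show ?thesis
    using assms by (auto simp: test_funs_def Int_absorb1)
qed

lemma test_funsE:
  assumes "\<phi> \<in> test_funs"
  obtains a b where "0 < a" "a < b" "smooth_fun \<phi>" "\<And>x. x \<notin> {a..b} \<Longrightarrow> \<phi> x = 0"
proof -
  define K where "K = closure {x. \<phi> x \<noteq> 0}"
  have K: "compact K" "K \<subseteq> {0<..}" "smooth_fun \<phi>" "\<And>x. x \<notin> K \<Longrightarrow> \<phi> x = 0"
    using assms closure_subset[of "{x. \<phi> x \<noteq> 0}"] by (auto simp: test_funs_def K_def)
  show ?thesis
  proof (cases "K = {}")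
    case True
    then show ?thesis using that[of 1 2] K by auto
  next
    case False
    obtain a where a: "a \<in> K" "\<And>x. x \<in> K \<Longrightarrow> a \<le> x"
      using compact_attains_inf[OF K(1) False] by auto
    obtain b where b: "b \<in> K" "\<And>x. x \<in> K \<Longrightarrow> x \<le> b"
      using compact_attains_sup[OF K(1) False] by auto
    show ?thesis
    proof (rule that[of a "b + 1"])
      show "0 < a" using a K by auto
      show "a < b + 1" using a(2)[OF b(1)] by simp
      show "\<phi> x = 0" if "x \<notin> {a..b + 1}" for x
        using K(4)[of x] a(2)[of x] b(2)[of x] that by force
    qed (use K in simp)
  qed
qed

lemma test_fun_smooth: "\<phi> \<in> test_funs \<Longrightarrow> smooth_fun \<phi>"
  by (auto simp: test_funs_def)

lemma test_fun_deriv: "\<phi> \<in> test_funs \<Longrightarrow> (\<phi> has_vector_derivative dv \<phi> x) (at x)"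
  by (simp add: smooth_fun_has_deriv test_fun_smooth)

lemma test_fun_continuous: "\<phi> \<in> test_funs \<Longrightarrow> continuous_on A \<phi>"
  by (simp add: smooth_fun_continuous test_fun_smooth)

lemma test_fun_nonpos: "\<phi> \<in> test_funs \<Longrightarrow> x \<le> 0 \<Longrightarrow> \<phi> x = 0"
  by (erule test_funsE) auto

lemma test_funs_E2:
  assumes "\<phi> \<in> test_funs" "\<psi> \<in> test_funs"
  obtains a b where "0 < a" "a < b" "\<And>x. x \<notin> {a..b} \<Longrightarrow> \<phi> x = 0" "\<And>x. x \<notin> {a..b} \<Longrightarrow> \<psi> x = 0"
proof -
  obtain a b where 1: "0 < a" "a < b" "\<And>x. x \<notin> {a..b} \<Longrightarrow> \<phi> x = 0"
    by (rule test_funsE[OF assms(1)]) blast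
  obtain c d where 2: "0 < c" "c < d" "\<And>x. x \<notin> {c..d} \<Longrightarrow> \<psi> x = 0"
    by (rule test_funsE[OF assms(2)]) blast
  show ?thesis
  proof (rule that)
    show "0 < min a c" "min a c < max b d" using 1 2 by auto
    show "\<phi> x = 0" if "x \<notin> {min a c..max b d}" for x
      by (rule 1(3)) (use that in auto)
    show "\<psi> x = 0" if "x \<notin> {min a c..max b d}" for x
      by (rule 2(3)) (use that in auto)
  qed
qed

lemma dv_eq_0_outside:
  assumes "\<And>x. x \<notin> {a..b::real} \<Longrightarrow> \<phi> x = (0::complex)" "x \<notin> {a..b}"
  shows "dv \<phi> x = 0"
proof -
  have "(\<phi> has_vector_derivative 0) (at x)"
  proof (rule has_vector_derivative_transform_within_open)
    show "((\<lambda>x. 0) has_vector_derivative 0) (at x)" by simp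
    show "open (- {a..b})" by (simp add: open_Compl)
  qed (use assms in auto)
  then show ?thesis by (rule vector_derivative_at)
qed

lemma test_fun_dv: "\<phi> \<in> test_funs \<Longrightarrow> dv \<phi> \<in> test_funs"
  by (erule test_funsE, rule test_funsI, erule smooth_fun_dv, assumption, rule dv_eq_0_outside)

lemma test_fun_add: "\<phi> \<in> test_funs \<Longrightarrow> \<psi> \<in> test_funs \<Longrightarrow> (\<lambda>x. \<phi> x + \<psi> x) \<in> test_funs"
proof -
  assume t: "\<phi> \<in> test_funs" "\<psi> \<in> test_funs"
  obtain a b where ab: "0 < a" "a < b" "\<And>x. x \<notin> {a..b} \<Longrightarrow> \<phi> x = 0" "\<And>x. x \<notin> {a..b} \<Longrightarrow> \<psi> x = 0"
    using test_funs_E2[OF t] by metis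
  show ?thesis
    by (rule test_funsI[of _ a b]) (use ab t in \<open>auto intro: smooth_fun_add test_fun_smooth\<close>)
qed

lemma test_fun_mult: "smooth_fun f \<Longrightarrow> \<phi> \<in> test_funs \<Longrightarrow> (\<lambda>x. f x * \<phi> x) \<in> test_funs"
  by (erule test_funsE, rule test_funsI) (auto intro: smooth_fun_mult)

lemma test_fun_scale: "\<phi> \<in> test_funs \<Longrightarrow> (\<lambda>x. c * \<phi> x) \<in> test_funs"
  by (rule test_fun_mult) auto

lemma test_fun_diff: "\<phi> \<in> test_funs \<Longrightarrow> \<psi> \<in> test_funs \<Longrightarrow> (\<lambda>x. \<phi> x - \<psi> x) \<in> test_funs"
  using test_fun_add[OF _ test_fun_scale[of \<psi> "-1"], of \<phi>] by simp

lemma test_fun_cnj: "\<phi> \<in> test_funs \<Longrightarrow> (\<lambda>x. cnj (\<phi> x)) \<in> test_funs"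
  by (erule test_funsE, rule test_funsI) (auto intro: smooth_fun_cnj)

lemma test_fun_dilate:
  assumes "\<phi> \<in> test_funs" "0 < l"
  shows "(\<lambda>x. \<phi> (l * x)) \<in> test_funs"
proof -
  obtain a b where ab: "0 < a" "a < b" "smooth_fun \<phi>" "\<And>x. x \<notin> {a..b} \<Longrightarrow> \<phi> x = 0"
    using test_funsE[OF assms(1)] by blast
  show ?thesis
  proof (rule test_funsI[of _ "a / l" "b / l"])
    show "\<phi> (l * x) = 0" if "x \<notin> {a / l..b / l}" for x
      using that assms(2) by (intro ab) (auto simp: field_simps)
  qed (use ab assms smooth_fun_affine[of \<phi> l 0] in auto)
qed

lemma dv_add: "\<phi> \<in> test_funs \<Longrightarrow> \<psi> \<in> test_funs \<Longrightarrow> dv (\<lambda>x. \<phi> x + \<psi> x) x = dv \<phi> x + dv \<psi> x"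
  by (intro vector_derivative_at has_vector_derivative_add test_fun_deriv)

lemma dv_diff: "\<phi> \<in> test_funs \<Longrightarrow> \<psi> \<in> test_funs \<Longrightarrow> dv (\<lambda>x. \<phi> x - \<psi> x) x = dv \<phi> x - dv \<psi> x"
  by (intro vector_derivative_at has_vector_derivative_diff test_fun_deriv)

lemma dv_scale: "\<phi> \<in> test_funs \<Longrightarrow> dv (\<lambda>x. c * \<phi> x) x = c * dv \<phi> x"
  by (intro vector_derivative_at has_vector_derivative_mult_right test_fun_deriv)

lemma dv_cnj: "\<phi> \<in> test_funs \<Longrightarrow> dv (\<lambda>x. cnj (\<phi> x)) x = cnj (dv \<phi> x)"
  by (intro vector_derivative_at has_vector_derivative_cnj test_fun_deriv)

lemma dv_dilate: "\<phi> \<in> test_funs \<Longrightarrow> dv (\<lambda>x. \<phi> (l * x)) x = of_real l * dv \<phi> (l * x)"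
  using vector_derivative_at[OF has_vector_derivative_affine[of \<phi> "dv \<phi> (l * x)" l x 0]] test_fun_deriv
  by (simp add: scaleR_conv_of_real)

lemma halfline_integral_Icc:
  fixes F :: "real \<Rightarrow> 'b::euclidean_space"
  assumes "0 < a" "continuous_on {a..b} F" "\<And>x. x \<notin> {a..b} \<Longrightarrow> F x = 0"
  shows "integrable halfline F" "integral\<^sup>L halfline F = integral {a..b} F"
proof -
  have F: "(\<lambda>x. indicator {a..b} x *\<^sub>R F x) = F"
    using assms(3) by (auto simp: indicator_def fun_eq_iff)
  have F': "(\<lambda>x. indicator {0<..} x *\<^sub>R F x) = F"
    using assms(1,3) by (fastforce simp: indicator_def fun_eq_iff)
  have "integrable lborel (\<lambda>x. indicator {a..b} x *\<^sub>R F x)"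
    by (intro borel_integrable_compact assms) auto
  then have "integrable lebesgue F"
    unfolding F by (simp add: integrable_completion)
  then show i: "integrable halfline F"
    by (simp add: integrable_restrict_space F')
  have "integral\<^sup>L halfline F = integral {0<..} F"
    by (rule lebesgue_integral_eq_integral[OF i]) simp
  also have "\<dots> = integral {a..b} F"
    using assms(1)
    by (intro integral_unique has_integral_on_superset[OF integrable_integral[OF integrable_continuous_real[OF assms(2)]] assms(3)])
      auto
  finally show "integral\<^sup>L halfline F = integral {a..b} F" .
qed

lemma test_fun_L2: "\<phi> \<in> test_funs \<Longrightarrow> \<phi> \<in> L2"
proof -
  assume t: "\<phi> \<in> test_funs"
  obtain a b where ab: "0 < a" "a < b" "\<And>x. x \<notin> {a..b} \<Longrightarrow> \<phi> x = 0"
    using test_funs_E2[OF t t] by metis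
  have "integrable halfline \<phi>"
    by (rule halfline_integral_Icc(1)[of a b]) (use ab t in \<open>auto intro: test_fun_continuous\<close>)
  moreover have "integrable halfline (\<lambda>x. (cmod (\<phi> x))\<^sup>2)"
    by (rule halfline_integral_Icc(1)[of a b]) (use ab t in \<open>auto intro!: continuous_intros test_fun_continuous\<close>)
  ultimately show ?thesis by (auto simp: L2_def)
qed

lemma test_fun_weak_deriv:
  assumes "\<phi> \<in> test_funs"
  shows "has_weak_deriv \<phi> (dv \<phi>)"
  unfolding has_weak_deriv_def
proof
  fix \<psi> assume \<psi>: "\<psi> \<in> test_funs"
  obtain a b where ab: "0 < a" "a < b" "\<And>x. x \<notin> {a..b} \<Longrightarrow> \<phi> x = 0" "\<And>x. x \<notin> {a..b} \<Longrightarrow> \<psi> x = 0"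
    using test_funs_E2[OF assms \<psi>] by blast
  \<comment> \<open>Widening the interval puts both end points where the functions are known to
    vanish, which kills the boundary terms.\<close>
  define a' b' where "a' = a / 2" and "b' = b + 1"
  have ab': "0 < a'" "a' < b'" "\<And>x. x \<notin> {a'..b'} \<Longrightarrow> \<phi> x = 0" "\<And>x. x \<notin> {a'..b'} \<Longrightarrow> \<psi> x = 0"
    using ab by (auto simp: a'_def b'_def)
  have c: "continuous_on {a'..b'} (\<lambda>x. \<phi> x * dv \<psi> x)" "continuous_on {a'..b'} (\<lambda>x. dv \<phi> x * \<psi> x)"
    by (intro continuous_intros test_fun_continuous assms \<psi> test_fun_dv)+
  have i1: "(\<integral>x. \<phi> x * dv \<psi> x \<partial>halfline) = integral {a'..b'} (\<lambda>x. \<phi> x * dv \<psi> x)"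
    by (rule halfline_integral_Icc(2)[OF ab'(1) c(1)]) (metis ab'(3) mult_zero_left)
  have i2: "(\<integral>x. dv \<phi> x * \<psi> x \<partial>halfline) = integral {a'..b'} (\<lambda>x. dv \<phi> x * \<psi> x)"
    by (rule halfline_integral_Icc(2)[OF ab'(1) c(2)]) (metis ab'(4) mult_zero_right)
  have "((\<lambda>x. \<phi> x * dv \<psi> x + dv \<phi> x * \<psi> x) has_integral \<phi> b' * \<psi> b' - \<phi> a' * \<psi> a') {a'..b'}"
    by (intro fundamental_theorem_of_calculus less_imp_le[OF ab'(2)]
        has_vector_derivative_at_within[OF has_vector_derivative_mult[OF test_fun_deriv[OF assms] test_fun_deriv[OF \<psi>]]])
  then have "integral {a'..b'} (\<lambda>x. \<phi> x * dv \<psi> x + dv \<phi> x * \<psi> x) = 0"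
    using ab by (auto dest!: integral_unique simp: a'_def b'_def)
  then have "integral {a'..b'} (\<lambda>x. \<phi> x * dv \<psi> x) + integral {a'..b'} (\<lambda>x. dv \<phi> x * \<psi> x) = 0"
    using c by (subst (asm) Henstock_Kurzweil_Integration.integral_add) (auto intro: integrable_continuous_real)
  then show "(\<integral>x. \<phi> x * dv \<psi> x \<partial>halfline) = - (\<integral>x. dv \<phi> x * \<psi> x \<partial>halfline)"
    unfolding i1 i2 by (simp add: add_eq_0_iff)
qed

section \<open>The fundamental lemma of the calculus of variations\<close>

lemma sigma_finite_lebesgue: "sigma_finite_measure (lebesgue :: real measure)"
proof
  obtain A :: "real set set" where "countable A" "A \<subseteq> sets lborel" "\<Union>A = space lborel"
    "\<forall>a\<in>A. emeasure lborel a \<noteq> \<infinity>"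
    using lborel.sigma_finite_countable by blast
  then show "\<exists>A :: real set set. countable A \<and> A \<subseteq> sets lebesgue \<and> \<Union>A = space lebesgue \<and>
      (\<forall>a\<in>A. emeasure lebesgue a \<noteq> \<infinity>)"
    by (intro exI[of _ A]) auto
qed

text \<open>Open intervals are stable under intersection and generate the Borel sets, and the sets
  with vanishing integral form a Dynkin class once the whole line is known to belong to it, by
  exhaustion. A Lebesgue set differs from a Borel set by a null set.\<close>

lemma AE_zero_if_interval_integrals_zero:
  fixes f :: "real \<Rightarrow> complex"
  assumes f: "integrable lebesgue f"
    and z: "\<And>a b. a < b \<Longrightarrow> set_lebesgue_integral lebesgue {a<..<b} f = 0"
  shows "AE x in lebesgue. f x = 0"
proof (rule sigma_finite_measure.density_zero[OF sigma_finite_lebesgue f])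
  have si: "set_integrable lebesgue A f" if "A \<in> sets lebesgue" for A
    unfolding set_integrable_def using that f by (rule integrable_mult_indicator)
  have U: "integral\<^sup>L lebesgue f = 0"
  proof -
    have "(\<lambda>n. \<integral>x. indicator {- real (Suc n)<..<real (Suc n)} x *\<^sub>R f x \<partial>lebesgue) \<longlonglongrightarrow> integral\<^sup>L lebesgue f"
    proof (rule integral_dominated_convergence[where w="\<lambda>x. norm (f x)"])
      show "AE x in lebesgue. (\<lambda>n. indicator {- real (Suc n)<..<real (Suc n)} x *\<^sub>R f x) \<longlonglongrightarrow> f x"
      proof (intro always_eventually allI)
        fix x
        obtain N where N: "\<bar>x\<bar> < real N" using reals_Archimedean2 by blast
        have "\<forall>\<^sub>F n in sequentially. indicator {- real (Suc n)<..<real (Suc n)} x *\<^sub>R f x = f x"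
          unfolding eventually_sequentially
          by (rule exI[of _ N]) (use N in \<open>auto simp: indicator_def\<close>)
        then show "(\<lambda>n. indicator {- real (Suc n)<..<real (Suc n)} x *\<^sub>R f x) \<longlonglongrightarrow> f x"
          by (rule tendsto_eventually)
      qed
      show "(\<lambda>x. indicator {- real (Suc n)<..<real (Suc n)} x *\<^sub>R f x) \<in> borel_measurable lebesgue" for n
        using si[of "{- real (Suc n)<..<real (Suc n)}"] by (auto simp: set_integrable_def)
    qed (use f in \<open>auto simp: indicator_def intro!: always_eventually\<close>)
    moreover have "(\<integral>x. indicator {- real (Suc n)<..<real (Suc n)} x *\<^sub>R f x \<partial>lebesgue) = 0" for n
      using z[of "- real (Suc n)" "real (Suc n)"] by (simp add: set_lebesgue_integral_def)
    ultimately show ?thesis by (simp add: LIMSEQ_const_iff)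
  qed
  have eq: "sets borel = sigma_sets UNIV (range (\<lambda>(a::real, b). {a<..<b}))"
  proof -
    have "(\<lambda>(a::real, b). box a b) = (\<lambda>(a, b). {a<..<b})"
      by (auto simp: fun_eq_iff box_real)
    then have "borel = sigma UNIV (range (\<lambda>(a::real, b). {a<..<b}))"
      using borel_eq_box[where 'a=real] by (rule back_subst[where P="\<lambda>g. borel = sigma UNIV (range g)", rotated])
    then show ?thesis by (metis sets_measure_of_conv Pow_UNIV subset_UNIV)
  qed
  have sig: "A \<in> sets lebesgue" if "A \<in> sigma_sets UNIV (range (\<lambda>(a::real, b). {a<..<b}))" for A
    using that unfolding eq[symmetric] by (simp add: sets_completionI_sets)
  have borel: "set_lebesgue_integral lebesgue A f = 0" if "A \<in> sets borel" for A
  proof -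
    let ?G = "range (\<lambda>(a::real, b). {a<..<b})"
    have "A \<in> sigma_sets UNIV ?G"
      using that by (simp only: eq)
    then show ?thesis
    proof (rule sigma_sets_induct_disjoint[rotated 2])
      show "Int_stable ?G"
      proof (rule Int_stableI_image)
        fix i j :: "real \<times> real"
        show "\<exists>k\<in>UNIV. (case i of (a, b) \<Rightarrow> {a<..<b}) \<inter> (case j of (a, b) \<Rightarrow> {a<..<b}) = (case k of (a, b) \<Rightarrow> {a<..<b})"
          by (intro bexI[of _ "(max (fst i) (fst j), min (snd i) (snd j))"]) (auto split: prod.splits)
      qed
      show "set_lebesgue_integral lebesgue A f = 0" if AG: "A \<in> ?G" for A
      proof -
        obtain a b where A: "A = {a<..<b}" using AG by auto
        show ?thesis using z[of a b] by (cases "a < b") (simp_all add: A set_lebesgue_integral_def)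
      qed
      show "set_lebesgue_integral lebesgue {} f = 0" by (simp add: set_lebesgue_integral_def)
      show "set_lebesgue_integral lebesgue (UNIV - A) f = 0"
        if A: "A \<in> sigma_sets UNIV ?G" and 0: "set_lebesgue_integral lebesgue A f = 0" for A
      proof -
        have A': "A \<in> sets lebesgue"
          using A by (rule sig)
        have "set_lebesgue_integral lebesgue (A \<union> (UNIV - A)) f
            = set_lebesgue_integral lebesgue A f + set_lebesgue_integral lebesgue (UNIV - A) f"
          using A' by (intro set_integral_Un si) auto
        then show ?thesis using U 0 by (simp add: set_lebesgue_integral_def)
      qed
      show "set_lebesgue_integral lebesgue (\<Union>i. A i) f = 0"
        if dis: "disjoint_family A" and A: "range A \<subseteq> sigma_sets UNIV ?G"
          and 0: "\<And>i. set_lebesgue_integral lebesgue (A i) f = 0" for A :: "nat \<Rightarrow> real set"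
      proof -
        have A': "A i \<in> sets lebesgue" for i
          using A by (intro sig) auto
        have "set_lebesgue_integral lebesgue (\<Union>i. A i) f = (\<Sum>i. set_lebesgue_integral lebesgue (A i) f)"
          by (rule lebesgue_integral_countable_add)
            (use A' dis in \<open>auto simp: disjoint_family_on_def intro!: si\<close>)
        then show ?thesis by (simp add: 0)
      qed
    qed auto
  qed
  fix A :: "real set" assume A: "A \<in> sets lebesgue"
  obtain C T where CT: "fsigma C" and T: "T \<in> null_sets lebesgue" and A_eq: "C \<union> T = A" and dis: "disjnt C T"
    by (rule lebesgue_set_almost_fsigma[OF A])
  have C: "C \<in> sets borel"
    using CT by cases auto
  have "set_lebesgue_integral lebesgue A f = set_lebesgue_integral lebesgue C f + set_lebesgue_integral lebesgue T f"
    unfolding A_eq[symmetric]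
    by (intro set_integral_Un si) (use C T dis in \<open>auto simp: disjnt_def null_setsD2\<close>)
  moreover have "set_lebesgue_integral lebesgue T f = 0"
    unfolding set_lebesgue_integral_def
    using AE_not_in[OF T] by (intro integral_eq_zero_AE) (auto elim: eventually_mono)
  ultimately show "set_lebesgue_integral lebesgue A f = 0" using borel[OF C] by simp
qed

lemma smooth_fun_bump_interval:
  "smooth_fun (\<lambda>x. of_real (bump (n * (x - a)) * bump (n * (b - x))))"
proof -
  have "smooth_fun (\<lambda>x. of_real (bump (n * x + (- n * a))) * of_real (bump ((- n) * x + n * b)))"
    by (intro smooth_fun_mult smooth_fun_affine[OF smooth_fun_bump])
  then show ?thesis by (simp add: algebra_simps)
qed

text \<open>Ever steeper bumps on an interval increase to its indicator, so \<open>v\<close> has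
  zero integral over every bounded interval in the half-line. Localization to
  \<open>{c<..<d}\<close> is necessary because \<open>v\<close> is integrable only on bounded
  pieces.\<close>

lemma fundamental_lemma:
  assumes v: "v \<in> L2" and z: "\<And>\<phi>. \<phi> \<in> test_funs \<Longrightarrow> (\<integral>x. v x * \<phi> x \<partial>halfline) = 0"
  shows "AE x in halfline. v x = 0"
proof -
  have meas: "v \<in> borel_measurable halfline" using L2_D(1)[OF v] .
  have intA: "integrable halfline (\<lambda>x. indicator {a<..<b} x *\<^sub>R v x)" if "0 < a" for a b :: real
  proof -
    have "integrable lborel (indicator {a..b} :: real \<Rightarrow> real)"
      by (intro integrable_real_indicator) (auto simp: emeasure_lborel_Icc_eq)
    then have "integrable halfline (indicator {a..b} :: real \<Rightarrow> real)"
      using integrable_mult_indicator[of "{0<..}" lborel "indicator {a..b} :: real \<Rightarrow> real"]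
      by (simp add: integrable_restrict_space integrable_completion)
    moreover have "(\<lambda>x. (cmod (complex_of_real (indicator {a..b} x)))\<^sup>2) = indicator {a..b}"
      by (auto simp: indicator_def fun_eq_iff)
    ultimately have "(\<lambda>x. complex_of_real (indicator {a..b} x)) \<in> L2"
      unfolding L2_def by (auto dest: borel_measurable_integrable)
    from L2_mult_integrable[OF this v]
    have "integrable halfline (\<lambda>x. indicator {a<..<b} x *\<^sub>R (complex_of_real (indicator {a..b} x) * v x))"
      by (rule integrable_mult_indicator[rotated]) (simp add: sets_restrict_space_iff that, use that in auto)
    moreover have "(\<lambda>x. indicator {a<..<b} x *\<^sub>R (complex_of_real (indicator {a..b} x) * v x))
       = (\<lambda>x. indicator {a<..<b} x *\<^sub>R v x)"
      by (auto simp: indicator_def fun_eq_iff)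
    ultimately show ?thesis by simp
  qed
  have zero: "(\<integral>x. indicator {a<..<b} x *\<^sub>R v x \<partial>halfline) = 0" if ab: "0 < a" "a < b" for a b :: real
  proof -
    define \<phi> where "\<phi> n x = complex_of_real (bump (real (Suc n) * (x - a)) * bump (real (Suc n) * (b - x)))" for n x
    have \<phi>: "\<phi> n \<in> test_funs" for n
      unfolding \<phi>_def[abs_def]
      by (rule test_funsI[of _ a b], rule smooth_fun_bump_interval)
        (use ab in \<open>auto simp: bump_eq zero_less_mult_iff\<close>)
    have le: "cmod (\<phi> n x) \<le> indicator {a<..<b} x" for n x
    proof (cases "x \<in> {a<..<b}")
      case True
      then show ?thesis by (simp add: \<phi>_def norm_mult mult_le_one)
    next
      case False
      then show ?thesis by (auto simp: \<phi>_def bump_eq zero_less_mult_iff)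
    qed
    have lim: "(\<lambda>n. \<phi> n x) \<longlonglongrightarrow> indicator {a<..<b} x" for x
    proof (cases "x \<in> {a<..<b}")
      case True
      have *: "(\<lambda>n. bump (real (Suc n) * t)) \<longlonglongrightarrow> 1" if "t > 0" for t
      proof -
        have "(\<lambda>n. exp (- (1 / t * inverse (real (Suc n))))) \<longlonglongrightarrow> exp (- (1 / t * 0))"
          by (intro tendsto_intros LIMSEQ_inverse_real_of_nat)
        then show ?thesis using that by (simp add: bump_eq divide_inverse mult_ac)
      qed
      have "(\<lambda>n. \<phi> n x) \<longlonglongrightarrow> complex_of_real (1 * 1)"
        unfolding \<phi>_def by (intro tendsto_of_real tendsto_mult *) (use True in auto)
      then show ?thesis using True by simp
    next
      case False
      then have "\<phi> n x = 0" for n by (auto simp: \<phi>_def bump_eq zero_less_mult_iff)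
      then show ?thesis using False by simp
    qed
    have "(\<lambda>n. \<integral>x. v x * \<phi> n x \<partial>halfline) \<longlonglongrightarrow> (\<integral>x. indicator {a<..<b} x *\<^sub>R v x \<partial>halfline)"
    proof (rule integral_dominated_convergence[where w="\<lambda>x. norm (indicator {a<..<b} x *\<^sub>R v x)"])
      show "integrable halfline (\<lambda>x. norm (indicator {a<..<b} x *\<^sub>R v x))"
        using intA ab by (intro integrable_norm) auto
      show "AE x in halfline. (\<lambda>n. v x * \<phi> n x) \<longlonglongrightarrow> indicator {a<..<b} x *\<^sub>R v x"
      proof (intro always_eventually allI)
        fix x
        have "(\<lambda>n. v x * \<phi> n x) \<longlonglongrightarrow> v x * indicator {a<..<b} x"
          by (intro tendsto_intros lim)
        then show "(\<lambda>n. v x * \<phi> n x) \<longlonglongrightarrow> indicator {a<..<b} x *\<^sub>R v x"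
          by (cases "x \<in> {a<..<b}") simp_all
      qed
      show "AE x in halfline. norm (v x * \<phi> n x) \<le> norm (indicator {a<..<b} x *\<^sub>R v x)" for n
      proof (intro always_eventually allI)
        fix x
        show "norm (v x * \<phi> n x) \<le> norm (indicator {a<..<b} x *\<^sub>R v x)"
          using mult_left_mono[OF le[of n x], of "cmod (v x)"] by (simp add: norm_mult mult.commute)
      qed
      show "(\<lambda>x. v x * \<phi> n x) \<in> borel_measurable halfline" for n
        by (rule borel_measurable_times[OF meas L2_D(1)[OF test_fun_L2[OF \<phi>]]])
      show "(\<lambda>x. indicator {a<..<b} x *\<^sub>R v x) \<in> borel_measurable halfline"
        by (rule borel_measurable_integrable[OF intA[OF ab(1)]])
    qed
    then show ?thesis using z[OF \<phi>] by (simp add: LIMSEQ_const_iff)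
  qed
  have loc: "AE x in halfline. x \<in> {c<..<d} \<longrightarrow> v x = 0" if cd: "0 < c" "c < d" for c d :: real
  proof -
    let ?f = "\<lambda>x. indicator {0<..} x *\<^sub>R (indicator {c<..<d} x *\<^sub>R v x)"
    have f: "integrable lebesgue ?f"
      using intA[OF cd(1), of d] by (simp add: integrable_restrict_space)
    have "AE x in lebesgue. ?f x = 0"
    proof (rule AE_zero_if_interval_integrals_zero[OF f])
      fix a b :: real assume "a < b"
      have "set_lebesgue_integral lebesgue {a<..<b} ?f
          = (\<integral>x. indicator {0<..} x *\<^sub>R (indicator {max a c<..<min b d} x *\<^sub>R v x) \<partial>lebesgue)"
        unfolding set_lebesgue_integral_def
        by (intro Bochner_Integration.integral_cong) (auto simp: indicator_def)
      also have "\<dots> = (\<integral>x. indicator {max a c<..<min b d} x *\<^sub>R v x \<partial>halfline)"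
        by (simp add: integral_restrict_space)
      also have "\<dots> = 0"
      proof (cases "max a c < min b d")
        case True
        then show ?thesis using cd by (intro zero) auto
      next
        case False
        then have "{max a c<..<min b d} = {}" by auto
        then show ?thesis by simp
      qed
      finally show "set_lebesgue_integral lebesgue {a<..<b} ?f = 0" .
    qed
    then have "AE x in lebesgue. x \<in> {0<..} \<longrightarrow> x \<in> {c<..<d} \<longrightarrow> v x = 0"
      by eventually_elim (auto simp: indicator_def split: if_splits)
    then show ?thesis by (simp add: AE_restrict_space_iff)
  qed
  have "AE x in halfline. \<forall>n. x \<in> {1 / real (Suc n)<..<real (Suc n) + 1} \<longrightarrow> v x = 0"
  proof (subst AE_all_countable, intro allI loc)
    fix n :: nat
    show "0 < 1 / real (Suc n)" by simp
    have "1 / real (Suc n) \<le> 1" by simp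
    also have "1 < real (Suc n) + 1" by simp
    finally show "1 / real (Suc n) < real (Suc n) + 1" .
  qed
  then have "AE x in lebesgue. x \<in> {0<..} \<longrightarrow> (\<forall>n. x \<in> {1 / real (Suc n)<..<real (Suc n) + 1} \<longrightarrow> v x = 0)"
    by (simp add: AE_restrict_space_iff)
  then have "AE x in lebesgue. x \<in> {0<..} \<longrightarrow> v x = 0"
  proof eventually_elim
    case (elim x)
    show ?case
    proof
      assume x: "x \<in> {0<..}"
      obtain n where n: "max x (1 / x) < real n" using reals_Archimedean2 by blast
      then have "1 / x < real (Suc n)" "x < real (Suc n) + 1" by auto
      then have "x \<in> {1 / real (Suc n)<..<real (Suc n) + 1}"
        using x by (auto simp: field_simps)
      then show "v x = 0" using elim x by blast
    qed
  qed
  then show ?thesis by (simp add: AE_restrict_space_iff)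
qed

section \<open>Weak derivatives, and the Sobolev space as a space of limits of test
  functions\<close>

lemma weak_deriv_add:
  assumes "has_weak_deriv u v" "has_weak_deriv u' v'" "u \<in> L2" "v \<in> L2" "u' \<in> L2" "v' \<in> L2"
  shows "has_weak_deriv (\<lambda>x. u x + u' x) (\<lambda>x. v x + v' x)"
  unfolding has_weak_deriv_def
proof
  fix \<phi> assume \<phi>: "\<phi> \<in> test_funs"
  note i = L2_mult_integrable[OF _ test_fun_L2[OF \<phi>]] L2_mult_integrable[OF _ test_fun_L2[OF test_fun_dv[OF \<phi>]]]
  show "(\<integral>x. (u x + u' x) * dv \<phi> x \<partial>halfline) = - (\<integral>x. (v x + v' x) * \<phi> x \<partial>halfline)"
    using assms \<phi> by (simp add: has_weak_deriv_def distrib_right i)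
qed

lemma weak_deriv_scale:
  "has_weak_deriv u v \<Longrightarrow> has_weak_deriv (\<lambda>x. c * u x) (\<lambda>x. c * v x)"
  by (simp add: has_weak_deriv_def mult.assoc)

lemma weak_deriv_diff:
  assumes "has_weak_deriv u v" "has_weak_deriv u' v'" "u \<in> L2" "v \<in> L2" "u' \<in> L2" "v' \<in> L2"
  shows "has_weak_deriv (\<lambda>x. u x - u' x) (\<lambda>x. v x - v' x)"
  using weak_deriv_add[OF assms(1) weak_deriv_scale[OF assms(2), of "-1"] assms(3,4)
      L2_scale[OF assms(5)] L2_scale[OF assms(6)]] by simp

lemma weak_deriv_unique:
  assumes "has_weak_deriv u v" "has_weak_deriv u v'" "v \<in> L2" "v' \<in> L2"
  shows "AE x in halfline. v x = v' x"
proof -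
  have "AE x in halfline. v x - v' x = 0"
  proof (rule fundamental_lemma)
    show "(\<lambda>x. v x - v' x) \<in> L2" by (intro L2_diff assms)
    fix \<phi> assume \<phi>: "\<phi> \<in> test_funs"
    have "- (\<integral>x. v x * \<phi> x \<partial>halfline) = - (\<integral>x. v' x * \<phi> x \<partial>halfline)"
      using assms(1,2) \<phi> by (simp add: has_weak_deriv_def)
    then show "(\<integral>x. (v x - v' x) * \<phi> x \<partial>halfline) = 0"
      using L2_mult_integrable[OF _ test_fun_L2[OF \<phi>]] assms(3,4) by (simp add: left_diff_distrib)
  qed
  then show ?thesis by simp
qed

lemma H1_wderiv: "u \<in> H1 \<Longrightarrow> wderiv u \<in> L2" "u \<in> H1 \<Longrightarrow> has_weak_deriv u (wderiv u)"
  unfolding H1_def wderiv_def by (metis (mono_tags, lifting) mem_Collect_eq someI)+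

lemma wderiv_AE:
  assumes "has_weak_deriv u v" "u \<in> L2" "v \<in> L2"
  shows "u \<in> H1" "wderiv u \<in> L2" "AE x in halfline. wderiv u x = v x"
proof -
  show u: "u \<in> H1" using assms by (auto simp: H1_def)
  show "wderiv u \<in> L2" using H1_wderiv[OF u] by simp
  show "AE x in halfline. wderiv u x = v x"
    using H1_wderiv[OF u] assms by (intro weak_deriv_unique)
qed

text \<open>Convergence in \<open>H1\<close> with the limit derivative \<open>v\<close> carried
  along. This keeps the chosen function \<open>wderiv u\<close>, which is determined only almost
  everywhere, out of the limit arguments.\<close>

definition H1_lim :: "(nat \<Rightarrow> real \<Rightarrow> complex) \<Rightarrow> (real \<Rightarrow> complex) \<Rightarrow> (real \<Rightarrow> complex) \<Rightarrow> bool" where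
  "H1_lim \<phi> u v \<longleftrightarrow> (\<forall>n. \<phi> n \<in> test_funs) \<and> u \<in> L2 \<and> v \<in> L2 \<and>
     (\<lambda>n. sqi (\<lambda>x. u x - \<phi> n x)) \<longlonglongrightarrow> 0 \<and> (\<lambda>n. sqi (\<lambda>x. v x - dv (\<phi> n) x)) \<longlonglongrightarrow> 0"

lemma H1_lim_weak_deriv:
  assumes "H1_lim \<phi> u v"
  shows "has_weak_deriv u v"
  unfolding has_weak_deriv_def
proof
  fix \<psi> assume \<psi>: "\<psi> \<in> test_funs"
  have 1: "(\<lambda>n. \<integral>x. \<phi> n x * dv \<psi> x \<partial>halfline) \<longlonglongrightarrow> (\<integral>x. u x * dv \<psi> x \<partial>halfline)"
    using assms \<psi> by (intro tendsto_L2_mult) (auto simp: H1_lim_def intro: test_fun_L2 test_fun_dv)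
  have 2: "(\<lambda>n. \<integral>x. dv (\<phi> n) x * \<psi> x \<partial>halfline) \<longlonglongrightarrow> (\<integral>x. v x * \<psi> x \<partial>halfline)"
    using assms \<psi> by (intro tendsto_L2_mult) (auto simp: H1_lim_def intro: test_fun_L2 test_fun_dv)
  have "(\<integral>x. \<phi> n x * dv \<psi> x \<partial>halfline) = - (\<integral>x. dv (\<phi> n) x * \<psi> x \<partial>halfline)" for n
    using test_fun_weak_deriv[of "\<phi> n"] assms \<psi> by (simp add: H1_lim_def has_weak_deriv_def)
  then have "(\<lambda>n. \<integral>x. \<phi> n x * dv \<psi> x \<partial>halfline) \<longlonglongrightarrow> - (\<integral>x. v x * \<psi> x \<partial>halfline)"
    using tendsto_minus[OF 2] by simp
  then show "(\<integral>x. u x * dv \<psi> x \<partial>halfline) = - (\<integral>x. v x * \<psi> x \<partial>halfline)"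
    by (rule LIMSEQ_unique[OF 1])
qed

lemma H1_norm_sq: "(H1_norm u)\<^sup>2 = sqi u + sqi (wderiv u)"
  by (simp add: H1_norm_def Lnorm_2)

lemma H1_lim_D:
  assumes "H1_lim \<phi> u v"
  shows "u \<in> H10" "wderiv u \<in> L2" "AE x in halfline. wderiv u x = v x"
proof -
  have L: "\<And>n. \<phi> n \<in> test_funs" "u \<in> L2" "v \<in> L2" "(\<lambda>n. sqi (\<lambda>x. u x - \<phi> n x)) \<longlonglongrightarrow> 0"
    "(\<lambda>n. sqi (\<lambda>x. v x - dv (\<phi> n) x)) \<longlonglongrightarrow> 0"
    using assms by (auto simp: H1_lim_def)
  note w = wderiv_AE[OF H1_lim_weak_deriv[OF assms] L(2,3)]
  show "wderiv u \<in> L2" "AE x in halfline. wderiv u x = v x" using w by auto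
  have eq: "(H1_norm (\<lambda>x. u x - \<phi> n x))\<^sup>2 = sqi (\<lambda>x. u x - \<phi> n x) + sqi (\<lambda>x. v x - dv (\<phi> n) x)" for n
  proof -
    have "has_weak_deriv (\<lambda>x. u x - \<phi> n x) (\<lambda>x. v x - dv (\<phi> n) x)"
      by (intro weak_deriv_diff H1_lim_weak_deriv[OF assms] test_fun_weak_deriv L test_fun_L2 test_fun_dv)
    note w' = wderiv_AE[OF this L2_diff[OF L(2) test_fun_L2[OF L(1)]] L2_diff[OF L(3) test_fun_L2[OF test_fun_dv[OF L(1)]]]]
    have "sqi (wderiv (\<lambda>x. u x - \<phi> n x)) = sqi (\<lambda>x. v x - dv (\<phi> n) x)"
      by (rule sqi_cong_AE[OF w'(3) L2_D(1)[OF w'(2)]])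
        (intro L2_D(1) L2_diff L test_fun_L2 test_fun_dv)
    then show ?thesis by (simp add: H1_norm_sq)
  qed
  have lim: "(\<lambda>n. (H1_norm (\<lambda>x. u x - \<phi> n x))\<^sup>2) \<longlonglongrightarrow> 0"
    unfolding eq using tendsto_add[OF L(4,5)] by simp
  have "\<exists>\<psi>\<in>test_funs. H1_norm (\<lambda>x. u x - \<psi> x) < e" if "e > 0" for e
  proof -
    have "\<forall>\<^sub>F n in sequentially. (H1_norm (\<lambda>x. u x - \<phi> n x))\<^sup>2 < e\<^sup>2"
      using order_tendstoD(2)[OF lim, of "e\<^sup>2"] that by simp
    then obtain n where "(H1_norm (\<lambda>x. u x - \<phi> n x))\<^sup>2 < e\<^sup>2"
      using eventually_happens'[OF sequentially_bot] by blast
    then have "H1_norm (\<lambda>x. u x - \<phi> n x) < e"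
      by (rule power_less_imp_less_base) (use that in simp)
    then show ?thesis using L(1) by blast
  qed
  then show "u \<in> H10" using w(1) by (auto simp: H10_def)
qed

text \<open>Together with \<open>H1_lim_D\<close> this describes \<open>H10\<close> as the set of
  such limits, so statements about \<open>H10\<close> reduce to test functions and a passage to the
  limit.\<close>

lemma H10_lim:
  assumes "u \<in> H10"
  obtains \<phi> where "H1_lim \<phi> u (wderiv u)"
proof -
  have u: "u \<in> H1" "u \<in> L2" using assms by (auto simp: H10_def H1_def)
  note w = H1_wderiv[OF u(1)]
  have "\<exists>\<psi>\<in>test_funs. H1_norm (\<lambda>x. u x - \<psi> x) < inverse (real (Suc n))" for n
    using assms by (simp add: H10_def)
  then obtain \<phi> where \<phi>: "\<And>n. \<phi> n \<in> test_funs" "\<And>n. H1_norm (\<lambda>x. u x - \<phi> n x) < inverse (real (Suc n))"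
    by metis
  have eq: "sqi (wderiv (\<lambda>x. u x - \<phi> n x)) = sqi (\<lambda>x. wderiv u x - dv (\<phi> n) x)" for n
  proof -
    have "has_weak_deriv (\<lambda>x. u x - \<phi> n x) (\<lambda>x. wderiv u x - dv (\<phi> n) x)"
      by (intro weak_deriv_diff w test_fun_weak_deriv \<phi> u test_fun_L2 test_fun_dv)
    note w' = wderiv_AE[OF this L2_diff[OF u(2) test_fun_L2[OF \<phi>(1)]] L2_diff[OF w(1) test_fun_L2[OF test_fun_dv[OF \<phi>(1)]]]]
    show ?thesis
      by (rule sqi_cong_AE[OF w'(3) L2_D(1)[OF w'(2)]])
        (intro L2_D(1) L2_diff \<phi> w test_fun_L2 test_fun_dv)
  qed
  have b: "sqi (\<lambda>x. u x - \<phi> n x) + sqi (\<lambda>x. wderiv u x - dv (\<phi> n) x) \<le> (inverse (real (Suc n)))\<^sup>2" for n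
    using power_mono[OF less_imp_le[OF \<phi>(2)[of n]], of 2] H1_norm_sq[of "\<lambda>x. u x - \<phi> n x"]
    by (simp add: eq H1_norm_def)
  have l0: "(\<lambda>n. (inverse (real (Suc n)))\<^sup>2) \<longlonglongrightarrow> 0"
    using tendsto_power[OF LIMSEQ_inverse_real_of_nat, of 2] by simp
  have "(\<lambda>n. sqi (\<lambda>x. u x - \<phi> n x)) \<longlonglongrightarrow> 0"
  proof (rule Lim_null_comparison[OF always_eventually l0], intro allI)
    show "norm (sqi (\<lambda>x. u x - \<phi> n x)) \<le> (inverse (real (Suc n)))\<^sup>2" for n
      unfolding real_norm_def abs_of_nonneg[OF sqi_nonneg]
      using b[of n] sqi_nonneg[of "\<lambda>x. wderiv u x - dv (\<phi> n) x"] by linarith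
  qed
  moreover have "(\<lambda>n. sqi (\<lambda>x. wderiv u x - dv (\<phi> n) x)) \<longlonglongrightarrow> 0"
  proof (rule Lim_null_comparison[OF always_eventually l0], intro allI)
    show "norm (sqi (\<lambda>x. wderiv u x - dv (\<phi> n) x)) \<le> (inverse (real (Suc n)))\<^sup>2" for n
      unfolding real_norm_def abs_of_nonneg[OF sqi_nonneg]
      using b[of n] sqi_nonneg[of "\<lambda>x. u x - \<phi> n x"] by linarith
  qed
  ultimately have "H1_lim \<phi> u (wderiv u)"
    unfolding H1_lim_def using \<phi>(1) u w by blast
  then show ?thesis by (rule that)
qed

lemma H10_L2: "u \<in> H10 \<Longrightarrow> u \<in> L2" "u \<in> H10 \<Longrightarrow> wderiv u \<in> L2"
  using H1_wderiv(1)[of u] by (auto simp: H10_def H1_def)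

lemma test_fun_H10:
  assumes "\<phi> \<in> test_funs"
  shows "\<phi> \<in> H10" "AE x in halfline. wderiv \<phi> x = dv \<phi> x"
proof -
  have "H1_lim (\<lambda>n. \<phi>) \<phi> (dv \<phi>)"
    using assms by (simp add: H1_lim_def test_fun_L2 test_fun_dv sqi_def)
  from H1_lim_D[OF this] show "\<phi> \<in> H10" "AE x in halfline. wderiv \<phi> x = dv \<phi> x" by auto
qed

lemma H1_lim_add:
  assumes "H1_lim \<phi> u v" "H1_lim \<psi> u' v'"
  shows "H1_lim (\<lambda>n x. \<phi> n x + \<psi> n x) (\<lambda>x. u x + u' x) (\<lambda>x. v x + v' x)"
proof -
  have *: "(\<lambda>n. sqi (\<lambda>x. (f x + g x) - (a n x + b n x))) \<longlonglongrightarrow> 0"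
    if "f \<in> L2" "g \<in> L2" "\<And>n. a n \<in> L2" "\<And>n. b n \<in> L2" "(\<lambda>n. sqi (\<lambda>x. f x - a n x)) \<longlonglongrightarrow> 0"
     "(\<lambda>n. sqi (\<lambda>x. g x - b n x)) \<longlonglongrightarrow> 0" for f g a b
  proof -
    have "(\<lambda>n. sqrt (sqi (\<lambda>x. (f x + g x) - (a n x + b n x)))) \<longlonglongrightarrow> 0"
    proof (rule Lim_null_comparison[OF always_eventually], intro allI)
      show "norm (sqrt (sqi (\<lambda>x. (f x + g x) - (a n x + b n x))))
        \<le> sqrt (sqi (\<lambda>x. f x - a n x)) + sqrt (sqi (\<lambda>x. g x - b n x))" for n
        using L2_triangle[OF L2_diff[OF that(1) that(3)[of n]] L2_diff[OF that(2) that(4)[of n]]]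
        by (simp add: algebra_simps)
      show "(\<lambda>n. sqrt (sqi (\<lambda>x. f x - a n x)) + sqrt (sqi (\<lambda>x. g x - b n x))) \<longlonglongrightarrow> 0"
        using tendsto_add[OF tendsto_real_sqrt[OF that(5)] tendsto_real_sqrt[OF that(6)]] by simp
    qed
    from tendsto_power[OF this, of 2] show ?thesis by simp
  qed
  have L: "\<And>n. \<phi> n \<in> test_funs" "u \<in> L2" "v \<in> L2" "(\<lambda>n. sqi (\<lambda>x. u x - \<phi> n x)) \<longlonglongrightarrow> 0"
    "(\<lambda>n. sqi (\<lambda>x. v x - dv (\<phi> n) x)) \<longlonglongrightarrow> 0"
    using assms(1) unfolding H1_lim_def by blast+
  have L': "\<And>n. \<psi> n \<in> test_funs" "u' \<in> L2" "v' \<in> L2" "(\<lambda>n. sqi (\<lambda>x. u' x - \<psi> n x)) \<longlonglongrightarrow> 0"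
    "(\<lambda>n. sqi (\<lambda>x. v' x - dv (\<psi> n) x)) \<longlonglongrightarrow> 0"
    using assms(2) unfolding H1_lim_def by blast+
  have 1: "(\<lambda>n. sqi (\<lambda>x. (u x + u' x) - (\<phi> n x + \<psi> n x))) \<longlonglongrightarrow> 0"
    by (rule *) (use L L' in \<open>auto intro: test_fun_L2\<close>)
  have 2: "(\<lambda>n. sqi (\<lambda>x. (v x + v' x) - (dv (\<phi> n) x + dv (\<psi> n) x))) \<longlonglongrightarrow> 0"
    by (rule *) (use L L' in \<open>auto intro: test_fun_L2 test_fun_dv\<close>)
  show ?thesis
    unfolding H1_lim_def dv_add[OF L(1) L'(1)]
    by (intro conjI allI test_fun_add L2_add L L' 1 2)
qed

lemma H1_lim_scale:
  assumes "H1_lim \<phi> u v"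
  shows "H1_lim (\<lambda>n x. c * \<phi> n x) (\<lambda>x. c * u x) (\<lambda>x. c * v x)"
proof -
  have *: "(\<lambda>n. sqi (\<lambda>x. c * f x - c * a n x)) \<longlonglongrightarrow> 0" if "(\<lambda>n. sqi (\<lambda>x. f x - a n x)) \<longlonglongrightarrow> 0" for f a
    using tendsto_mult_left[OF that, of "(cmod c)\<^sup>2"] by (simp add: sqi_scale flip: right_diff_distrib)
  show ?thesis
    using assms unfolding H1_lim_def
    by (auto simp: dv_scale intro!: test_fun_scale L2_scale *)
qed

lemma H1_lim_cnj:
  assumes "H1_lim \<phi> u v"
  shows "H1_lim (\<lambda>n x. cnj (\<phi> n x)) (\<lambda>x. cnj (u x)) (\<lambda>x. cnj (v x))"
  using assms unfolding H1_lim_def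
  by (auto simp: dv_cnj intro!: test_fun_cnj L2_cnj simp flip: complex_cnj_diff)

lemma
  assumes "u \<in> H10" "u' \<in> H10"
  shows H10_add: "(\<lambda>x. u x + u' x) \<in> H10"
    and wderiv_add: "AE x in halfline. wderiv (\<lambda>x. u x + u' x) x = wderiv u x + wderiv u' x"
proof -
  obtain \<phi> \<psi> where "H1_lim \<phi> u (wderiv u)" "H1_lim \<psi> u' (wderiv u')"
    using H10_lim[OF assms(1)] H10_lim[OF assms(2)] by metis
  from H1_lim_D[OF H1_lim_add[OF this]]
  show "(\<lambda>x. u x + u' x) \<in> H10"
    "AE x in halfline. wderiv (\<lambda>x. u x + u' x) x = wderiv u x + wderiv u' x" by blast+
qed

lemma
  assumes "u \<in> H10"
  shows H10_scale: "(\<lambda>x. c * u x) \<in> H10"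
    and wderiv_scale: "AE x in halfline. wderiv (\<lambda>x. c * u x) x = c * wderiv u x"
proof -
  obtain \<phi> where "H1_lim \<phi> u (wderiv u)" using H10_lim[OF assms] .
  from H1_lim_D[OF H1_lim_scale[OF this, of c]]
  show "(\<lambda>x. c * u x) \<in> H10" "AE x in halfline. wderiv (\<lambda>x. c * u x) x = c * wderiv u x"
    by blast+
qed

lemma
  assumes "u \<in> H10"
  shows H10_cnj: "(\<lambda>x. cnj (u x)) \<in> H10"
    and wderiv_cnj: "AE x in halfline. wderiv (\<lambda>x. cnj (u x)) x = cnj (wderiv u x)"
proof -
  obtain \<phi> where "H1_lim \<phi> u (wderiv u)" using H10_lim[OF assms] .
  from H1_lim_D[OF H1_lim_cnj[OF this]]
  show "(\<lambda>x. cnj (u x)) \<in> H10" "AE x in halfline. wderiv (\<lambda>x. cnj (u x)) x = cnj (wderiv u x)"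
    by blast+
qed

section \<open>Dilations\<close>

lemma dilate_measurable: "0 < l \<Longrightarrow> (\<lambda>x. l * x) \<in> halfline \<rightarrow>\<^sub>M halfline" for l :: real
proof -
  assume l: "0 < l"
  have "(\<lambda>x. l *\<^sub>R x) \<in> lebesgue \<rightarrow>\<^sub>M (lebesgue :: real measure)"
    by (rule lebesgue_measurable_scaling)
  then show ?thesis
    using l by (intro measurable_restrict_space3) auto
qed

text \<open>The change of variables is stated for the measure itself, so that it serves
  measurability, integrability and integrals of functions with values in any admissible space at
  once.\<close>

lemma distr_dilate:
  assumes "0 < (l::real)"
  shows "distr halfline halfline (\<lambda>x. l * x) = density halfline (\<lambda>_. ennreal (1 / l))"
proof (rule measure_eqI)
  fix A assume "A \<in> sets (distr halfline halfline (\<lambda>x. l * x))"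
  then have A: "A \<in> sets halfline" by simp
  then have A': "A \<in> sets lebesgue" "A \<subseteq> {0<..}"
    by (auto simp: sets_restrict_space_iff)
  have e: "emeasure halfline B = emeasure lebesgue B" if "B \<subseteq> {0<..}" for B
    using that by (intro emeasure_restrict_space) auto
  let ?B = "(\<lambda>x. l * x) -` A \<inter> space halfline"
  have B: "?B \<in> sets halfline"
    using dilate_measurable[OF assms] A by (rule measurable_sets)
  then have B': "?B \<in> sets lebesgue" by (auto simp: sets_restrict_space_iff)
  have "emeasure halfline ?B = emeasure lebesgue ?B"
    by (intro e) (auto simp: space_restrict_space)
  also have "\<dots> = (\<integral>\<^sup>+x. indicator ?B x \<partial>lebesgue)"
    using B' by simp
  also have "\<dots> = (\<integral>\<^sup>+x. indicator A (0 + l * x) \<partial>lebesgue)"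
    using A' assms by (intro nn_integral_cong) (auto simp: indicator_def space_restrict_space zero_less_mult_iff)
  finally have 1: "emeasure halfline ?B = (\<integral>\<^sup>+x. indicator A (0 + l * x) \<partial>lebesgue)" .
  have "emeasure lebesgue A = (\<integral>\<^sup>+x. indicator A x \<partial>lebesgue)" using A' by simp
  also have "\<dots> = ennreal \<bar>l\<bar> * (\<integral>\<^sup>+x. indicator A (0 + l * x) \<partial>lebesgue)"
    using A' assms by (intro nn_integral_real_affine_lebesgue) auto
  finally have 2: "emeasure lebesgue A = ennreal l * emeasure halfline ?B"
    using assms unfolding 1 by simp
  have "ennreal (1 / l) * emeasure halfline A = emeasure halfline ?B"
    unfolding e[OF A'(2)] 2 mult.assoc[symmetric] using assms by (simp flip: ennreal_mult)
  then show "emeasure (distr halfline halfline (\<lambda>x. l * x)) A = emeasure (density halfline (\<lambda>_. ennreal (1 / l))) A"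
    using A dilate_measurable[OF assms]
    by (simp add: emeasure_distr emeasure_density nn_integral_cmult_indicator)
qed simp

lemma
  fixes f :: "real \<Rightarrow> 'b::{banach, second_countable_topology}"
  assumes "0 < l" "f \<in> borel_measurable halfline"
  shows measurable_dilate: "(\<lambda>x. f (l * x)) \<in> borel_measurable halfline"
    and integral_dilate: "(\<integral>x. f (l * x) \<partial>halfline) = (1 / l) *\<^sub>R (\<integral>x. f x \<partial>halfline)"
    and integrable_dilate: "integrable halfline f \<Longrightarrow> integrable halfline (\<lambda>x. f (l * x))"
proof -
  note m = dilate_measurable[OF assms(1)]
  show "(\<lambda>x. f (l * x)) \<in> borel_measurable halfline"
    by (rule measurable_compose[OF m assms(2)])
  have "(\<integral>x. f (l * x) \<partial>halfline) = integral\<^sup>L (density halfline (\<lambda>_. ennreal (1 / l))) f"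
    using integral_distr[OF m assms(2)] by (simp add: distr_dilate[OF assms(1)])
  also have "\<dots> = (1 / l) *\<^sub>R (\<integral>x. f x \<partial>halfline)"
    using assms by (subst integral_density) auto
  finally show "(\<integral>x. f (l * x) \<partial>halfline) = (1 / l) *\<^sub>R (\<integral>x. f x \<partial>halfline)" .
  assume i: "integrable halfline f"
  have "integrable (density halfline (\<lambda>_. ennreal (1 / l))) f"
    using assms i by (subst integrable_density) auto
  then show "integrable halfline (\<lambda>x. f (l * x))"
    using integrable_distr_eq[OF m assms(2)] by (simp add: distr_dilate[OF assms(1)])
qed

lemma L2_dilate:
  assumes "0 < l" "f \<in> L2"
  shows "(\<lambda>x. f (l * x)) \<in> L2" "sqi (\<lambda>x. f (l * x)) = sqi f / l"
proof -
  have m: "(\<lambda>x. (cmod (f x))\<^sup>2) \<in> borel_measurable halfline"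
    using L2_D(2)[OF assms(2)] by (rule borel_measurable_integrable)
  show "(\<lambda>x. f (l * x)) \<in> L2"
    using measurable_dilate[OF assms(1) L2_D(1)[OF assms(2)]]
      integrable_dilate[OF assms(1) m L2_D(2)[OF assms(2)]] by (simp add: L2_def)
  show "sqi (\<lambda>x. f (l * x)) = sqi f / l"
    unfolding sqi_def using integral_dilate[OF assms(1) m] by simp
qed

lemma H1_lim_dilate:
  assumes "0 < l" "H1_lim \<phi> u v"
  shows "H1_lim (\<lambda>n x. \<phi> n (l * x)) (\<lambda>x. u (l * x)) (\<lambda>x. of_real l * v (l * x))"
proof -
  have L: "\<And>n. \<phi> n \<in> test_funs" "u \<in> L2" "v \<in> L2" "(\<lambda>n. sqi (\<lambda>x. u x - \<phi> n x)) \<longlonglongrightarrow> 0"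
    "(\<lambda>n. sqi (\<lambda>x. v x - dv (\<phi> n) x)) \<longlonglongrightarrow> 0"
    using assms(2) unfolding H1_lim_def by blast+
  have 1: "sqi (\<lambda>x. u (l * x) - \<phi> n (l * x)) = sqi (\<lambda>x. u x - \<phi> n x) / l" for n
    by (rule L2_dilate(2)[OF assms(1), of "\<lambda>x. u x - \<phi> n x"]) (intro L2_diff L test_fun_L2)
  have 2: "sqi (\<lambda>x. of_real l * v (l * x) - of_real l * dv (\<phi> n) (l * x)) = l\<^sup>2 * (sqi (\<lambda>x. v x - dv (\<phi> n) x) / l)" for n
  proof -
    have "sqi (\<lambda>x. v (l * x) - dv (\<phi> n) (l * x)) = sqi (\<lambda>x. v x - dv (\<phi> n) x) / l"
      by (rule L2_dilate(2)[OF assms(1), of "\<lambda>x. v x - dv (\<phi> n) x"]) (intro L2_diff L test_fun_L2 test_fun_dv)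
    then show ?thesis
      unfolding right_diff_distrib[symmetric] sqi_scale by simp
  qed
  have "(\<lambda>n. sqi (\<lambda>x. u (l * x) - \<phi> n (l * x))) \<longlonglongrightarrow> 0"
    unfolding 1 using tendsto_divide[OF L(4) tendsto_const[of l]] assms(1) by simp
  moreover have "(\<lambda>n. sqi (\<lambda>x. of_real l * v (l * x) - of_real l * dv (\<phi> n) (l * x))) \<longlonglongrightarrow> 0"
    unfolding 2 using tendsto_mult[OF tendsto_const[of "l\<^sup>2"] tendsto_divide[OF L(5) tendsto_const[of l]]] assms(1) by simp
  ultimately show ?thesis
    unfolding H1_lim_def dv_dilate[OF L(1)]
    using assms(1) by (intro conjI allI test_fun_dilate L L2_scale L2_dilate)
qed

lemma
  assumes "u \<in> H10" "0 < l"
  shows H10_dilate: "(\<lambda>x. u (l * x)) \<in> H10"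
    and wderiv_dilate: "AE x in halfline. wderiv (\<lambda>x. u (l * x)) x = of_real l * wderiv u (l * x)"
proof -
  obtain \<phi> where "H1_lim \<phi> u (wderiv u)" using H10_lim[OF assms(1)] .
  from H1_lim_D[OF H1_lim_dilate[OF assms(2) this]]
  show "(\<lambda>x. u (l * x)) \<in> H10" "AE x in halfline. wderiv (\<lambda>x. u (l * x)) x = of_real l * wderiv u (l * x)"
    by blast+
qed

section \<open>Inequalities for test functions\<close>

lemma halfline_integral_indicator_Icc:
  fixes F :: "real \<Rightarrow> real"
  assumes "0 \<le> r" "continuous_on {r..s} F"
  shows "integrable halfline (\<lambda>x. indicator {r..s} x * F x)"
    "(\<integral>x. indicator {r..s} x * F x \<partial>halfline) = integral {r..s} F"
proof -
  have "integrable lborel (\<lambda>x. indicator {r..s} x *\<^sub>R F x)"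
    by (intro borel_integrable_compact assms) auto
  then have "integrable lebesgue (\<lambda>x. indicator {r..s} x * F x)"
    by (simp add: integrable_completion borel_measurable_integrable)
  then have "integrable lebesgue (\<lambda>x. indicator {0<..} x *\<^sub>R (indicator {r..s} x * F x))"
    by (rule integrable_mult_indicator[rotated]) simp
  then show i: "integrable halfline (\<lambda>x. indicator {r..s} x * F x)"
    by (simp add: integrable_restrict_space)
  have "(\<integral>x. indicator {r..s} x * F x \<partial>halfline) = integral {0<..} (\<lambda>x. indicator {r..s} x * F x)"
    by (rule lebesgue_integral_eq_integral[OF i]) simp
  also have "\<dots> = integral UNIV (\<lambda>x. if x \<in> {0<..} then indicator {r..s} x * F x else 0)"
    by (rule integral_restrict_UNIV[symmetric])
  also have "\<dots> = integral UNIV (\<lambda>x. if x \<in> {r..s} then F x else 0)"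
    by (rule integral_spike[of "{0}"]) (use assms(1) in \<open>auto simp: indicator_def\<close>)
  also have "\<dots> = integral {r..s} F"
    by (rule integral_restrict_UNIV)
  finally show "(\<integral>x. indicator {r..s} x * F x \<partial>halfline) = integral {r..s} F" .
qed

text \<open>The common tool for the estimates below: an integrand that dominates the derivative of
  \<open>g\<close> has integral at least the increment of \<open>g\<close>. Each estimate is a
  choice of \<open>g\<close>.\<close>

lemma FTC_le:
  assumes "0 \<le> r" "r \<le> s" "continuous_on {r..s} F"
    and "\<And>x. r \<le> x \<Longrightarrow> x \<le> s \<Longrightarrow> (g has_real_derivative g' x) (at x)"
    and "\<And>x. r \<le> x \<Longrightarrow> x \<le> s \<Longrightarrow> g' x \<le> F x"
  shows "g s - g r \<le> (\<integral>x. indicator {r..s} x * F x \<partial>halfline)"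
proof -
  have "(g' has_integral g s - g r) {r..s}"
    by (rule fundamental_theorem_of_calculus[OF assms(2)])
      (use assms(4) in \<open>auto simp flip: has_real_derivative_iff_has_vector_derivative
         intro: has_field_derivative_at_within\<close>)
  moreover have "(F has_integral integral {r..s} F) {r..s}"
    by (intro integrable_integral integrable_continuous_real assms)
  ultimately have "g s - g r \<le> integral {r..s} F"
    by (rule has_integral_le) (use assms(5) in auto)
  then show ?thesis using halfline_integral_indicator_Icc(2)[OF assms(1,3)] by simp
qed

lemma has_derivative_cmod_sq:
  assumes "(f has_vector_derivative f') (at x)"
  shows "((\<lambda>x. (cmod (f x))\<^sup>2) has_real_derivative 2 * (f x \<bullet> f')) (at x)"
  using bounded_bilinear.has_vector_derivative[OF bounded_bilinear_inner assms assms]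
  by (simp add: has_real_derivative_iff_has_vector_derivative power2_norm_eq_inner inner_commute)

lemma inner_le_cmod: "a \<bullet> b \<le> cmod a * cmod b"
  using Cauchy_Schwarz_ineq2[of a b] by (simp add: abs_le_iff)

lemma two_inner_le: "2 * (a \<bullet> b) \<le> (cmod a)\<^sup>2 + (cmod b)\<^sup>2"
  using inner_le_cmod[of a b] zero_le_power2[of "cmod a - cmod b"]
  unfolding power2_diff by linarith

lemma test_sq_integrable:
  assumes "\<phi> \<in> test_funs"
  shows "integrable halfline (\<lambda>x. (cmod (\<phi> x))\<^sup>2)" "integrable halfline (\<lambda>x. (cmod (dv \<phi> x))\<^sup>2)"
  by (intro L2_D(2) test_fun_L2 test_fun_dv assms)+

lemma integral_indicator_le:
  fixes F :: "real \<Rightarrow> real"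
  assumes "integrable halfline F" "\<And>x. 0 \<le> F x" "A \<in> sets borel"
  shows "(\<integral>x. indicator A x * F x \<partial>halfline) \<le> integral\<^sup>L halfline F"
    "integrable halfline (\<lambda>x. indicator A x * F x)"
proof -
  have m: "A \<inter> {0<..} \<in> sets halfline"
    using assms(3) by (auto simp: sets_restrict_space_iff)
  have "integrable halfline (\<lambda>x. indicator (A \<inter> {0<..}) x *\<^sub>R F x)"
    by (rule integrable_mult_indicator[OF m assms(1)])
  then show i: "integrable halfline (\<lambda>x. indicator A x * F x)"
    by (rule Bochner_Integration.integrable_cong[OF refl, THEN iffD1, rotated])
      (auto simp: indicator_def space_restrict_space)
  show "(\<integral>x. indicator A x * F x \<partial>halfline) \<le> integral\<^sup>L halfline F"
    by (rule integral_mono[OF i assms(1)]) (use assms(2) in \<open>auto simp: indicator_def\<close>)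
qed

text \<open>Since \<open>\<phi>\<close> vanishes at \<open>0\<close>, its squared modulus is the
  integral of a derivative bounded pointwise by \<open>two_inner_le\<close>.\<close>

lemma test_sup_le:
  assumes "\<phi> \<in> test_funs"
  shows "(cmod (\<phi> x))\<^sup>2 \<le> sqi \<phi> + sqi (dv \<phi>)"
proof (cases "x \<le> 0")
  case True
  then show ?thesis using test_fun_nonpos[OF assms] by simp
next
  case False
  let ?F = "\<lambda>x. (cmod (\<phi> x))\<^sup>2 + (cmod (dv \<phi> x))\<^sup>2"
  have "(cmod (\<phi> x))\<^sup>2 - (cmod (\<phi> 0))\<^sup>2 \<le> (\<integral>y. indicator {0..x} y * ?F y \<partial>halfline)"
  proof (rule FTC_le)
    show "continuous_on {0..x} ?F"
      by (intro continuous_intros test_fun_continuous test_fun_dv assms)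
    show "((\<lambda>x. (cmod (\<phi> x))\<^sup>2) has_real_derivative 2 * (\<phi> x \<bullet> dv \<phi> x)) (at x)" for x
      by (intro has_derivative_cmod_sq test_fun_deriv assms)
  qed (use False two_inner_le in auto)
  also have "\<dots> \<le> integral\<^sup>L halfline ?F"
    by (rule integral_indicator_le) (use test_sq_integrable[OF assms] in auto)
  also have "\<dots> = sqi \<phi> + sqi (dv \<phi>)"
    unfolding sqi_def using test_sq_integrable[OF assms] by simp
  finally show ?thesis using test_fun_nonpos[OF assms, of 0] by simp
qed

text \<open>Only equicontinuity is wanted, so the constant is crude and free of square roots of
  norms: \<open>cmod (dv \<phi> z)\<close> is split as
  \<open>t * (cmod (dv \<phi> z))\<^sup>2 + 1 / t\<close>.\<close>

lemma test_Hoelder: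
  assumes "\<phi> \<in> test_funs" "0 \<le> x" "x < y"
  shows "cmod (\<phi> y - \<phi> x) \<le> sqrt (y - x) * (sqi (dv \<phi>) + 1)"
proof (cases "\<phi> y = \<phi> x")
  case True
  then show ?thesis using assms by simp
next
  case False
  \<comment> \<open>Projecting on the direction \<open>w\<close> of the increment makes the function
    real; \<open>t = sqrt (y - x)\<close> is the weight for which the integral of
    \<open>1 / t\<close> over the interval is again \<open>t\<close>.\<close>
  define w where "w = sgn (\<phi> y - \<phi> x)"
  define t where "t = sqrt (y - x)"
  have t: "t > 0" "t * t = y - x" using assms by (auto simp: t_def)
  have w: "cmod w = 1" using False by (simp add: w_def norm_sgn)
  let ?F = "\<lambda>x. t * (cmod (dv \<phi> x))\<^sup>2 + 1 / t"
  have i1: "integrable halfline (\<lambda>z. indicator {x..y} z * (t * (cmod (dv \<phi> z))\<^sup>2))"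
    and i2: "integrable halfline (\<lambda>z. indicator {x..y} z * (1 / t))"
    by (rule halfline_integral_indicator_Icc(1)[OF assms(2)],
        intro continuous_intros test_fun_continuous test_fun_dv assms)+
  have "\<phi> y \<bullet> w - \<phi> x \<bullet> w \<le> (\<integral>z. indicator {x..y} z * ?F z \<partial>halfline)"
  proof (rule FTC_le[where g'="\<lambda>x. dv \<phi> x \<bullet> w"])
    show "continuous_on {x..y} ?F"
      by (intro continuous_intros test_fun_continuous test_fun_dv assms)
    show "((\<lambda>z. \<phi> z \<bullet> w) has_real_derivative dv \<phi> z \<bullet> w) (at z)" for z
      using bounded_linear.has_vector_derivative[OF bounded_linear_inner_left test_fun_deriv[OF assms(1)]]
      by (simp add: has_real_derivative_iff_has_vector_derivative)
    show "dv \<phi> z \<bullet> w \<le> ?F z" for z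
    proof -
      have "dv \<phi> z \<bullet> w \<le> cmod (dv \<phi> z)" using inner_le_cmod[of "dv \<phi> z" w] w by simp
      also have "\<dots> \<le> ?F z"
      proof -
        define y where "y = t * cmod (dv \<phi> z)"
        have "0 \<le> y" using t by (simp add: y_def)
        moreover have "0 \<le> y\<^sup>2 - 2 * y + 1" using zero_le_power2[of "y - 1"] by (simp add: power2_diff)
        ultimately have "y \<le> y\<^sup>2 + 1" by linarith
        moreover have "t * ?F z = y\<^sup>2 + 1"
          using t by (simp add: y_def power2_eq_square distrib_left)
        ultimately have "t * cmod (dv \<phi> z) \<le> t * ?F z" by (simp add: y_def)
        then show ?thesis using t by simp
      qed
      finally show ?thesis .
    qed
  qed (use assms in auto)
  also have "\<dots> = (\<integral>z. indicator {x..y} z * (t * (cmod (dv \<phi> z))\<^sup>2) \<partial>halfline) + (\<integral>z. indicator {x..y} z * (1 / t) \<partial>halfline)"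
    unfolding distrib_left by (rule Bochner_Integration.integral_add[OF i1 i2])
  also have "(\<integral>z. indicator {x..y} z * (1 / t) \<partial>halfline) = t"
    using t assms by (subst halfline_integral_indicator_Icc(2)) (auto simp: field_simps)
  also have "(\<integral>z. indicator {x..y} z * (t * (cmod (dv \<phi> z))\<^sup>2) \<partial>halfline) \<le> (\<integral>z. t * (cmod (dv \<phi> z))\<^sup>2 \<partial>halfline)"
    by (rule integral_indicator_le) (use test_sq_integrable[OF assms(1)] t in auto)
  also have "\<dots> = t * sqi (dv \<phi>)" by (simp add: sqi_def)
  finally have "\<phi> y \<bullet> w - \<phi> x \<bullet> w \<le> t * (sqi (dv \<phi>) + 1)" by (simp add: algebra_simps)
  moreover have "\<phi> y \<bullet> w - \<phi> x \<bullet> w = cmod (\<phi> y - \<phi> x)"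
    unfolding w_def inner_diff_left[symmetric] sgn_div_norm using False
    by (simp add: power2_norm_eq_inner[symmetric] power2_eq_square)
  ultimately show ?thesis by (simp add: t_def)
qed

section \<open>Hardy's inequality\<close>

lemma continuous_on_quotient_test:
  assumes "\<phi> \<in> test_funs" "0 < r"
  shows "continuous_on {r..s} (\<lambda>x. (cmod (\<phi> x))\<^sup>2 / x\<^sup>2)"
  using assms by (intro continuous_intros test_fun_continuous) auto

lemma test_Hardy_integrable:
  assumes "\<phi> \<in> test_funs"
  shows "integrable halfline (\<lambda>x. (cmod (\<phi> x))\<^sup>2 / x\<^sup>2)"
proof -
  obtain a b where ab: "0 < a" "a < b" "\<And>x. x \<notin> {a..b} \<Longrightarrow> \<phi> x = 0"
    using test_funs_E2[OF assms assms] by metis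
  show ?thesis
  proof (rule halfline_integral_Icc(1)[OF ab(1) continuous_on_quotient_test[OF assms ab(1)]])
    show "(cmod (\<phi> x))\<^sup>2 / x\<^sup>2 = 0" if "x \<notin> {a..b}" for x
      using ab(3)[OF that] by simp
  qed
qed

text \<open>Expanding \<open>(cmod (dv \<phi> x - \<phi> x / (2 * x)))\<^sup>2 \<ge> 0\<close>
  bounds the derivative of \<open>(cmod (\<phi> x))\<^sup>2 / (2 * x)\<close>. The boundary term at
  \<open>R\<close> has the favourable sign, so the sharp constant survives on \<open>[0, R]\<close>
  although \<open>\<phi> R\<close> need not vanish; this local form is used for tails.\<close>

lemma test_Hardy:
  assumes "\<phi> \<in> test_funs" "0 < R"
  shows "(\<integral>x. indicator {0..R} x * ((cmod (\<phi> x))\<^sup>2 / x\<^sup>2) \<partial>halfline)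
    \<le> 4 * (\<integral>x. indicator {0..R} x * (cmod (dv \<phi> x))\<^sup>2 \<partial>halfline)"
proof -
  obtain a0 b where ab: "0 < a0" "a0 < b" "\<And>x. x \<notin> {a0..b} \<Longrightarrow> \<phi> x = 0"
    using test_funs_E2[OF assms(1) assms(1)] by metis
  \<comment> \<open>Half the minimum lies strictly below both the support and \<open>R\<close>, so
    \<open>\<phi>\<close> vanishes on all of \<open>(-\<infinity>, a]\<close>.\<close>
  define a where "a = min a0 R / 2"
  have a: "0 < a" "a < R" "\<And>x. x \<le> a \<Longrightarrow> \<phi> x = 0"
    using ab assms(2) by (auto simp: a_def)
  let ?h = "\<lambda>x. (cmod (\<phi> x))\<^sup>2 / x\<^sup>2" and ?k = "\<lambda>x. (cmod (dv \<phi> x))\<^sup>2"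
  have i1: "integrable halfline (\<lambda>x. indicator {a..R} x * ?h x)"
    by (rule integral_indicator_le(2)) (use test_Hardy_integrable[OF assms(1)] in auto)
  have i2: "integrable halfline (\<lambda>x. indicator {A..R} x * ?k x)" for A
    by (rule integral_indicator_le(2)) (use test_sq_integrable[OF assms(1)] in auto)
  have "(cmod (\<phi> R))\<^sup>2 / (2 * R) - (cmod (\<phi> a))\<^sup>2 / (2 * a)
     \<le> (\<integral>x. indicator {a..R} x * (?k x - ?h x / 4) \<partial>halfline)"
  proof (rule FTC_le)
    show "continuous_on {a..R} (\<lambda>x. ?k x - ?h x / 4)"
      using a(1) by (intro continuous_intros continuous_on_quotient_test test_fun_continuous test_fun_dv assms) auto
    show "((\<lambda>x. (cmod (\<phi> x))\<^sup>2 / (2 * x)) has_real_derivative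
        (2 * (\<phi> x \<bullet> dv \<phi> x) * (2 * x) - (cmod (\<phi> x))\<^sup>2 * 2) / ((2 * x) * (2 * x))) (at x)" if "a \<le> x" for x
      by (rule DERIV_divide[OF has_derivative_cmod_sq[OF test_fun_deriv[OF assms(1)]]])
        (use that a in \<open>auto intro!: derivative_eq_intros\<close>)
    show "(2 * (\<phi> x \<bullet> dv \<phi> x) * (2 * x) - (cmod (\<phi> x))\<^sup>2 * 2) / ((2 * x) * (2 * x)) \<le> ?k x - ?h x / 4"
      if "a \<le> x" for x
    proof -
      have x: "x > 0" using that a by simp
      have "0 \<le> (cmod (dv \<phi> x - \<phi> x /\<^sub>R (2 * x)))\<^sup>2" by simp
      also have "\<dots> = ?k x - (\<phi> x \<bullet> dv \<phi> x) / x + (cmod (\<phi> x))\<^sup>2 / (4 * x\<^sup>2)"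
        using x unfolding power2_norm_eq_inner
        by (simp add: inner_diff_left inner_diff_right inner_commute power2_eq_square field_simps)
      finally have "0 \<le> ?k x - (\<phi> x \<bullet> dv \<phi> x) / x + (cmod (\<phi> x))\<^sup>2 / (4 * x\<^sup>2)" .
      note 1 = this
      have 2: "(2 * (\<phi> x \<bullet> dv \<phi> x) * (2 * x) - (cmod (\<phi> x))\<^sup>2 * 2) / ((2 * x) * (2 * x))
          = (\<phi> x \<bullet> dv \<phi> x) / x - 2 * ((cmod (\<phi> x))\<^sup>2 / (4 * x\<^sup>2))"
        using x by (simp add: power2_eq_square field_simps)
      have 3: "?h x / 4 = (cmod (\<phi> x))\<^sup>2 / (4 * x\<^sup>2)" by simp
      have "0 \<le> k - d + q \<Longrightarrow> L = d - 2 * q \<Longrightarrow> h = q \<Longrightarrow> L \<le> k - h" for k d q L h :: real by linarith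
      from this[OF 1 2 3] show ?thesis .
    qed
  qed (use a in auto)
  also have "\<dots> = (\<integral>x. indicator {a..R} x * ?k x - (1 / 4) * (indicator {a..R} x * ?h x) \<partial>halfline)"
    by (intro Bochner_Integration.integral_cong) (auto simp: algebra_simps)
  also have "\<dots> = (\<integral>x. indicator {a..R} x * ?k x \<partial>halfline) - (1 / 4) * (\<integral>x. indicator {a..R} x * ?h x \<partial>halfline)"
    by (subst Bochner_Integration.integral_diff[OF i2 integrable_mult_right[OF i1]])
      (simp only: integral_mult_right_zero)
  finally have 1: "(cmod (\<phi> R))\<^sup>2 / (2 * R) - (cmod (\<phi> a))\<^sup>2 / (2 * a) \<le> \<dots>" .
  have 2: "(cmod (\<phi> a))\<^sup>2 / (2 * a) = 0" using a(3)[of a] by simp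
  have 3: "0 \<le> (cmod (\<phi> R))\<^sup>2 / (2 * R)" using assms(2) by simp
  have "r - s \<le> K - h \<Longrightarrow> s = 0 \<Longrightarrow> 0 \<le> r \<Longrightarrow> h \<le> K" for r s K h :: real by linarith
  from this[OF 1 2 3]
  have "(1 / 4) * (\<integral>x. indicator {a..R} x * ?h x \<partial>halfline) \<le> (\<integral>x. indicator {a..R} x * ?k x \<partial>halfline)" .
  note lea = this
  have eq: "(\<lambda>x. indicator {a..R} x * ?h x) = (\<lambda>x. indicator {0..R} x * ?h x)"
    using a by (auto simp: indicator_def fun_eq_iff not_le)
  have le: "(\<integral>x. indicator {a..R} x * ?k x \<partial>halfline) \<le> (\<integral>x. indicator {0..R} x * ?k x \<partial>halfline)"
    by (rule integral_mono[OF i2 i2], rule mult_right_mono) (use a in \<open>auto simp: indicator_def\<close>)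
  from order_trans[OF lea[unfolded eq] le] show ?thesis by linarith
qed

section \<open>A sharp Gagliardo--Nirenberg inequality on half-lines\<close>

definition pint :: "real \<Rightarrow> (real \<Rightarrow> complex) \<Rightarrow> real" where
  "pint q u = (\<integral>x. cmod (u x) powr q \<partial>halfline)"

lemma pint_nonneg [simp]: "0 \<le> pint q u"
  by (simp add: pint_def)

lemma powr_split_sq: "q \<ge> 2 \<Longrightarrow> x powr q = x\<^sup>2 * x powr (q - 2)" if "0 \<le> x" for x q :: real
  using that by (cases "x = 0") (auto simp: powr_diff)

lemma test_powr_continuous:
  assumes "\<phi> \<in> test_funs" "q > 0"
  shows "continuous_on A (\<lambda>x. cmod (\<phi> x) powr q)"
  using assms by (intro continuous_on_powr' continuous_intros test_fun_continuous) auto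

lemma test_pint_integrable:
  assumes "\<phi> \<in> test_funs" "q > 0"
  shows "integrable halfline (\<lambda>x. cmod (\<phi> x) powr q)"
proof -
  obtain a b where ab: "0 < a" "a < b" "\<And>x. x \<notin> {a..b} \<Longrightarrow> \<phi> x = 0"
    using test_funs_E2[OF assms(1) assms(1)] by metis
  show ?thesis
  proof (rule halfline_integral_Icc(1)[OF ab(1) test_powr_continuous[OF assms]])
    show "cmod (\<phi> x) powr q = 0" if "x \<notin> {a..b}" for x
      using ab(3)[OF that] by simp
  qed
qed

lemma Bernoulli_powr:
  fixes r t :: real
  assumes "0 \<le> r" "0 < t" "t < 1"
  shows "r powr t \<le> 1 + t * (r - 1)"
proof (cases "r = 0")
  case True
  then show ?thesis using assms by simp
next
  case False
  have "r powr t * 1 powr (1 - t) \<le> t * r + (1 - t) * 1"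
    using assms False by (intro Youngs_inequality_0) auto
  then show ?thesis by (simp add: algebra_simps)
qed

lemma powr_le_1: "0 \<le> r \<Longrightarrow> r \<le> 1 \<Longrightarrow> 0 \<le> a \<Longrightarrow> r powr a \<le> (1::real)"
  using powr_mono2[of a r 1] by simp

text \<open>Strictness without a second derivative: the inequality for \<open>r = sqrt s\<close>,
  squared, gives \<open>t * (1 - t) * (r - 1)\<^sup>2 \<le> 0\<close>.\<close>

lemma Bernoulli_powr_eq:
  fixes s t :: real
  assumes "0 < s" "0 < t" "t < 1" "s powr t = 1 + t * (s - 1)"
  shows "s = 1"
proof -
  define r where "r = sqrt s"
  have r: "0 < r" "s = r\<^sup>2" using assms(1) by (auto simp: r_def)
  have "s powr t = (r powr t)\<^sup>2"
    unfolding r(2) using r(1) by (simp add: power2_eq_square powr_mult)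
  also have "\<dots> \<le> (1 + t * (r - 1))\<^sup>2"
    using r assms by (intro power_mono Bernoulli_powr) auto
  finally have "1 + t * (r\<^sup>2 - 1) \<le> (1 + t * (r - 1))\<^sup>2" using assms(4) r(2) by simp
  then have "t * (1 - t) * (r - 1)\<^sup>2 \<le> 0" by (simp add: power2_eq_square algebra_simps)
  then have "(r - 1)\<^sup>2 \<le> 0" using assms by (simp add: mult_le_0_iff)
  then show ?thesis using r by simp
qed

locale hardy_nls =
  fixes c \<omega> p :: real
  assumes c_pos: "0 < c" and c_less: "c < 1 / 4" and omega: "0 < \<omega>" and p_gt: "1 < p" and p_less: "p < 5"
begin

text \<open>The exponent that makes \<open>pint (p + 1) u powr \<theta>\<close> homogeneous of
  degree two in \<open>u\<close>, like the quadratic form with which it is compared.\<close>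

definition "\<theta> = 2 / (p + 1)"

lemma theta: "0 < \<theta>" "\<theta> < 1"
  using p_gt by (auto simp: \<theta>_def)

text \<open>Nagy's argument: with this primitive \<open>G\<close>, the function \<open>2 M\<^sup>2 G(\<bar>u\<bar>\<^sup>2 / M\<^sup>2)\<close> calibrates the
  Lagrangian \<open>\<bar>u'\<bar>\<^sup>2 + \<omega> \<bar>u\<bar>\<^sup>2 - \<omega> M\<^bsup>1-p\<^esup> \<bar>u\<bar>\<^bsup>p+1\<^esup>\<close> as long as \<open>\<bar>u\<bar> \<le> M\<close>; equality holds along the soliton.\<close>

definition "gn_density r = sqrt \<omega> / 2 * sqrt (1 - \<bar>r\<bar> powr ((p - 1) / 2))"

definition "gn_prim = (SOME G. (\<forall>r. (G has_real_derivative gn_density r) (at r)) \<and> G 0 = (0::real))"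

lemma gn_prim: "(gn_prim has_real_derivative gn_density r) (at r)" "gn_prim 0 = 0"
proof -
  have "continuous_on UNIV gn_density"
    unfolding gn_density_def using p_gt by (intro continuous_intros continuous_on_powr') auto
  then obtain G where "\<And>r. (G has_real_derivative gn_density r) (at r)" "G 0 = 0"
    by (rule continuous_antiderivative) blast
  then have "\<exists>G. (\<forall>r. (G has_real_derivative gn_density r) (at r)) \<and> G 0 = (0::real)" by blast
  from someI_ex[OF this, folded gn_prim_def]
  show "(gn_prim has_real_derivative gn_density r) (at r)" "gn_prim 0 = 0" by auto
qed

lemma gn_density_bounds: "0 \<le> r \<Longrightarrow> r \<le> 1 \<Longrightarrow> 0 \<le> gn_density r \<and> gn_density r \<le> sqrt \<omega> / 2"
  using powr_le_1[of r "(p - 1) / 2"] p_gt omega mult_left_mono[of "sqrt (1 - r powr ((p - 1) / 2))" 1 "sqrt \<omega> / 2"]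
  by (auto simp: gn_density_def)

lemma gn_prim_bounds:
  assumes "0 \<le> r" "r \<le> 1"
  shows "0 \<le> gn_prim r" "gn_prim r \<le> sqrt \<omega> / 2 * r"
proof -
  have "0 \<le> gn_prim r \<and> gn_prim r \<le> sqrt \<omega> / 2 * r"
  proof (cases "r = 0")
    case False
    then have "0 < r" using assms by simp
    from MVT2[OF this gn_prim(1)] obtain z where z: "0 < z" "z < r" "gn_prim r - gn_prim 0 = (r - 0) * gn_density z"
      by blast
    have "0 \<le> gn_density z" "gn_density z \<le> sqrt \<omega> / 2" using gn_density_bounds[of z] z assms by auto
    then show ?thesis using z assms gn_prim(2) mult_left_mono[of "gn_density z" "sqrt \<omega> / 2" r] by (simp add: mult.commute)
  qed (use gn_prim in simp)
  then show "0 \<le> gn_prim r" "gn_prim r \<le> sqrt \<omega> / 2 * r" by auto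
qed

text \<open>Half the integral over the line of the squared derivative of the soliton of height
  \<open>1\<close>; see \<open>soliton_kinetic\<close> for large \<open>T\<close>.\<close>

definition "gn_a = gn_prim 1"

lemma gn_a: "0 < gn_a"
proof -
  obtain z where z: "0 < z" "z < 1" "gn_prim 1 - gn_prim 0 = (1 - 0) * gn_density z"
    using MVT2[of 0 1, OF zero_less_one gn_prim(1)] by blast
  have "z powr ((p - 1) / 2) < 1 powr ((p - 1) / 2)"
    using z p_gt by (intro powr_less_mono2) auto
  then have "0 < gn_density z" using z omega by (simp add: gn_density_def)
  then show ?thesis using z gn_prim(2) by (simp add: gn_a_def)
qed

text \<open>The integral over the line of the power \<open>p + 1\<close> of the soliton of height
  \<open>1\<close>, computed from \<open>gn_a\<close> by the virial identity.\<close>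

definition "gn_K = 8 * gn_a / ((p - 1) * \<omega>)"

lemma gn_K: "0 < gn_K" using gn_a p_gt omega by (simp add: gn_K_def)

text \<open>The quotient attained by the soliton: its energy
  \<open>(p + 1) / 2 * \<omega> * gn_K\<close> divided by \<open>gn_K powr \<theta>\<close>.\<close>

definition "gn_C = (p + 1) / 2 * \<omega> * gn_K powr (1 - \<theta>)"

lemma gn_C: "0 < gn_C" using gn_K p_gt omega by (simp add: gn_C_def)

text \<open>The calibrating function \<open>h\<close> changes at most at the rate \<open>F\<close>.
  It climbs to \<open>2 * M\<^sup>2 * gn_a\<close> at the maximum point \<open>x0\<close> and
  returns to \<open>0\<close> beyond the support, and both passages are paid for by the integral.
  What is missing because \<open>h R\<close> need not be \<open>0\<close> is the boundary
  term.\<close>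

lemma gn_calibration:
  assumes \<phi>: "\<phi> \<in> test_funs" and R: "0 \<le> R" and M: "0 < M" "\<And>x. R \<le> x \<Longrightarrow> cmod (\<phi> x) \<le> M"
    and x0: "R \<le> x0" "cmod (\<phi> x0) = M"
  shows "4 * M\<^sup>2 * gn_a - sqrt \<omega> * (cmod (\<phi> R))\<^sup>2
    \<le> (\<integral>x. indicator {R..} x * ((cmod (dv \<phi> x))\<^sup>2 + \<omega> * (cmod (\<phi> x))\<^sup>2) \<partial>halfline)
      - \<omega> * M powr (1 - p) * (\<integral>x. indicator {R..} x * cmod (\<phi> x) powr (p + 1) \<partial>halfline)"
proof -
  obtain a b where ab: "0 < a" "a < b" "\<And>x. x \<notin> {a..b} \<Longrightarrow> \<phi> x = 0"
    using test_funs_E2[OF \<phi> \<phi>] by metis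
  define S where "S = max b x0 + 1"
  have S: "x0 \<le> S" "b < S" by (auto simp: S_def)
  let ?E = "\<lambda>x. (cmod (dv \<phi> x))\<^sup>2 + \<omega> * (cmod (\<phi> x))\<^sup>2" and ?P = "\<lambda>x. cmod (\<phi> x) powr (p + 1)"
  define F where "F x = ?E x - \<omega> * M powr (1 - p) * ?P x" for x
  define h where "h x = 2 * M\<^sup>2 * gn_prim ((cmod (\<phi> x))\<^sup>2 / M\<^sup>2)" for x
  define h' where "h' x = 4 * gn_density ((cmod (\<phi> x))\<^sup>2 / M\<^sup>2) * (\<phi> x \<bullet> dv \<phi> x)" for x
  have contF: "continuous_on A F" for A
    unfolding F_def using p_gt
    by (intro continuous_intros test_fun_continuous test_fun_dv test_powr_continuous \<phi>) auto
  have h: "(h has_real_derivative h' x) (at x)" for x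
  proof -
    have "((\<lambda>x. (cmod (\<phi> x))\<^sup>2 / M\<^sup>2) has_real_derivative 2 * (\<phi> x \<bullet> dv \<phi> x) / M\<^sup>2) (at x)"
      by (intro DERIV_cdivide has_derivative_cmod_sq test_fun_deriv \<phi>)
    from DERIV_cmult[OF DERIV_chain2[OF gn_prim(1) this], of "2 * M\<^sup>2"]
    show ?thesis unfolding h_def[abs_def] h'_def using M by (simp add: field_simps)
  qed
  have F_eq: "F x = (cmod (dv \<phi> x))\<^sup>2 + \<omega> * (cmod (\<phi> x))\<^sup>2 * (1 - (cmod (\<phi> x) / M) powr (p - 1))" for x
  proof -
    have "M powr (1 - p) * ?P x = (cmod (\<phi> x))\<^sup>2 * (cmod (\<phi> x) / M) powr (p - 1)"
      using M p_gt powr_split_sq[of "cmod (\<phi> x)" "p + 1"] powr_minus_divide[of M "p - 1"]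
      by (simp add: powr_divide)
    then show ?thesis by (simp add: F_def algebra_simps)
  qed
  \<comment> \<open>The bound \<open>cmod (\<phi> x) \<le> M\<close> enters here: beyond
    \<open>R\<close> the potential part of the Lagrangian is nonnegative and has a square root,
    which the calibration needs.\<close>
  have sq: "0 \<le> 1 - (cmod (\<phi> x) / M) powr (p - 1)" if "R \<le> x" for x
    using powr_le_1[of "cmod (\<phi> x) / M" "p - 1"] M(1) M(2)[OF that] p_gt by simp
  have F0: "0 \<le> F x" if "R \<le> x" for x
    unfolding F_eq using sq[OF that] omega by (intro add_nonneg_nonneg mult_nonneg_nonneg) auto
  have h'_le: "\<bar>h' x\<bar> \<le> F x" if x: "R \<le> x" for x
  proof -
    let ?t = "sqrt (1 - (cmod (\<phi> x) / M) powr (p - 1))"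
    have "((cmod (\<phi> x))\<^sup>2 / M\<^sup>2) powr ((p - 1) / 2) = (cmod (\<phi> x) / M) powr (p - 1)"
    proof -
      have "((cmod (\<phi> x) / M)\<^sup>2) powr ((p - 1) / 2) = ((cmod (\<phi> x) / M) powr 2) powr ((p - 1) / 2)"
        using M by simp
      also have "\<dots> = (cmod (\<phi> x) / M) powr (2 * ((p - 1) / 2))" by (rule powr_powr)
      also have "2 * ((p - 1) / 2) = p - 1" by simp
      finally show ?thesis by (simp add: power_divide)
    qed
    then have g: "gn_density ((cmod (\<phi> x))\<^sup>2 / M\<^sup>2) = sqrt \<omega> / 2 * ?t"
      by (simp add: gn_density_def)
    have "\<bar>h' x\<bar> = 2 * (sqrt \<omega> * ?t) * \<bar>\<phi> x \<bullet> dv \<phi> x\<bar>"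
      unfolding h'_def g using sq[OF x] omega by (simp add: abs_mult)
    also have "\<dots> \<le> 2 * (sqrt \<omega> * ?t) * (cmod (\<phi> x) * cmod (dv \<phi> x))"
      using Cauchy_Schwarz_ineq2[of "\<phi> x" "dv \<phi> x"] sq[OF x] omega by (intro mult_left_mono) auto
    also have "\<dots> = 2 * (cmod (dv \<phi> x)) * (sqrt \<omega> * cmod (\<phi> x) * ?t)" by simp
    also have "\<dots> \<le> (cmod (dv \<phi> x))\<^sup>2 + (sqrt \<omega> * cmod (\<phi> x) * ?t)\<^sup>2"
      using zero_le_power2[of "cmod (dv \<phi> x) - sqrt \<omega> * cmod (\<phi> x) * ?t"] unfolding power2_diff by linarith
    also have "\<dots> = F x"
      unfolding F_eq power_mult_distrib using sq[OF x] omega by simp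
    finally show ?thesis .
  qed
  have 1: "h x0 - h R \<le> (\<integral>x. indicator {R..x0} x * F x \<partial>halfline)"
    by (rule FTC_le[OF R x0(1) contF h]) (use h'_le in \<open>force simp: abs_le_iff\<close>)
  \<comment> \<open>On the descending side the same estimate is used for \<open>- h\<close>.\<close>
  have 2: "- h S - (- h x0) \<le> (\<integral>x. indicator {x0..S} x * F x \<partial>halfline)"
    by (rule FTC_le[OF _ S(1) contF DERIV_minus[OF h]]) (use R x0 h'_le in \<open>force simp: abs_le_iff\<close>)+
  have "(\<integral>x. indicator {R..x0} x * F x \<partial>halfline) + (\<integral>x. indicator {x0..S} x * F x \<partial>halfline)
     = integral {R..x0} F + integral {x0..S} F"
    using halfline_integral_indicator_Icc(2)[OF R contF] halfline_integral_indicator_Icc(2)[OF _ contF, of x0 S] R x0 by simp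
  also have "\<dots> = integral {R..S} F"
    by (intro Henstock_Kurzweil_Integration.integral_combine x0 S integrable_continuous_real contF)
  also have "\<dots> = (\<integral>x. indicator {R..S} x * F x \<partial>halfline)"
    by (rule halfline_integral_indicator_Icc(2)[OF R contF, symmetric])
  also have "\<dots> = (\<integral>x. indicator {R..} x * F x \<partial>halfline)"
  proof (rule Bochner_Integration.integral_cong[OF refl])
    fix x
    have "F x = 0" if "S < x"
    proof -
      have "x \<notin> {a..b}" using that S by auto
      then have "\<phi> x = 0" by (rule ab(3))
      moreover have "dv \<phi> x = 0"
        by (rule dv_eq_0_outside[of a b]) (rule ab(3), assumption, rule \<open>x \<notin> {a..b}\<close>)
      ultimately have "\<phi> x = 0" "dv \<phi> x = 0" by auto
      then show ?thesis by (simp add: F_def)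
    qed
    then show "indicator {R..S} x * F x = indicator {R..} x * F x"
      by (cases "S < x") (auto simp: indicator_def)
  qed
  also have "\<dots> = (\<integral>x. indicator {R..} x * ?E x - \<omega> * M powr (1 - p) * (indicator {R..} x * ?P x) \<partial>halfline)"
    by (rule Bochner_Integration.integral_cong[OF refl]) (simp add: F_def algebra_simps)
  also have "\<dots> = (\<integral>x. indicator {R..} x * ?E x \<partial>halfline) - \<omega> * M powr (1 - p) * (\<integral>x. indicator {R..} x * ?P x \<partial>halfline)"
  proof -
    have "integrable halfline (\<lambda>x. indicator {R..} x * ?E x)"
      by (rule integral_indicator_le(2)) (use omega test_sq_integrable[OF \<phi>] in auto)
    moreover have "integrable halfline (\<lambda>x. indicator {R..} x * ?P x)"
      by (rule integral_indicator_le(2)) (use test_pint_integrable[OF \<phi>] p_gt in auto)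
    ultimately show ?thesis by simp
  qed
  finally have 3: "2 * h x0 - h R - h S \<le> \<dots>" using 1 2 by linarith
  have "h x0 = 2 * M\<^sup>2 * gn_a" using x0 M by (simp add: h_def gn_a_def)
  moreover have "h S = 0"
  proof -
    have "\<phi> S = 0" by (rule ab(3)) (use S in auto)
    then show ?thesis by (simp add: h_def gn_prim)
  qed
  moreover have "h R \<le> sqrt \<omega> * (cmod (\<phi> R))\<^sup>2"
  proof -
    have "(cmod (\<phi> R))\<^sup>2 / M\<^sup>2 \<le> 1" using M(1) power_mono[OF M(2)[of R], of 2] by simp
    then have "h R \<le> 2 * M\<^sup>2 * (sqrt \<omega> / 2 * ((cmod (\<phi> R))\<^sup>2 / M\<^sup>2))"
      unfolding h_def by (intro mult_left_mono gn_prim_bounds) auto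
    then show ?thesis using M by simp
  qed
  ultimately show ?thesis using 3 by simp
qed

text \<open>The calibration bounds the energy below by an expression that is affine in
  \<open>P\<close> and still contains the maximum \<open>M\<close>. Bernoulli's inequality with
  exponent \<open>\<theta>\<close> replaces the affine function by the power that it supports, and
  \<open>M\<close> cancels because \<open>(p + 1) * \<theta> = 2\<close>.\<close>

lemma test_GN_tail:
  assumes \<phi>: "\<phi> \<in> test_funs" and R: "0 \<le> R"
  shows "gn_C * (\<integral>x. indicator {R..} x * cmod (\<phi> x) powr (p + 1) \<partial>halfline) powr \<theta>
    \<le> (\<integral>x. indicator {R..} x * ((cmod (dv \<phi> x))\<^sup>2 + \<omega> * (cmod (\<phi> x))\<^sup>2) \<partial>halfline)
      + sqrt \<omega> * (cmod (\<phi> R))\<^sup>2"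
proof -
  let ?PR = "\<integral>x. indicator {R..} x * cmod (\<phi> x) powr (p + 1) \<partial>halfline"
  let ?IR = "\<integral>x. indicator {R..} x * ((cmod (dv \<phi> x))\<^sup>2 + \<omega> * (cmod (\<phi> x))\<^sup>2) \<partial>halfline"
  obtain a b where ab: "0 < a" "a < b" "\<And>x. x \<notin> {a..b} \<Longrightarrow> \<phi> x = 0"
    using test_funs_E2[OF \<phi> \<phi>] by metis
  have "continuous_on {R..max R b} (\<lambda>x. cmod (\<phi> x))"
    by (intro continuous_intros test_fun_continuous \<phi>)
  then obtain x0 where x0: "R \<le> x0" "\<And>x. R \<le> x \<Longrightarrow> x \<le> max R b \<Longrightarrow> cmod (\<phi> x) \<le> cmod (\<phi> x0)"
    using continuous_attains_sup[of "{R..max R b}" "\<lambda>x. cmod (\<phi> x)"] by auto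
  define M where "M = cmod (\<phi> x0)"
  have M: "cmod (\<phi> x) \<le> M" if "R \<le> x" for x
  proof (cases "x \<le> max R b")
    case True
    then show ?thesis using x0(2)[OF that] by (simp add: M_def)
  next
    case False
    then have "\<phi> x = 0" by (intro ab(3)) auto
    then show ?thesis by (simp add: M_def)
  qed
  show ?thesis
  proof (cases "M = 0")
    case True
    then have "indicator {R..} x * cmod (\<phi> x) powr (p + 1) = 0" for x
      using M[of x] by (auto simp: indicator_def)
    then have "?PR = 0" by (simp only: integral_zero)
    moreover have "0 \<le> ?IR" using omega by (intro integral_nonneg_AE) auto
    ultimately show ?thesis using omega by simp
  next
    case False
    then have Mp: "0 < M" by (simp add: M_def)
    \<comment> \<open>Normalized so that \<open>r = 1\<close> for a full soliton of height
      \<open>M\<close>, where Bernoulli's inequality is an equality.\<close>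
    define r where "r = ?PR / (gn_K * M powr (p + 1))"
    have PR0: "0 \<le> ?PR" by (intro integral_nonneg_AE) auto
    have r0: "0 \<le> r" unfolding r_def using gn_K PR0 by simp
    have PR: "?PR = r * (gn_K * M powr (p + 1))" using gn_K Mp by (simp add: r_def)
    have M2: "(M powr (p + 1)) powr \<theta> = M\<^sup>2"
    proof -
      have "(p + 1) * \<theta> = 2"
        unfolding \<theta>_def times_divide_eq_right using p_gt by (intro nonzero_mult_div_cancel_left) auto
      then show ?thesis using Mp by (simp add: powr_powr)
    qed
    have "gn_C * ?PR powr \<theta> = (p + 1) / 2 * \<omega> * (gn_K powr (1 - \<theta>) * gn_K powr \<theta>) * M\<^sup>2 * r powr \<theta>"
      unfolding PR gn_C_def using r0 gn_K Mp by (simp add: powr_mult M2)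
    also have "gn_K powr (1 - \<theta>) * gn_K powr \<theta> = gn_K"
      using gn_K by (simp flip: powr_add)
    also have "(p + 1) / 2 * \<omega> * gn_K * M\<^sup>2 * r powr \<theta> \<le> (p + 1) / 2 * \<omega> * gn_K * M\<^sup>2 * (1 + \<theta> * (r - 1))"
      using p_gt omega gn_K r0 theta by (intro mult_left_mono Bernoulli_powr) auto
    also have "\<dots> = 4 * M\<^sup>2 * gn_a + \<omega> * gn_K * M\<^sup>2 * r"
    proof -
      have "(p + 1) / 2 * \<omega> * gn_K * M\<^sup>2 * (1 + \<theta> * (r - 1))
        = \<omega> * gn_K * M\<^sup>2 * ((p + 1) / 2 * (1 + \<theta> * (r - 1)))" by simp
      also have "(p + 1) / 2 * (1 + \<theta> * (r - 1)) = (p - 1) / 2 + r"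
        using p_gt by (simp add: \<theta>_def field_simps)
      also have "\<omega> * gn_K * M\<^sup>2 * ((p - 1) / 2 + r) = (\<omega> * gn_K * ((p - 1) / 2)) * M\<^sup>2 + \<omega> * gn_K * M\<^sup>2 * r"
        by (simp add: algebra_simps)
      also have "\<omega> * gn_K * ((p - 1) / 2) = 4 * gn_a"
        using p_gt omega by (simp add: gn_K_def)
      finally show ?thesis by simp
    qed
    also have "\<omega> * gn_K * M\<^sup>2 * r = \<omega> * M powr (1 - p) * ?PR"
    proof -
      have "M powr (1 - p) * M powr (p + 1) = M\<^sup>2"
        using Mp by (simp flip: powr_add)
      then show ?thesis unfolding PR by simp
    qed
    also have "4 * M\<^sup>2 * gn_a + \<omega> * M powr (1 - p) * ?PR \<le> ?IR + sqrt \<omega> * (cmod (\<phi> R))\<^sup>2"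
      using gn_calibration[OF \<phi> R Mp M x0(1) M_def[symmetric]] by simp
    finally show ?thesis .
  qed
qed

end

lemma FTC_eq:
  assumes "r \<le> s" "\<And>x. r \<le> x \<Longrightarrow> x \<le> s \<Longrightarrow> (g has_real_derivative g' x) (at x)"
  shows "(g' has_integral g s - g r) {r..s}"
  by (rule fundamental_theorem_of_calculus[OF assms(1)])
    (use assms(2) in \<open>auto simp flip: has_real_derivative_iff_has_vector_derivative
       intro: has_field_derivative_at_within\<close>)

lemma integral_le_const:
  fixes F :: "real \<Rightarrow> real"
  assumes "r \<le> s" "continuous_on {r..s} F" "\<And>x. r \<le> x \<Longrightarrow> x \<le> s \<Longrightarrow> F x \<le> E"
  shows "integral {r..s} F \<le> (s - r) * E"
proof -
  have "integral {r..s} F \<le> integral {r..s} (\<lambda>_. E)"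
    by (intro integral_le integrable_continuous_real assms) (use assms in auto)
  then show ?thesis using assms(1) by simp
qed

lemma integral_ge_const:
  fixes F :: "real \<Rightarrow> real"
  assumes "r \<le> s" "continuous_on {r..s} F" "\<And>x. r \<le> x \<Longrightarrow> x \<le> s \<Longrightarrow> E \<le> F x"
  shows "(s - r) * E \<le> integral {r..s} F"
proof -
  have "integral {r..s} (\<lambda>_. E) \<le> integral {r..s} F"
    by (intro integral_le integrable_continuous_real assms) (use assms in auto)
  then show ?thesis using assms(1) by simp
qed

section \<open>Properties of the Sobolev space\<close>

lemma test_Hardy_L2:
  assumes "\<phi> \<in> test_funs"
  shows "(\<lambda>x. \<phi> x / of_real x) \<in> L2" "sqi (\<lambda>x. \<phi> x / of_real x) \<le> 4 * sqi (dv \<phi>)"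
proof -
  obtain a b where ab: "0 < a" "a < b" "\<And>x. x \<notin> {a..b} \<Longrightarrow> \<phi> x = 0"
    using test_funs_E2[OF assms assms] by metis
  have c: "continuous_on {a..b} (\<lambda>x. \<phi> x / of_real x)"
    by (intro continuous_intros test_fun_continuous assms) (use ab in auto)
  have "integrable halfline (\<lambda>x. \<phi> x / of_real x)"
  proof (rule halfline_integral_Icc(1)[OF ab(1) c])
    show "\<phi> x / of_real x = 0" if "x \<notin> {a..b}" for x using ab(3)[OF that] by simp
  qed
  then have m: "(\<lambda>x. \<phi> x / of_real x) \<in> borel_measurable halfline" by (rule borel_measurable_integrable)
  have eq: "(cmod (\<phi> x / of_real x))\<^sup>2 = (cmod (\<phi> x))\<^sup>2 / x\<^sup>2" for x
    by (simp add: norm_divide power_divide)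
  show "(\<lambda>x. \<phi> x / of_real x) \<in> L2"
    unfolding L2_def mem_Collect_eq eq by (intro conjI m test_Hardy_integrable assms)
  have "sqi (\<lambda>x. \<phi> x / of_real x) = (\<integral>x. indicator {0..b} x * ((cmod (\<phi> x))\<^sup>2 / x\<^sup>2) \<partial>halfline)"
    unfolding sqi_def eq
  proof (rule Bochner_Integration.integral_cong[OF refl])
    fix x assume "x \<in> space halfline"
    then have x: "0 < x" by (simp add: space_restrict_space)
    show "(cmod (\<phi> x))\<^sup>2 / x\<^sup>2 = indicator {0..b} x * ((cmod (\<phi> x))\<^sup>2 / x\<^sup>2)"
    proof (cases "x \<in> {a..b}")
      case False
      then show ?thesis using ab(3)[OF False] by simp
    qed (use x in simp)
  qed
  also have "\<dots> \<le> 4 * (\<integral>x. indicator {0..b} x * (cmod (dv \<phi> x))\<^sup>2 \<partial>halfline)"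
    using ab by (intro test_Hardy assms) simp
  also have "\<dots> \<le> 4 * sqi (dv \<phi>)"
    unfolding sqi_def by (intro mult_left_mono integral_indicator_le(1) test_sq_integrable assms) auto
  finally show "sqi (\<lambda>x. \<phi> x / of_real x) \<le> 4 * sqi (dv \<phi>)" .
qed

section \<open>Passing from test functions to limits in the Sobolev space\<close>

lemma sqi_tendsto_0_Cauchy:
  assumes "\<And>n. f n \<in> L2" "g \<in> L2" "(\<lambda>n. sqi (\<lambda>x. g x - f n x)) \<longlonglongrightarrow> 0" "0 < e"
  shows "\<exists>N. \<forall>m\<ge>N. \<forall>n\<ge>N. sqi (\<lambda>x. f m x - f n x) \<le> e"
proof -
  have "(\<lambda>n. sqrt (sqi (\<lambda>x. g x - f n x))) \<longlonglongrightarrow> 0"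
    using tendsto_real_sqrt[OF assms(3)] by simp
  then have "\<forall>\<^sub>F n in sequentially. sqrt (sqi (\<lambda>x. g x - f n x)) < sqrt e / 2"
    using assms(4) by (intro order_tendstoD) auto
  then obtain N where N: "\<And>n. n \<ge> N \<Longrightarrow> sqrt (sqi (\<lambda>x. g x - f n x)) < sqrt e / 2"
    unfolding eventually_sequentially by blast
  have "sqi (\<lambda>x. f m x - f n x) \<le> e" if "m \<ge> N" "n \<ge> N" for m n
  proof -
    have "sqrt (sqi (\<lambda>x. (g x - f n x) - (g x - f m x))) \<le> sqrt (sqi (\<lambda>x. g x - f n x)) + sqrt (sqi (\<lambda>x. g x - f m x))"
      by (intro L2_triangle_diff L2_diff assms)
    also have "\<dots> \<le> sqrt e" using N[OF that(1)] N[OF that(2)] by linarith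
    finally show ?thesis by simp
  qed
  then show ?thesis by blast
qed

lemma H1_lim_unfold:
  assumes "H1_lim \<phi> u v"
  shows "\<And>n. \<phi> n \<in> test_funs" "u \<in> L2" "v \<in> L2" "(\<lambda>n. sqi (\<lambda>x. u x - \<phi> n x)) \<longlonglongrightarrow> 0"
    "(\<lambda>n. sqi (\<lambda>x. v x - dv (\<phi> n) x)) \<longlonglongrightarrow> 0"
    "\<And>n. \<phi> n \<in> L2" "\<And>n. dv (\<phi> n) \<in> L2"
  using assms unfolding H1_lim_def by (auto intro: test_fun_L2 test_fun_dv)

lemma H1_lim_Cauchy:
  assumes "H1_lim \<phi> u v" "0 < e"
  shows "\<exists>N. \<forall>m\<ge>N. \<forall>n\<ge>N. sqi (\<lambda>x. \<phi> m x - \<phi> n x) \<le> e"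
    "\<exists>N. \<forall>m\<ge>N. \<forall>n\<ge>N. sqi (\<lambda>x. dv (\<phi> m) x - dv (\<phi> n) x) \<le> e"
proof -
  note L = H1_lim_unfold[OF assms(1)]
  show "\<exists>N. \<forall>m\<ge>N. \<forall>n\<ge>N. sqi (\<lambda>x. \<phi> m x - \<phi> n x) \<le> e"
    by (rule sqi_tendsto_0_Cauchy[OF L(6) L(2) L(4) assms(2)])
  show "\<exists>N. \<forall>m\<ge>N. \<forall>n\<ge>N. sqi (\<lambda>x. dv (\<phi> m) x - dv (\<phi> n) x) \<le> e"
    by (rule sqi_tendsto_0_Cauchy[OF L(7) L(3) L(5) assms(2)])
qed

lemma H1_Cauchy_pointwise:
  assumes t: "\<And>n. \<phi> n \<in> test_funs"
    and 1: "\<And>e. 0 < e \<Longrightarrow> \<exists>N. \<forall>m\<ge>N. \<forall>n\<ge>N. sqi (\<lambda>x. \<phi> m x - \<phi> n x) \<le> e"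
    and 2: "\<And>e. 0 < e \<Longrightarrow> \<exists>N. \<forall>m\<ge>N. \<forall>n\<ge>N. sqi (\<lambda>x. dv (\<phi> m) x - dv (\<phi> n) x) \<le> e"
  shows "convergent (\<lambda>n. \<phi> n x)"
proof (rule Cauchy_convergent, rule metric_CauchyI)
  fix e :: real assume e: "0 < e"
  then have e': "0 < e\<^sup>2 / 4" by simp
  obtain N1 where N1: "\<And>m n. m \<ge> N1 \<Longrightarrow> n \<ge> N1 \<Longrightarrow> sqi (\<lambda>x. \<phi> m x - \<phi> n x) \<le> e\<^sup>2 / 4"
    using 1[OF e'] by blast
  obtain N2 where N2: "\<And>m n. m \<ge> N2 \<Longrightarrow> n \<ge> N2 \<Longrightarrow> sqi (\<lambda>x. dv (\<phi> m) x - dv (\<phi> n) x) \<le> e\<^sup>2 / 4"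
    using 2[OF e'] by blast
  have "dist (\<phi> m x) (\<phi> n x) < e" if "m \<ge> max N1 N2" "n \<ge> max N1 N2" for m n
  proof -
    have "(cmod (\<phi> m x - \<phi> n x))\<^sup>2 \<le> sqi (\<lambda>x. \<phi> m x - \<phi> n x) + sqi (dv (\<lambda>x. \<phi> m x - \<phi> n x))"
      by (rule test_sup_le) (intro test_fun_diff t)
    also have "dv (\<lambda>x. \<phi> m x - \<phi> n x) = (\<lambda>x. dv (\<phi> m) x - dv (\<phi> n) x)"
      using dv_diff[OF t t] by blast
    also have "sqi (\<lambda>x. \<phi> m x - \<phi> n x) + sqi (\<lambda>x. dv (\<phi> m) x - dv (\<phi> n) x) \<le> e\<^sup>2 / 4 + e\<^sup>2 / 4"
      using that by (intro add_mono N1 N2) auto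
    also have "\<dots> < e\<^sup>2" using e by simp
    finally show ?thesis
      unfolding dist_norm by (rule power_less_imp_less_base) (use e in simp)
  qed
  then show "\<exists>M. \<forall>m\<ge>M. \<forall>n\<ge>M. dist (\<phi> m x) (\<phi> n x) < e" by blast
qed

text \<open>The functions converge at every point by the sup bound for differences, which gives
  \<open>u\<close>; the derivatives have only a limit in the mean, supplied by
  \<open>L2_complete\<close>.\<close>

lemma H1_complete:
  assumes t: "\<And>n. \<phi> n \<in> test_funs"
    and 1: "\<And>e. 0 < e \<Longrightarrow> \<exists>N. \<forall>m\<ge>N. \<forall>n\<ge>N. sqi (\<lambda>x. \<phi> m x - \<phi> n x) \<le> e"
    and 2: "\<And>e. 0 < e \<Longrightarrow> \<exists>N. \<forall>m\<ge>N. \<forall>n\<ge>N. sqi (\<lambda>x. dv (\<phi> m) x - dv (\<phi> n) x) \<le> e"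
  obtains u v where "H1_lim \<phi> u v" "\<And>x. (\<lambda>n. \<phi> n x) \<longlonglongrightarrow> u x"
proof -
  have L: "\<And>n. \<phi> n \<in> L2" "\<And>n. dv (\<phi> n) \<in> L2"
    by (intro test_fun_L2 test_fun_dv t)+
  define u where "u x = lim (\<lambda>n. \<phi> n x)" for x
  have lim: "(\<lambda>n. \<phi> n x) \<longlonglongrightarrow> u x" for x
    unfolding u_def using H1_Cauchy_pointwise[OF t 1 2] by (simp add: convergent_LIMSEQ_iff)
  have [measurable]: "\<phi> n \<in> borel_measurable halfline" for n by (rule L2_D(1)[OF L(1)])
  have u: "u \<in> borel_measurable halfline" unfolding u_def by measurable
  have ae: "AE x in halfline. (\<lambda>n. \<phi> n x) \<longlonglongrightarrow> u x" using lim by simp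
  note u2 = L2_Cauchy_limit[of \<phi>, OF L(1) u ae 1]
  obtain v where v: "v \<in> L2" "(\<lambda>n. sqi (\<lambda>x. v x - dv (\<phi> n) x)) \<longlonglongrightarrow> 0"
    by (rule L2_complete[of "\<lambda>n. dv (\<phi> n)", OF L(2) 2])
  have "H1_lim \<phi> u v" unfolding H1_lim_def using t u2 v by blast
  then show ?thesis using lim by (rule that)
qed

lemma sqi_0_AE:
  assumes "f \<in> L2" "sqi f = 0"
  shows "AE x in halfline. f x = 0"
proof -
  have "AE x in halfline. (cmod (f x))\<^sup>2 = 0"
    using integral_nonneg_eq_0_iff_AE[OF L2_D(2)[OF assms(1)]] assms(2) by (simp add: sqi_def)
  then show ?thesis by simp
qed

lemma L2_lim_unique:
  assumes "\<And>n. f n \<in> L2" "g \<in> L2" "h \<in> L2" "(\<lambda>n. sqi (\<lambda>x. g x - f n x)) \<longlonglongrightarrow> 0"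
    "(\<lambda>n. sqi (\<lambda>x. h x - f n x)) \<longlonglongrightarrow> 0"
  shows "AE x in halfline. g x = h x"
proof -
  have "sqrt (sqi (\<lambda>x. g x - h x)) \<le> 0"
  proof (rule LIMSEQ_le_const)
    show "(\<lambda>n. sqrt (sqi (\<lambda>x. g x - f n x)) + sqrt (sqi (\<lambda>x. h x - f n x))) \<longlonglongrightarrow> 0"
      using tendsto_add[OF tendsto_real_sqrt[OF assms(4)] tendsto_real_sqrt[OF assms(5)]] by simp
    have "sqrt (sqi (\<lambda>x. (g x - f n x) - (h x - f n x))) \<le> sqrt (sqi (\<lambda>x. g x - f n x)) + sqrt (sqi (\<lambda>x. h x - f n x))" for n
      by (intro L2_triangle_diff L2_diff assms)
    then show "\<exists>N. \<forall>n\<ge>N. sqrt (sqi (\<lambda>x. g x - h x)) \<le> sqrt (sqi (\<lambda>x. g x - f n x)) + sqrt (sqi (\<lambda>x. h x - f n x))"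
      by simp
  qed
  then have "sqi (\<lambda>x. g x - h x) = 0" using sqi_nonneg[of "\<lambda>x. g x - h x"] by simp
  from sqi_0_AE[OF L2_diff[OF assms(2,3)] this] show ?thesis by simp
qed

text \<open>The whole sequence converges almost everywhere, not just a subsequence: completeness
  yields an everywhere pointwise limit, which agrees with \<open>u\<close> by uniqueness of limits
  in the mean.\<close>

lemma H1_lim_AE:
  assumes "H1_lim \<phi> u v"
  shows "AE x in halfline. (\<lambda>n. \<phi> n x) \<longlonglongrightarrow> u x"
proof -
  note L = H1_lim_unfold[OF assms]
  obtain u' v' where u': "H1_lim \<phi> u' v'" "\<And>x. (\<lambda>n. \<phi> n x) \<longlonglongrightarrow> u' x"
    using H1_complete[OF L(1) H1_lim_Cauchy[OF assms]] by blast
  note L' = H1_lim_unfold[OF u'(1)]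
  have "AE x in halfline. u' x = u x"
    by (rule L2_lim_unique[OF L(6) L'(2) L(2) L'(4) L(4)])
  then show ?thesis by eventually_elim (use u'(2) in metis)
qed

lemma H1_lim_norms:
  assumes "H1_lim \<phi> u v"
  shows "(\<lambda>n. sqi (\<phi> n)) \<longlonglongrightarrow> sqi u" "(\<lambda>n. sqi (dv (\<phi> n))) \<longlonglongrightarrow> sqi v"
proof -
  note L = H1_lim_unfold[OF assms]
  show "(\<lambda>n. sqi (\<phi> n)) \<longlonglongrightarrow> sqi u" by (rule tendsto_sqi[OF L(6) L(2) L(4)])
  show "(\<lambda>n. sqi (dv (\<phi> n))) \<longlonglongrightarrow> sqi v" by (rule tendsto_sqi[OF L(7) L(3) L(5)])
qed

lemma H1_lim_bound:
  assumes "H1_lim \<phi> u v"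
  obtains B where "0 < B" "\<And>n x. cmod (\<phi> n x) \<le> B" "AE x in halfline. cmod (u x) \<le> B"
proof -
  have "Bseq (\<lambda>n. sqi (\<phi> n) + sqi (dv (\<phi> n)))"
    by (rule convergent_imp_Bseq[OF convergentI[OF tendsto_add[OF H1_lim_norms[OF assms]]]])
  then obtain K where K: "0 < K" "\<And>n. norm (sqi (\<phi> n) + sqi (dv (\<phi> n))) \<le> K"
    by (rule BseqE) blast
  have le: "cmod (\<phi> n x) \<le> sqrt K" for n x
  proof (rule real_le_rsqrt)
    have "(cmod (\<phi> n x))\<^sup>2 \<le> sqi (\<phi> n) + sqi (dv (\<phi> n))"
      by (rule test_sup_le[OF H1_lim_unfold(1)[OF assms]])
    also have "\<dots> \<le> K" using K(2)[of n] by simp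
    finally show "(cmod (\<phi> n x))\<^sup>2 \<le> K" .
  qed
  have "AE x in halfline. cmod (u x) \<le> sqrt K"
    using H1_lim_AE[OF assms]
  proof eventually_elim
    case (elim x)
    show ?case by (rule LIMSEQ_le_const2[OF tendsto_norm[OF elim]]) (use le in auto)
  qed
  then show ?thesis using that[of "sqrt K"] le K by simp
qed

text \<open>Hardy's inequality for differences of test functions makes the quotients a Cauchy
  sequence, so that division by \<open>x\<close> is continuous from \<open>H10\<close> to
  \<open>L2\<close>.\<close>

lemma H1_lim_Hardy:
  assumes "H1_lim \<phi> u v"
  shows "(\<lambda>x. u x / of_real x) \<in> L2"
    "(\<lambda>n. sqi (\<lambda>x. \<phi> n x / of_real x)) \<longlonglongrightarrow> sqi (\<lambda>x. u x / of_real x)"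
    "sqi (\<lambda>x. u x / of_real x) \<le> 4 * sqi v"
proof -
  note L = H1_lim_unfold[OF assms]
  have m: "(\<lambda>x. u x / of_real x) \<in> borel_measurable halfline"
  proof (rule borel_measurable_divide[OF L2_D(1)[OF L(2)]])
    have "(\<lambda>x. complex_of_real x) \<in> borel_measurable lebesgue"
      by (intro measurable_completion) simp
    then show "(\<lambda>x. complex_of_real x) \<in> borel_measurable halfline"
      by (rule measurable_restrict_space1)
  qed
  have ae: "AE x in halfline. (\<lambda>n. \<phi> n x / of_real x) \<longlonglongrightarrow> u x / of_real x"
    using H1_lim_AE[OF assms]
  proof eventually_elim
    case (elim x)
    from tendsto_mult_right[OF elim, of "inverse (of_real x)"] show ?case
      by (simp only: divide_inverse)
  qed
  have C: "\<exists>N. \<forall>m\<ge>N. \<forall>n\<ge>N. sqi (\<lambda>x. \<phi> m x / of_real x - \<phi> n x / of_real x) \<le> e" if e: "0 < e" for e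
  proof -
    have e4: "0 < e / 4" using e by simp
    obtain N where N: "\<And>m n. m \<ge> N \<Longrightarrow> n \<ge> N \<Longrightarrow> sqi (\<lambda>x. dv (\<phi> m) x - dv (\<phi> n) x) \<le> e / 4"
      using H1_lim_Cauchy(2)[OF assms e4] by blast
    have "sqi (\<lambda>x. \<phi> m x / of_real x - \<phi> n x / of_real x) \<le> e" if "m \<ge> N" "n \<ge> N" for m n
    proof -
      have "sqi (\<lambda>x. (\<phi> m x - \<phi> n x) / of_real x) \<le> 4 * sqi (dv (\<lambda>x. \<phi> m x - \<phi> n x))"
        by (rule test_Hardy_L2(2)) (intro test_fun_diff L)
      also have "dv (\<lambda>x. \<phi> m x - \<phi> n x) = (\<lambda>x. dv (\<phi> m) x - dv (\<phi> n) x)"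
        using dv_diff[OF L(1) L(1)] by blast
      also have "4 * sqi \<dots> \<le> e" using N[OF that] by simp
      finally show ?thesis by (simp only: diff_divide_distrib)
    qed
    then show ?thesis by blast
  qed
  note h = L2_Cauchy_limit[of "\<lambda>n x. \<phi> n x / of_real x", OF test_Hardy_L2(1)[OF L(1)] m ae C]
  show "(\<lambda>x. u x / of_real x) \<in> L2" by (rule h(1))
  show t: "(\<lambda>n. sqi (\<lambda>x. \<phi> n x / of_real x)) \<longlonglongrightarrow> sqi (\<lambda>x. u x / of_real x)"
    by (rule tendsto_sqi[of "\<lambda>n x. \<phi> n x / of_real x", OF test_Hardy_L2(1)[OF L(1)] h])
  show "sqi (\<lambda>x. u x / of_real x) \<le> 4 * sqi v"
    by (rule LIMSEQ_le[OF t tendsto_mult_left[OF H1_lim_norms(2)[OF assms]]])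
      (use test_Hardy_L2(2)[OF L(1)] in auto)
qed

lemma powr_Lipschitz:
  fixes s t k B :: real
  assumes "1 \<le> k" "0 \<le> s" "0 \<le> t" "s \<le> B" "t \<le> B"
  shows "\<bar>s powr k - t powr k\<bar> \<le> k * B powr (k - 1) * \<bar>s - t\<bar>"
proof -
  have *: "y powr k - x powr k \<le> k * B powr (k - 1) * (y - x)" if xy: "0 \<le> x" "x < y" "y \<le> B" for x y
  proof -
    have d: "((\<lambda>x. x powr k) has_real_derivative k * z powr (k - 1)) (at z)" if "x < z" for z
      using that xy by (intro has_real_derivative_powr) auto
    have "\<exists>l z. x < z \<and> z < y \<and> ((\<lambda>x. x powr k) has_real_derivative l) (at z) \<and> y powr k - x powr k = (y - x) * l"
    proof (rule MVT[OF xy(2)])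
      show "continuous_on {x..y} (\<lambda>x. x powr k)"
        using assms xy by (intro continuous_on_powr' continuous_intros) auto
      show "(\<lambda>x. x powr k) differentiable (at z)" if "x < z" for z
        using d[OF that] by (auto simp: real_differentiable_def)
    qed
    then obtain l z where z': "x < z" "z < y" "((\<lambda>x. x powr k) has_real_derivative l) (at z)"
      "y powr k - x powr k = (y - x) * l" by blast
    have "l = k * z powr (k - 1)" by (rule DERIV_unique[OF z'(3) d[OF z'(1)]])
    with z' have z: "x < z" "z < y" "y powr k - x powr k = (y - x) * (k * z powr (k - 1))" by auto
    have "z powr (k - 1) \<le> B powr (k - 1)" using z xy assms by (intro powr_mono2) auto
    then have "(y - x) * (k * z powr (k - 1)) \<le> (y - x) * (k * B powr (k - 1))"
      using xy assms by (intro mult_left_mono) auto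
    then show ?thesis using z by (simp add: mult_ac)
  qed
  have m: "x powr k \<le> y powr k" if "0 \<le> x" "x \<le> y" for x y :: real
    using that assms by (intro powr_mono2) auto
  show ?thesis
    using *[of s t] *[of t s] m[of s t] m[of t s] assms by (cases s t rule: linorder_cases) auto
qed

text \<open>The map \<open>z \<mapsto> cmod z powr (q / 2)\<close> is Lipschitz on bounded sets
  because \<open>q / 2 \<ge> 1\<close>, and the sup bound confines all values to one such set.
  Convergence of the power integrals thus becomes convergence in \<open>L2\<close> of the functions
  \<open>W\<close>.\<close>

lemma H1_lim_pint:
  assumes "H1_lim \<phi> u v" "2 \<le> q"
  shows "integrable halfline (\<lambda>x. cmod (u x) powr q)" "(\<lambda>n. pint q (\<phi> n)) \<longlonglongrightarrow> pint q u"
proof -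
  note L = H1_lim_unfold[OF assms(1)]
  obtain B where B: "0 < B" "\<And>n x. cmod (\<phi> n x) \<le> B" "AE x in halfline. cmod (u x) \<le> B"
    by (rule H1_lim_bound[OF assms(1)]) blast
  define W where "W w x = complex_of_real (cmod (w x) powr (q / 2))" for w :: "real \<Rightarrow> complex" and x :: real
  define K where "K = q / 2 * B powr (q / 2 - 1)"
  have sq: "(cmod (W w x))\<^sup>2 = cmod (w x) powr q" for w x
  proof -
    have "(cmod (w x) powr (q / 2))\<^sup>2 = cmod (w x) powr (q / 2 + q / 2)"
      unfolding powr_add by (rule power2_eq_square)
    then show ?thesis by (simp add: W_def)
  qed
  have m: "W w \<in> borel_measurable halfline" if "w \<in> L2" for w
    unfolding W_def using L2_D(1)[OF that] by measurable
  have lip: "cmod (W w x - W w' x) \<le> K * cmod (w x - w' x)" if "cmod (w x) \<le> B" "cmod (w' x) \<le> B" for w w' x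
  proof -
    have "cmod (W w x - W w' x) = \<bar>cmod (w x) powr (q / 2) - cmod (w' x) powr (q / 2)\<bar>"
      unfolding W_def by (metis norm_of_real of_real_diff)
    also have "\<dots> \<le> K * \<bar>cmod (w x) - cmod (w' x)\<bar>"
      unfolding K_def using that assms(2) by (intro powr_Lipschitz) auto
    also have "\<dots> \<le> K * cmod (w x - w' x)"
      using assms(2) by (intro mult_left_mono norm_triangle_ineq3) (auto simp: K_def)
    finally show ?thesis .
  qed
  have W0: "W w x = 0" if "w x = 0" for w x using that by (simp add: W_def)
  have WL: "W w \<in> L2" if w: "w \<in> L2" and b: "AE x in halfline. cmod (w x) \<le> B" for w
  proof (rule L2_dominated[OF w m[OF w], of K])
    show "AE x in halfline. cmod (W w x) \<le> K * cmod (w x)"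
      using b by eventually_elim (use lip[of w _ "\<lambda>x. 0"] B(1) in \<open>auto simp: W0\<close>)
  qed
  have Wu: "W u \<in> L2" by (rule WL[OF L(2) B(3)])
  have W\<phi>: "W (\<phi> n) \<in> L2" for n by (rule WL[OF L(6)]) (use B in auto)
  have "integrable halfline (\<lambda>x. (cmod (W u x))\<^sup>2)" by (rule L2_D(2)[OF Wu])
  then show "integrable halfline (\<lambda>x. cmod (u x) powr q)" by (simp only: sq)
  have pi: "pint q w = sqi (W w)" for w by (simp only: pint_def sqi_def sq)
  have "(\<lambda>n. sqi (\<lambda>x. W u x - W (\<phi> n) x)) \<longlonglongrightarrow> 0"
  proof (rule Lim_null_comparison[OF always_eventually], intro allI)
    show "(\<lambda>n. K\<^sup>2 * sqi (\<lambda>x. u x - \<phi> n x)) \<longlonglongrightarrow> 0"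
      using tendsto_mult_left[OF L(4), of "K\<^sup>2"] by simp
    fix n
    have "sqi (\<lambda>x. W u x - W (\<phi> n) x) \<le> (\<integral>x. K\<^sup>2 * (cmod (u x - \<phi> n x))\<^sup>2 \<partial>halfline)"
      unfolding sqi_def
    proof (rule integral_mono_AE)
      show "integrable halfline (\<lambda>x. (cmod (W u x - W (\<phi> n) x))\<^sup>2)" by (intro L2_D(2) L2_diff Wu W\<phi>)
      show "integrable halfline (\<lambda>x. K\<^sup>2 * (cmod (u x - \<phi> n x))\<^sup>2)"
        by (intro integrable_mult_right L2_D(2) L2_diff L)
      show "AE x in halfline. (cmod (W u x - W (\<phi> n) x))\<^sup>2 \<le> K\<^sup>2 * (cmod (u x - \<phi> n x))\<^sup>2"
        using B(3)
      proof eventually_elim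
        case (elim x)
        have "(cmod (W u x - W (\<phi> n) x))\<^sup>2 \<le> (K * cmod (u x - \<phi> n x))\<^sup>2"
          by (intro power_mono lip elim B) auto
        then show ?case by (simp only: power_mult_distrib)
      qed
    qed
    then show "norm (sqi (\<lambda>x. W u x - W (\<phi> n) x)) \<le> K\<^sup>2 * sqi (\<lambda>x. u x - \<phi> n x)"
      by (simp add: sqi_def)
  qed
  from tendsto_sqi[OF W\<phi> Wu this] show "(\<lambda>n. pint q (\<phi> n)) \<longlonglongrightarrow> pint q u"
    by (simp only: pi)
qed

lemma H10_Hardy:
  assumes "u \<in> H10"
  shows "(\<lambda>x. u x / of_real x) \<in> L2" "sqi (\<lambda>x. u x / of_real x) \<le> 4 * sqi (wderiv u)"
proof -
  obtain \<phi> where "H1_lim \<phi> u (wderiv u)" by (rule H10_lim[OF assms])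
  from H1_lim_Hardy[OF this] show "(\<lambda>x. u x / of_real x) \<in> L2" "sqi (\<lambda>x. u x / of_real x) \<le> 4 * sqi (wderiv u)"
    by blast+
qed

lemma H10_pint_integrable:
  assumes "u \<in> H10" "2 \<le> q"
  shows "integrable halfline (\<lambda>x. cmod (u x) powr q)"
proof -
  obtain \<phi> where "H1_lim \<phi> u (wderiv u)" by (rule H10_lim[OF assms(1)])
  from H1_lim_pint(1)[OF this assms(2)] show ?thesis .
qed

lemma H10_bound:
  assumes "u \<in> H10"
  obtains B where "0 < B" "AE x in halfline. cmod (u x) \<le> B"
proof -
  obtain \<phi> where "H1_lim \<phi> u (wderiv u)" by (rule H10_lim[OF assms])
  then show ?thesis by (rule H1_lim_bound) (rule that)
qed

section \<open>The functionals and their behaviour under multiples and dilations\<close>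

lemma H_fun_eq:
  assumes "u \<in> H10"
  shows "H_fun c u = sqi (wderiv u) - c * sqi (\<lambda>x. u x / of_real x)"
proof -
  have "H_fun c u = (\<integral>x. (cmod (wderiv u x))\<^sup>2 - c * (cmod (u x / of_real x))\<^sup>2 \<partial>halfline)"
    unfolding H_fun_def
    by (intro Bochner_Integration.integral_cong) (auto simp: norm_divide power_divide)
  also have "\<dots> = sqi (wderiv u) - c * sqi (\<lambda>x. u x / of_real x)"
    unfolding sqi_def using L2_D(2)[OF H10_L2(2)[OF assms]] L2_D(2)[OF H10_Hardy(1)[OF assms]]
    by (subst Bochner_Integration.integral_diff) (auto intro: integrable_mult_right)
  finally show ?thesis .
qed

lemma Lnorm_powr:
  assumes "0 < q"
  shows "Lnorm q u powr q = pint q u"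
proof -
  have "Lnorm q u powr q = pint q u powr (1 / q * q)"
    unfolding Lnorm_def pint_def[symmetric] by (rule powr_powr)
  then show ?thesis using assms by simp
qed

lemma sqi_wderiv_cong:
  assumes "u \<in> H10" "AE x in halfline. wderiv u x = f x" "f \<in> borel_measurable halfline"
  shows "sqi (wderiv u) = sqi f"
  by (rule sqi_cong_AE[OF assms(2) L2_D(1)[OF H10_L2(2)[OF assms(1)]] assms(3)])

lemma scale_identities:
  assumes "u \<in> H10"
  shows "H_fun c (\<lambda>x. a * u x) = (cmod a)\<^sup>2 * H_fun c u"
    "pint q (\<lambda>x. a * u x) = cmod a powr q * pint q u"
proof -
  have 1: "sqi (wderiv (\<lambda>x. a * u x)) = (cmod a)\<^sup>2 * sqi (wderiv u)"
    using sqi_wderiv_cong[OF H10_scale[OF assms] wderiv_scale[OF assms] L2_D(1)[OF L2_scale[OF H10_L2(2)[OF assms]]]]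
    by (simp only: sqi_scale)
  have 2: "sqi (\<lambda>x. a * u x / of_real x) = (cmod a)\<^sup>2 * sqi (\<lambda>x. u x / of_real x)"
    using sqi_scale[of a "\<lambda>x. u x / of_real x"] by simp
  show "H_fun c (\<lambda>x. a * u x) = (cmod a)\<^sup>2 * H_fun c u"
    unfolding H_fun_eq[OF H10_scale[OF assms]] H_fun_eq[OF assms] 1 2 by (simp add: algebra_simps)
  show "pint q (\<lambda>x. a * u x) = cmod a powr q * pint q u"
    unfolding pint_def by (simp add: norm_mult powr_mult)
qed

lemma dilate_identities:
  assumes "u \<in> H10" "0 < l"
  shows "H_fun c (\<lambda>x. u (l * x)) = l * H_fun c u"
    "2 \<le> q \<Longrightarrow> pint q (\<lambda>x. u (l * x)) = pint q u / l"
    "sqi (\<lambda>x. u (l * x)) = sqi u / l"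
proof -
  have 1: "sqi (wderiv (\<lambda>x. u (l * x))) = l * sqi (wderiv u)"
  proof -
    have "sqi (wderiv (\<lambda>x. u (l * x))) = sqi (\<lambda>x. of_real l * wderiv u (l * x))"
      by (rule sqi_wderiv_cong[OF H10_dilate[OF assms] wderiv_dilate[OF assms]])
        (intro L2_D(1) L2_scale L2_dilate(1) assms H10_L2)
    also have "\<dots> = l\<^sup>2 * (sqi (wderiv u) / l)"
      using assms by (simp only: sqi_scale L2_dilate(2)[OF assms(2) H10_L2(2)[OF assms(1)]] norm_of_real power2_abs)
    finally show ?thesis using assms by (simp add: power2_eq_square)
  qed
  have 2: "sqi (\<lambda>x. u (l * x) / of_real x) = l * sqi (\<lambda>x. u x / of_real x)"
  proof -
    have "(\<lambda>x. u (l * x) / of_real x) = (\<lambda>x. of_real l * (u (l * x) / of_real (l * x)))"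
      using assms by (auto simp: fun_eq_iff)
    then have "sqi (\<lambda>x. u (l * x) / of_real x) = l\<^sup>2 * (sqi (\<lambda>x. u x / of_real x) / l)"
      using L2_dilate(2)[OF assms(2) H10_Hardy(1)[OF assms(1)]] by (simp only: sqi_scale norm_of_real power2_abs)
    then show ?thesis using assms by (simp add: power2_eq_square)
  qed
  show "H_fun c (\<lambda>x. u (l * x)) = l * H_fun c u"
    unfolding H_fun_eq[OF H10_dilate[OF assms]] H_fun_eq[OF assms(1)] 1 2 by (simp add: algebra_simps)
  show "sqi (\<lambda>x. u (l * x)) = sqi u / l"
    by (rule L2_dilate(2)[OF assms(2) H10_L2(1)[OF assms(1)]])
  assume "2 \<le> q"
  from integral_dilate[OF assms(2) borel_measurable_integrable[OF H10_pint_integrable[OF assms(1) this]]]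
  show "pint q (\<lambda>x. u (l * x)) = pint q u / l" by (simp add: pint_def)
qed

section \<open>The variational problem\<close>

context hardy_nls
begin

definition "Q u = H_fun c u + \<omega> * sqi u"

abbreviation "P u \<equiv> pint (p + 1) u"

text \<open>A coercivity constant: \<open>1 - 4 * c\<close> is what Hardy's constant
  \<open>4\<close> leaves of the kinetic term, and \<open>\<omega>\<close> controls the mass
  term.\<close>

definition "\<kappa> = min (1 - 4 * c) \<omega>"

lemma kappa: "0 < \<kappa>" "\<kappa> \<le> 1 - 4 * c" "\<kappa> \<le> \<omega>"
  using c_less omega by (auto simp: \<kappa>_def)

lemma p1_theta: "(p + 1) * \<theta> = 2"
  unfolding \<theta>_def times_divide_eq_right using p_gt by (intro nonzero_mult_div_cancel_left) auto

lemma H_fun_ge: "u \<in> H10 \<Longrightarrow> (1 - 4 * c) * sqi (wderiv u) \<le> H_fun c u"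
  using mult_left_mono[OF H10_Hardy(2), of u c] c_pos
  by (simp add: H_fun_eq algebra_simps)

lemma Q_coercive: "u \<in> H10 \<Longrightarrow> \<kappa> * (sqi u + sqi (wderiv u)) \<le> Q u"
  using H_fun_ge[of u] mult_right_mono[OF kappa(2) sqi_nonneg[of "wderiv u"]]
    mult_right_mono[OF kappa(3) sqi_nonneg[of u]]
  by (simp add: Q_def algebra_simps)

lemma Q_nonneg: "u \<in> H10 \<Longrightarrow> 0 \<le> Q u"
  by (rule order_trans[OF _ Q_coercive]) (use kappa(1) in \<open>auto intro!: mult_nonneg_nonneg add_nonneg_nonneg\<close>)

lemma sqi_wderiv_test: "\<phi> \<in> test_funs \<Longrightarrow> sqi (wderiv \<phi>) = sqi (dv \<phi>)"
  by (rule sqi_wderiv_cong[OF test_fun_H10]) (auto intro!: L2_D(1) test_fun_L2 test_fun_dv)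

lemma Q_test:
  "\<phi> \<in> test_funs \<Longrightarrow> Q \<phi> = sqi (dv \<phi>) - c * sqi (\<lambda>x. \<phi> x / of_real x) + \<omega> * sqi \<phi>"
  by (simp add: Q_def H_fun_eq test_fun_H10 sqi_wderiv_test)

lemma Q_test_coercive: "\<phi> \<in> test_funs \<Longrightarrow> \<kappa> * (sqi \<phi> + sqi (dv \<phi>)) \<le> Q \<phi>"
  using Q_coercive[of \<phi>] by (simp add: test_fun_H10 sqi_wderiv_test)

lemma Q_lim:
  assumes "H1_lim \<phi> u v"
  shows "(\<lambda>n. Q (\<phi> n)) \<longlonglongrightarrow> Q u"
proof -
  note D = H1_lim_D[OF assms]
  have "sqi (wderiv u) = sqi v"
    by (rule sqi_wderiv_cong[OF D(1,3) L2_D(1)[OF H1_lim_unfold(3)[OF assms]]])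
  then have Qu: "Q u = sqi v - c * sqi (\<lambda>x. u x / of_real x) + \<omega> * sqi u"
    by (simp add: Q_def H_fun_eq D(1))
  show ?thesis
    unfolding Qu Q_test[OF H1_lim_unfold(1)[OF assms]]
    by (intro tendsto_intros H1_lim_norms[OF assms] H1_lim_Hardy[OF assms])
qed

lemma P_lim: "H1_lim \<phi> u v \<Longrightarrow> (\<lambda>n. P (\<phi> n)) \<longlonglongrightarrow> P u"
  by (rule H1_lim_pint) (use p_gt in auto)

lemma Q_scale: "u \<in> H10 \<Longrightarrow> Q (\<lambda>x. a * u x) = (cmod a)\<^sup>2 * Q u"
  by (simp add: Q_def scale_identities(1) sqi_scale algebra_simps)

lemma P_scale: "u \<in> H10 \<Longrightarrow> P (\<lambda>x. a * u x) = cmod a powr (p + 1) * P u"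
  by (rule scale_identities(2))

lemma nonzero_pos:
  assumes "u \<in> H10_nonzero"
  shows "0 < H_fun c u" "0 < sqi u" "0 < P u"
proof -
  have u: "u \<in> H10" and nz: "\<not> (AE x in halfline. u x = 0)"
    using assms by (auto simp: H10_nonzero_def)
  have "sqi u \<noteq> 0" using sqi_0_AE[OF H10_L2(1)[OF u]] nz by blast
  then show "0 < sqi u" using sqi_nonneg[of u] unfolding less_le by simp
  have "sqi (wderiv u) \<noteq> 0"
  proof
    assume "sqi (wderiv u) = 0"
    then have "sqi (\<lambda>x. u x / of_real x) = 0"
      using H10_Hardy(2)[OF u] sqi_nonneg[of "\<lambda>x. u x / of_real x"] by linarith
    from sqi_0_AE[OF H10_Hardy(1)[OF u] this] AE_space[of halfline]
    have "AE x in halfline. u x = 0"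
      by eventually_elim (auto simp: space_restrict_space)
    then show False using nz by blast
  qed
  then have "0 < sqi (wderiv u)" using sqi_nonneg[of "wderiv u"] unfolding less_le by simp
  then have "0 < (1 - 4 * c) * sqi (wderiv u)" using c_less by simp
  then show "0 < H_fun c u" using H_fun_ge[OF u] by linarith
  have "P u \<noteq> 0"
  proof
    assume "P u = 0"
    then have "AE x in halfline. cmod (u x) powr (p + 1) = 0"
      unfolding pint_def using p_gt
      by (subst (asm) integral_nonneg_eq_0_iff_AE[OF H10_pint_integrable[OF u]]) auto
    then show False using nz by simp
  qed
  then show "0 < P u" using pint_nonneg[of "p + 1" u] unfolding less_le by simp
qed

lemma P_pos_nonzero: "u \<in> H10 \<Longrightarrow> 0 < P u \<Longrightarrow> u \<in> H10_nonzero"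
proof -
  assume u: "u \<in> H10" "0 < P u"
  have "\<not> (AE x in halfline. u x = 0)"
  proof
    assume "AE x in halfline. u x = 0"
    then have "AE x in halfline. cmod (u x) powr (p + 1) = 0" by eventually_elim simp
    then have "P u = 0" unfolding pint_def by (rule integral_eq_zero_AE)
    then show False using u by simp
  qed
  then show ?thesis using u by (simp add: H10_nonzero_def)
qed

text \<open>The factor \<open>cmod (\<phi> x) powr (p - 1)\<close> is bounded by the sup estimate,
  and the remaining square integrates to \<open>sqi \<phi>\<close>.\<close>

lemma test_Sobolev:
  assumes "\<phi> \<in> test_funs"
  shows "P \<phi> powr \<theta> \<le> sqi \<phi> + sqi (dv \<phi>)"
proof -
  define h where "h = sqi \<phi> + sqi (dv \<phi>)"
  have h: "0 \<le> h" "sqi \<phi> \<le> h" by (auto simp: h_def)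
  have "P \<phi> \<le> (\<integral>x. h powr ((p - 1) / 2) * (cmod (\<phi> x))\<^sup>2 \<partial>halfline)"
    unfolding pint_def
  proof (rule integral_mono)
    show "integrable halfline (\<lambda>x. cmod (\<phi> x) powr (p + 1))"
      using p_gt by (intro test_pint_integrable assms) auto
    show "integrable halfline (\<lambda>x. h powr ((p - 1) / 2) * (cmod (\<phi> x))\<^sup>2)"
      by (intro integrable_mult_right test_sq_integrable assms)
    fix x
    have "cmod (\<phi> x) powr (p - 1) = ((cmod (\<phi> x))\<^sup>2) powr ((p - 1) / 2)"
    proof -
      have "((cmod (\<phi> x)) powr 2) powr ((p - 1) / 2) = cmod (\<phi> x) powr (2 * ((p - 1) / 2))" by (rule powr_powr)
      also have "2 * ((p - 1) / 2) = p - 1" by simp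
      finally show ?thesis by simp
    qed
    also have "\<dots> \<le> h powr ((p - 1) / 2)"
      using test_sup_le[OF assms, of x] p_gt by (intro powr_mono2) (auto simp: h_def)
    finally have "(cmod (\<phi> x))\<^sup>2 * cmod (\<phi> x) powr (p - 1) \<le> (cmod (\<phi> x))\<^sup>2 * h powr ((p - 1) / 2)"
      by (intro mult_left_mono) auto
    then show "cmod (\<phi> x) powr (p + 1) \<le> h powr ((p - 1) / 2) * (cmod (\<phi> x))\<^sup>2"
      using powr_split_sq[of "cmod (\<phi> x)" "p + 1"] p_gt by (simp add: mult.commute)
  qed
  also have "\<dots> = h powr ((p - 1) / 2) * sqi \<phi>" by (simp add: sqi_def)
  also have "\<dots> \<le> h powr ((p - 1) / 2) * h" using h by (intro mult_left_mono) auto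
  also have "\<dots> = h powr ((p + 1) / 2)"
  proof (cases "h = 0")
    case False
    then have "h powr ((p - 1) / 2) * h powr 1 = h powr ((p - 1) / 2 + 1)" by (simp only: powr_add)
    also have "(p - 1) / 2 + 1 = (p + 1) / 2" by (simp add: field_simps)
    finally show ?thesis using h by simp
  qed simp
  finally have "P \<phi> powr \<theta> \<le> (h powr ((p + 1) / 2)) powr \<theta>"
    using theta by (intro powr_mono2) auto
  also have "\<dots> = h powr ((p + 1) / 2 * \<theta>)" by (rule powr_powr)
  also have "(p + 1) / 2 * \<theta> = 1" using p1_theta by simp
  finally show ?thesis using h by (simp add: h_def)
qed

section \<open>A truncated soliton beats the translation-invariant problem\<close>

text \<open>The two parameters are fixed by \<open>\<alpha> * (p - 1) = 2\<close>, which makes the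
  power \<open>p - 1\<close> of the soliton equal to \<open>1 - tanh^2\<close>, and by
  \<open>\<alpha> * \<beta> = sqrt \<omega>\<close>, its exponential decay rate.\<close>

definition "\<alpha> = 2 / (p - 1)"
definition "\<beta> = sqrt \<omega> * (p - 1) / 2"

lemma alpha_beta: "0 < \<alpha>" "0 < \<beta>" "\<alpha> * \<beta> = sqrt \<omega>" "\<alpha> * (p - 1) = 2" "sqrt \<omega> * \<beta> = \<omega> * (p - 1) / 2"
proof -
  have "2 / (p - 1) * (p - 1) = 2"
    unfolding times_divide_eq_left using p_gt by (intro nonzero_mult_div_cancel_right) auto
  then show "\<alpha> * (p - 1) = 2" by (simp only: \<alpha>_def)
qed (use p_gt omega in \<open>auto simp: \<alpha>_def \<beta>_def\<close>)

text \<open>The ground state of the problem without potential on the line, scaled to height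
  \<open>1\<close>; it solves
  \<open>s'' = \<omega> * s - \<omega> * (p + 1) / 2 * s^p\<close>.\<close>

definition soliton :: "real \<Rightarrow> real" where
  "soliton z = cosh (\<beta> * z) powr (- \<alpha>)"

definition soliton' :: "real \<Rightarrow> real" where
  "soliton' z = - (sqrt \<omega> * tanh (\<beta> * z) * soliton z)"

lemma soliton_deriv: "(soliton has_real_derivative soliton' z) (at z)"
proof -
  have c: "0 < cosh (\<beta> * z)" by (rule cosh_real_pos)
  have 1: "((\<lambda>z. cosh (\<beta> * z)) has_real_derivative sinh (\<beta> * z) * \<beta>) (at z)"
    by (auto intro!: derivative_eq_intros)
  have "((\<lambda>z. cosh (\<beta> * z) powr (- \<alpha>)) has_real_derivative (- \<alpha> * cosh (\<beta> * z) powr (- \<alpha> - 1)) * (sinh (\<beta> * z) * \<beta>)) (at z)"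
    by (rule DERIV_chain2[OF has_real_derivative_powr[OF c] 1])
  moreover have "cosh (\<beta> * z) powr (- \<alpha> - 1) = cosh (\<beta> * z) powr (- \<alpha>) / cosh (\<beta> * z)"
    using c by (simp add: powr_diff)
  moreover have "(- \<alpha> * (cosh (\<beta> * z) powr (- \<alpha>) / cosh (\<beta> * z))) * (sinh (\<beta> * z) * \<beta>) = soliton' z"
    unfolding soliton'_def soliton_def alpha_beta(3)[symmetric] tanh_def by simp
  ultimately show ?thesis unfolding soliton_def[abs_def] by simp
qed

lemma soliton_pos: "0 < soliton z"
  using cosh_real_pos[of "\<beta> * z"] by (simp add: soliton_def)

lemma soliton_le_exp: "soliton z \<le> 2 powr \<alpha> * exp (- (sqrt \<omega> * \<bar>z\<bar>))"
proof -
  have "exp \<bar>\<beta> * z\<bar> / 2 \<le> cosh \<bar>\<beta> * z\<bar>" by (simp add: cosh_def)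
  also have "cosh \<bar>\<beta> * z\<bar> = cosh (\<beta> * z)" by (simp add: abs_if)
  finally have "soliton z \<le> (exp \<bar>\<beta> * z\<bar> / 2) powr (- \<alpha>)"
    unfolding soliton_def using alpha_beta by (intro powr_mono2') auto
  also have "\<dots> = exp \<bar>\<beta> * z\<bar> powr (- \<alpha>) / 2 powr (- \<alpha>)" by (simp add: powr_divide)
  also have "\<dots> = 2 powr \<alpha> * exp (\<bar>\<beta> * z\<bar> * (- \<alpha>))"
    by (simp add: powr_minus divide_inverse exp_powr_real exp_minus)
  also have "\<bar>\<beta> * z\<bar> * (- \<alpha>) = - (sqrt \<omega> * \<bar>z\<bar>)"
    using alpha_beta by (simp add: abs_mult flip: alpha_beta(3))
  finally show ?thesis .
qed

lemma soliton_powr: "soliton z powr (p - 1) = 1 - (tanh (\<beta> * z))\<^sup>2"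
proof -
  have c: "0 < cosh (\<beta> * z)" by (rule cosh_real_pos)
  have "soliton z powr (p - 1) = cosh (\<beta> * z) powr (- (\<alpha> * (p - 1)))"
    unfolding soliton_def by (simp add: powr_powr)
  also have "\<dots> = 1 / (cosh (\<beta> * z))\<^sup>2"
    unfolding alpha_beta(4) using c by (simp add: powr_minus_divide)
  also have "\<dots> = 1 - (tanh (\<beta> * z))\<^sup>2"
  proof -
    have "(sinh (\<beta> * z))\<^sup>2 = (cosh (\<beta> * z))\<^sup>2 - 1" using cosh_square_eq[of "\<beta> * z"] by simp
    then show ?thesis using c unfolding tanh_def power_divide by (simp add: diff_divide_distrib)
  qed
  finally show ?thesis .
qed

lemma soliton_powr_p1: "soliton z powr (p + 1) = (soliton z)\<^sup>2 * (1 - (tanh (\<beta> * z))\<^sup>2)"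
  using powr_split_sq[of "soliton z" "p + 1"] soliton_pos[of z] p_gt soliton_powr[of z] by simp

text \<open>The first integral of the soliton equation, with energy constant
  \<open>0\<close>.\<close>

lemma soliton'_sq: "(soliton' z)\<^sup>2 = \<omega> * (soliton z)\<^sup>2 - \<omega> * soliton z powr (p + 1)"
  unfolding soliton_powr_p1 using omega by (simp add: soliton'_def power_mult_distrib algebra_simps)

lemma soliton_sq_le_1: "(soliton z)\<^sup>2 \<le> 1"
proof -
  have "soliton z \<le> 1 powr (- \<alpha>)"
    unfolding soliton_def using alpha_beta cosh_real_ge_1[of "\<beta> * z"] by (intro powr_mono2') auto
  then show ?thesis using soliton_pos[of z] by (simp add: power_le_one)
qed

lemma soliton_0: "soliton 0 = 1"
  by (simp add: soliton_def)

lemma soliton_even: "soliton (- z) = soliton z"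
  by (simp add: soliton_def)

text \<open>The equality case of the calibration. It makes the kinetic energy of the soliton a
  difference of values of \<open>gn_prim\<close>, so no integral has to be evaluated in closed form;
  the sign changes at the peak, where the intervals are split later.\<close>

lemma gn_prim_soliton_deriv:
  "((\<lambda>z. gn_prim ((soliton z)\<^sup>2)) has_real_derivative (if 0 \<le> z then - (soliton' z)\<^sup>2 else (soliton' z)\<^sup>2)) (at z)"
proof -
  have "((\<lambda>z. (soliton z)\<^sup>2) has_real_derivative 2 * (soliton z * soliton' z)) (at z)"
    using soliton_deriv[of z] by (auto intro!: derivative_eq_intros)
  from DERIV_chain2[OF gn_prim(1) this]
  have d: "((\<lambda>z. gn_prim ((soliton z)\<^sup>2)) has_real_derivative gn_density ((soliton z)\<^sup>2) * (2 * (soliton z * soliton' z))) (at z)" .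
  have "((soliton z)\<^sup>2) powr ((p - 1) / 2) = soliton z powr (p - 1)"
  proof -
    have "(soliton z powr 2) powr ((p - 1) / 2) = soliton z powr (2 * ((p - 1) / 2))" by (rule powr_powr)
    also have "2 * ((p - 1) / 2) = p - 1" by simp
    finally show ?thesis using soliton_pos[of z] by simp
  qed
  then have g: "gn_density ((soliton z)\<^sup>2) = sqrt \<omega> / 2 * \<bar>tanh (\<beta> * z)\<bar>"
    by (simp add: gn_density_def soliton_powr)
  have "gn_density ((soliton z)\<^sup>2) * (2 * (soliton z * soliton' z)) = (if 0 \<le> z then - (soliton' z)\<^sup>2 else (soliton' z)\<^sup>2)"
  proof (cases "0 \<le> z")
    case True
    then have "\<bar>tanh (\<beta> * z)\<bar> = tanh (\<beta> * z)" using alpha_beta by simp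
    then show ?thesis using True unfolding g by (simp add: soliton'_def power2_eq_square)
  next
    case False
    then have "\<beta> * z < 0" using alpha_beta by (simp add: mult_pos_neg)
    then have "\<bar>tanh (\<beta> * z)\<bar> = - tanh (\<beta> * z)" by (simp add: less_imp_le)
    then show ?thesis using False unfolding g by (simp add: soliton'_def power2_eq_square)
  qed
  with d show ?thesis by simp
qed

lemma soliton_kinetic:
  assumes "0 \<le> T"
  shows "((\<lambda>z. (soliton' z)\<^sup>2) has_integral 2 * gn_a - 2 * gn_prim ((soliton T)\<^sup>2)) {-T..T}"
proof -
  have 1: "((\<lambda>z. (soliton' z)\<^sup>2) has_integral - gn_prim ((soliton T)\<^sup>2) - (- gn_prim ((soliton 0)\<^sup>2))) {0..T}"
  proof (rule FTC_eq[OF assms, of "\<lambda>z. - gn_prim ((soliton z)\<^sup>2)"])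
    fix z :: real assume "0 \<le> z"
    with DERIV_minus[OF gn_prim_soliton_deriv[of z]]
    show "((\<lambda>z. - gn_prim ((soliton z)\<^sup>2)) has_real_derivative (soliton' z)\<^sup>2) (at z)" by simp
  qed
  have 2: "((\<lambda>z. (soliton' z)\<^sup>2) has_integral gn_prim ((soliton 0)\<^sup>2) - gn_prim ((soliton (-T))\<^sup>2)) {-T..0}"
  proof (rule FTC_eq)
    fix z :: real assume "z \<le> 0"
    have "(if 0 \<le> z then - (soliton' z)\<^sup>2 else (soliton' z)\<^sup>2) = (soliton' z)\<^sup>2"
      using \<open>z \<le> 0\<close> by (auto simp: soliton'_def)
    with gn_prim_soliton_deriv[of z]
    show "((\<lambda>z. gn_prim ((soliton z)\<^sup>2)) has_real_derivative (soliton' z)\<^sup>2) (at z)" by simp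
  qed (use assms in simp)
  show ?thesis
    using has_integral_combine[OF _ _ 2 1] assms by (simp add: soliton_0 soliton_even gn_a_def algebra_simps)
qed

text \<open>The function \<open>?D\<close> is \<open>soliton * soliton'\<close>; its derivative
  takes this form once the soliton equation and the first integral are inserted. The identity
  expresses the power integral through the kinetic energy.\<close>

lemma soliton_virial:
  assumes "0 \<le> T"
  shows "((\<lambda>z. 2 * (soliton' z)\<^sup>2 - (p - 1) / 2 * \<omega> * soliton z powr (p + 1)) has_integral
     - (2 * sqrt \<omega> * tanh (\<beta> * T) * (soliton T)\<^sup>2)) {-T..T}"
proof -
  let ?D = "\<lambda>z. - sqrt \<omega> * (tanh (\<beta> * z) * (soliton z)\<^sup>2)"
  have "((\<lambda>z. 2 * (soliton' z)\<^sup>2 - (p - 1) / 2 * \<omega> * soliton z powr (p + 1)) has_integral ?D T - ?D (-T)) {-T..T}"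
  proof (rule FTC_eq)
    fix z :: real
    have c: "cosh (\<beta> * z) \<noteq> 0" using cosh_real_pos[of "\<beta> * z"] by simp
    have 1: "((\<lambda>z. tanh (\<beta> * z)) has_real_derivative (1 - (tanh (\<beta> * z))\<^sup>2) * \<beta>) (at z)"
      using c by (auto intro!: derivative_eq_intros)
    have 2: "((\<lambda>z. (soliton z)\<^sup>2) has_real_derivative 2 * (soliton z * soliton' z)) (at z)"
      using soliton_deriv[of z] by (auto intro!: derivative_eq_intros)
    have "- sqrt \<omega> * ((1 - (tanh (\<beta> * z))\<^sup>2) * \<beta> * (soliton z)\<^sup>2 + 2 * (soliton z * soliton' z) * tanh (\<beta> * z))
       = - (sqrt \<omega> * \<beta>) * (1 - (tanh (\<beta> * z))\<^sup>2) * (soliton z)\<^sup>2 + 2 * (soliton' z)\<^sup>2"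
      by (simp add: soliton'_def power2_eq_square algebra_simps)
    also have "\<dots> = 2 * (soliton' z)\<^sup>2 - (p - 1) / 2 * \<omega> * soliton z powr (p + 1)"
      unfolding alpha_beta(5) soliton_powr_p1 by simp
    finally show "(?D has_real_derivative 2 * (soliton' z)\<^sup>2 - (p - 1) / 2 * \<omega> * soliton z powr (p + 1)) (at z)"
      using DERIV_cmult[OF DERIV_mult[OF 1 2], of "- sqrt \<omega>"] by simp
  qed (use assms in simp)
  moreover have "?D T - ?D (-T) = - (2 * sqrt \<omega> * tanh (\<beta> * T) * (soliton T)\<^sup>2)"
    by (simp add: soliton_even)
  ultimately show ?thesis by (simp only:)
qed

text \<open>\<open>sqrt \<omega> * tail T\<close> bounds the truncation errors of the kinetic energy
  and of the virial boundary term; solving the virial identity for the power integral multiplies it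
  by \<open>4 / ((p - 1) * \<omega>)\<close>.\<close>

definition "gn_k = 4 * sqrt \<omega> / ((p - 1) * \<omega>)"
definition "tail T = (2 powr \<alpha>)\<^sup>2 * exp (- (2 * sqrt \<omega> * T))"

lemma tail_nonneg: "0 \<le> tail T" by (simp add: tail_def)

lemma soliton_tail:
  assumes "0 \<le> T" "T \<le> \<bar>z\<bar>"
  shows "(soliton z)\<^sup>2 \<le> tail T"
proof -
  have "soliton z \<le> 2 powr \<alpha> * exp (- (sqrt \<omega> * \<bar>z\<bar>))" by (rule soliton_le_exp)
  also have "\<dots> \<le> 2 powr \<alpha> * exp (- (sqrt \<omega> * T))"
    using assms omega by (intro mult_left_mono) (auto intro!: mult_left_mono)
  finally have "(soliton z)\<^sup>2 \<le> (2 powr \<alpha> * exp (- (sqrt \<omega> * T)))\<^sup>2"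
    using soliton_pos[of z] by (intro power_mono) auto
  also have "\<dots> = tail T"
    by (simp add: tail_def power_mult_distrib flip: exp_double)
  finally show ?thesis .
qed

lemma soliton_continuous: "continuous_on A soliton"
  by (meson DERIV_continuous continuous_at_imp_continuous_on soliton_deriv)

lemma soliton'_continuous: "continuous_on A soliton'"
proof -
  have "cosh (\<beta> * z) \<noteq> 0" for z using cosh_real_pos[of "\<beta> * z"] by simp
  then show ?thesis
    unfolding soliton'_def[abs_def] by (intro continuous_intros soliton_continuous) auto
qed

lemma soliton_powr_continuous: "continuous_on A (\<lambda>z. soliton z powr (p + 1))"
  using soliton_pos p_gt by (intro continuous_on_powr' soliton_continuous continuous_intros) (auto intro: less_imp_le)

text \<open>The kinetic energy is known from \<open>soliton_kinetic\<close>, the power integral from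
  the virial identity, and the mass term from the first integral, which rewrites the energy density
  as \<open>2 * (soliton' z)\<^sup>2 + \<omega> * soliton z powr (p + 1)\<close>. All errors are
  multiples of \<open>tail T\<close>.\<close>

lemma soliton_integrals:
  assumes "0 \<le> T"
  defines "k \<equiv> integral {-T..T} (\<lambda>z. soliton z powr (p + 1))"
    and "e \<equiv> integral {-T..T} (\<lambda>z. (soliton' z)\<^sup>2 + \<omega> * (soliton z)\<^sup>2)"
  shows "gn_K - gn_k * tail T \<le> k" "e \<le> (p + 1) / 2 * \<omega> * gn_K + \<omega> * gn_k * tail T"
proof -
  define a where "a = integral {-T..T} (\<lambda>z. (soliton' z)\<^sup>2)"
  note ic = integrable_continuous_real
  have i1: "(\<lambda>z. (soliton' z)\<^sup>2) integrable_on {-T..T}"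
    by (intro ic continuous_intros soliton'_continuous)
  have i2: "(\<lambda>z. soliton z powr (p + 1)) integrable_on {-T..T}"
    by (intro ic soliton_powr_continuous)
  have s0: "0 \<le> (soliton T)\<^sup>2" by simp
  have sT: "(soliton T)\<^sup>2 \<le> tail T" using assms by (intro soliton_tail) auto
  have a: "a = 2 * gn_a - 2 * gn_prim ((soliton T)\<^sup>2)"
    unfolding a_def by (rule integral_unique[OF soliton_kinetic[OF assms(1)]])
  have a_le: "a \<le> 2 * gn_a" using gn_prim_bounds(1)[OF s0 soliton_sq_le_1] a by simp
  have a_ge: "2 * gn_a - sqrt \<omega> * tail T \<le> a"
  proof -
    have "sqrt \<omega> * (soliton T)\<^sup>2 \<le> sqrt \<omega> * tail T" using omega by (intro mult_left_mono sT) simp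
    then show ?thesis using gn_prim_bounds(2)[OF s0 soliton_sq_le_1] a by linarith
  qed
  define t where "t = sqrt \<omega> * tanh (\<beta> * T) * (soliton T)\<^sup>2"
  have t0: "0 \<le> t" using assms(1) alpha_beta omega by (simp add: t_def)
  have t1: "t \<le> sqrt \<omega> * tail T"
  proof -
    have "tanh (\<beta> * T) * (soliton T)\<^sup>2 \<le> 1 * tail T"
      using sT tanh_real_lt_1[of "\<beta> * T"] by (intro mult_mono) auto
    then show ?thesis unfolding t_def mult.assoc using omega by (intro mult_left_mono) auto
  qed
  have vir: "2 * a - (p - 1) / 2 * \<omega> * k = - (2 * t)"
  proof -
    have "integral {-T..T} (\<lambda>z. 2 * (soliton' z)\<^sup>2 - (p - 1) / 2 * \<omega> * soliton z powr (p + 1)) = - (2 * t)"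
      using integral_unique[OF soliton_virial[OF assms(1)]] by (simp add: t_def mult.assoc)
    moreover have "integral {-T..T} (\<lambda>z. 2 * (soliton' z)\<^sup>2 - (p - 1) / 2 * \<omega> * soliton z powr (p + 1))
      = integral {-T..T} (\<lambda>z. 2 * (soliton' z)\<^sup>2) - integral {-T..T} (\<lambda>z. (p - 1) / 2 * \<omega> * soliton z powr (p + 1))"
      by (intro Henstock_Kurzweil_Integration.integral_diff integrable_on_cmult_left[of _ _ _, simplified] ic continuous_intros soliton'_continuous soliton_powr_continuous)
    moreover have "\<dots> = 2 * a - (p - 1) / 2 * \<omega> * k"
      unfolding a_def k_def by (simp only: Henstock_Kurzweil_Integration.integral_mult_right)
    ultimately show ?thesis by simp
  qed
  have d: "0 < (p - 1) * \<omega>" using p_gt omega by simp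
  have "(p - 1) * \<omega> * k = 4 * a + 4 * t" using vir by (simp add: field_simps)
  then have k: "k = (4 * a + 4 * t) / ((p - 1) * \<omega>)"
    using d by (metis nonzero_mult_div_cancel_left less_irrefl)
  have K: "gn_K - gn_k * tail T = (8 * gn_a - 4 * (sqrt \<omega> * tail T)) / ((p - 1) * \<omega>)"
    "gn_K + gn_k * tail T = (8 * gn_a + 4 * (sqrt \<omega> * tail T)) / ((p - 1) * \<omega>)"
    unfolding gn_K_def gn_k_def by (simp_all add: diff_divide_distrib add_divide_distrib)
  show "gn_K - gn_k * tail T \<le> k"
    unfolding K k using d a_ge t0 by (intro divide_right_mono) auto
  have k_le: "k \<le> gn_K + gn_k * tail T"
    unfolding K k using d a_le t1 by (intro divide_right_mono) auto
  have "e = integral {-T..T} (\<lambda>z. 2 * (soliton' z)\<^sup>2 + \<omega> * soliton z powr (p + 1))"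
    unfolding e_def by (rule Henstock_Kurzweil_Integration.integral_cong) (simp add: soliton'_sq)
  also have "\<dots> = 2 * a + \<omega> * k"
    unfolding a_def k_def
    by (subst Henstock_Kurzweil_Integration.integral_add)
      (auto intro!: ic continuous_intros soliton'_continuous soliton_powr_continuous)
  also have "\<dots> \<le> 2 * (2 * gn_a) + \<omega> * (gn_K + gn_k * tail T)"
    using a_le k_le omega by (intro add_mono mult_left_mono) auto
  also have "2 * (2 * gn_a) = (p - 1) / 2 * \<omega> * gn_K"
  proof -
    have "(p - 1) * \<omega> * gn_K = 8 * gn_a"
      unfolding gn_K_def times_divide_eq_right using d by (intro nonzero_mult_div_cancel_left) auto
    then show ?thesis by simp
  qed
  also have "(p - 1) / 2 * \<omega> * gn_K + \<omega> * (gn_K + gn_k * tail T) = (p + 1) / 2 * \<omega> * gn_K + \<omega> * gn_k * tail T"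
    by (simp add: field_simps)
  finally show "e \<le> (p + 1) / 2 * \<omega> * gn_K + \<omega> * gn_k * tail T" .
qed

section \<open>The truncated soliton as a trial function\<close>

lemma smooth_fun_soliton: "smooth_fun (\<lambda>x. of_real (soliton (x - y)))"
proof -
  have "smooth_fun (\<lambda>x. of_real (poly 1 (tanh (\<beta> * x + - (\<beta> * y))) * cosh (\<beta> * x + - (\<beta> * y)) powr (- \<alpha>)))"
    by (rule smooth_fun_affine[OF smooth_fun_tanh_cosh])
  then show ?thesis by (simp add: soliton_def algebra_simps)
qed

lemma integral_soliton_shift:
  assumes "continuous_on {-T..T} (f :: real \<Rightarrow> real)"
  shows "integral {y - T..y + T} (\<lambda>x. f (x - y)) = integral {-T..T} f"
  using integral_shift[of "y - T" "- y" "y + T" f] assms by (simp add: o_def)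

text \<open>The potential gain is read off only on the unit neighbourhood of the centre, where the
  soliton is at least \<open>soliton 1\<close> and \<open>x \<le> T + 3\<close>; the truncation
  changes the soliton only where its square is at most \<open>tail T\<close>.\<close>

lemma trial_family:
  obtains C1 where "\<And>T. 1 \<le> T \<Longrightarrow> \<exists>\<psi>\<in>test_funs.
     Q \<psi> \<le> (p + 1) / 2 * \<omega> * gn_K + C1 * tail T - c * (2 * ((soliton 1)\<^sup>2 / (T + 3)\<^sup>2)) \<and>
     gn_K - gn_k * tail T \<le> P \<psi>"
proof -
  obtain \<eta> \<eta>' :: "real \<Rightarrow> real" and K where sm: "smooth_fun (\<lambda>t. of_real (\<eta> t))"
    and der: "\<And>t. (\<eta> has_real_derivative \<eta>' t) (at t)"
    and e0: "\<And>t. t \<le> 0 \<Longrightarrow> \<eta> t = 0" and e1: "\<And>t. t \<ge> 1 \<Longrightarrow> \<eta> t = 1"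
    and eb: "\<And>t. 0 \<le> \<eta> t" "\<And>t. \<eta> t \<le> 1" and K: "\<And>t. \<bar>\<eta>' t\<bar> \<le> K" "0 \<le> K"
    by (rule smooth_plateau) blast
  \<comment> \<open>The plateau function attains its maximum \<open>1\<close> at each such point,
    including the end point \<open>t = 1\<close>.\<close>
  have e1': "\<eta>' t = 0" if "t \<ge> 1" for t
    by (rule DERIV_local_max[OF der zero_less_one]) (use e1[OF that] eb in auto)
  \<comment> \<open>\<open>K1 * soliton\<close> bounds the derivative of the truncated soliton:
    \<open>2 * K\<close> comes from the two cut-off factors and \<open>sqrt \<omega>\<close> from
    \<open>soliton'\<close>.\<close>
  define K1 where "K1 = 2 * K + sqrt \<omega>"
  have K1: "0 \<le> K1" using K omega by (simp add: K1_def)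
  \<comment> \<open>The first summand is the error of the soliton integrals on
    \<open>[-T, T]\<close>; the second collects the two transition intervals, each of length
    \<open>1\<close>.\<close>
  define C1 where "C1 = \<omega> * gn_k + 2 * (K1\<^sup>2 + \<omega>)"
  have "\<exists>\<psi>\<in>test_funs.
     Q \<psi> \<le> (p + 1) / 2 * \<omega> * gn_K + C1 * tail T - c * (2 * ((soliton 1)\<^sup>2 / (T + 3)\<^sup>2)) \<and>
     gn_K - gn_k * tail T \<le> P \<psi>" if T: "1 \<le> T" for T
  proof -
    \<comment> \<open>The centre \<open>T + 2\<close> makes \<open>[y - T, y + T]\<close> the
      interval \<open>[2, 2 * T + 2]\<close> on which \<open>X\<close> is \<open>1\<close>;
      \<open>X\<close> rises on \<open>[1, 2]\<close> and falls on
      \<open>[2 * T + 2, 2 * T + 3]\<close>, so the support stays away from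
      \<open>0\<close>.\<close>
    define y where "y = T + 2"
    define X where "X x = \<eta> (x - 1) * \<eta> (2 * T + 3 - x)" for x
    define X' where "X' x = \<eta>' (x - 1) * \<eta> (2 * T + 3 - x) - \<eta> (x - 1) * \<eta>' (2 * T + 3 - x)" for x
    define W where "W x = X x * soliton (x - y)" for x
    define W' where "W' x = X' x * soliton (x - y) + X x * soliton' (x - y)" for x
    define \<psi> where "\<psi> x = complex_of_real (W x)" for x
    have "smooth_fun (\<lambda>x. of_real (\<eta> (1 * x + - 1)) * of_real (\<eta> ((- 1) * x + (2 * T + 3))) * of_real (soliton (x - y)))"
      by (intro smooth_fun_mult smooth_fun_soliton smooth_fun_affine[OF sm])
    then have sm\<psi>: "smooth_fun \<psi>"
      by (simp add: \<psi>_def[abs_def] W_def X_def algebra_simps)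
    have X0: "X x = 0" if "x \<notin> {1..2 * T + 3}" for x
      using that e0[of "x - 1"] e0[of "2 * T + 3 - x"] by (auto simp: X_def)
    have \<psi>0: "\<psi> x = 0" if "x \<notin> {1..2 * T + 3}" for x
      using X0[OF that] by (simp add: \<psi>_def W_def)
    have t: "\<psi> \<in> test_funs"
      by (rule test_funsI[OF sm\<psi> zero_less_one]) (rule \<psi>0)
    have Xb: "0 \<le> X x" "X x \<le> 1" for x
      using eb by (auto simp: X_def intro: mult_le_one)
    have X'b: "\<bar>X' x\<bar> \<le> 2 * K" for x
    proof -
      have "\<bar>\<eta>' (x - 1) * \<eta> (2 * T + 3 - x)\<bar> \<le> K * 1" "\<bar>\<eta> (x - 1) * \<eta>' (2 * T + 3 - x)\<bar> \<le> 1 * K"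
        unfolding abs_mult abs_of_nonneg[OF eb(1)]
        by (rule mult_mono[OF K(1) eb(2) K(2) eb(1)], rule mult_mono[OF eb(2) K(1) zero_le_one abs_ge_zero])
      then show ?thesis unfolding X'_def by linarith
    qed
    have dW: "(W has_real_derivative W' x) (at x)" for x
    proof -
      have 1: "((\<lambda>x. \<eta> (x - 1)) has_real_derivative \<eta>' (x - 1) * 1) (at x)"
        by (rule DERIV_chain2[OF der]) (auto intro!: derivative_eq_intros)
      have 2: "((\<lambda>x. \<eta> (2 * T + 3 - x)) has_real_derivative \<eta>' (2 * T + 3 - x) * (- 1)) (at x)"
        by (rule DERIV_chain2[OF der]) (auto intro!: derivative_eq_intros)
      have 3: "((\<lambda>x. soliton (x - y)) has_real_derivative soliton' (x - y) * 1) (at x)"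
        by (rule DERIV_chain2[OF soliton_deriv]) (auto intro!: derivative_eq_intros)
      have "(W has_real_derivative (\<eta>' (x - 1) * 1 * \<eta> (2 * T + 3 - x) + \<eta>' (2 * T + 3 - x) * (- 1) * \<eta> (x - 1)) * soliton (x - y)
         + soliton' (x - y) * 1 * (\<eta> (x - 1) * \<eta> (2 * T + 3 - x))) (at x)"
        unfolding W_def[abs_def] X_def by (rule DERIV_mult[OF DERIV_mult[OF 1 2] 3])
      then show ?thesis by (simp add: W'_def X_def X'_def mult.commute algebra_simps)
    qed
    have dv\<psi>: "dv \<psi> x = of_real (W' x)" for x
      unfolding \<psi>_def[abs_def] by (intro vector_derivative_at has_vector_derivative_of_real dW)
    define F where "F x = (cmod (dv \<psi> x))\<^sup>2 + \<omega> * (cmod (\<psi> x))\<^sup>2" for x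
    have F: "F x = (W' x)\<^sup>2 + \<omega> * (W x)\<^sup>2" for x
      by (simp add: F_def dv\<psi> \<psi>_def)
    have contF: "continuous_on A F" for A
      unfolding F_def by (intro continuous_intros test_fun_continuous test_fun_dv t)
    have F0: "F x = 0" if "x \<notin> {1..2 * T + 3}" for x
      using \<psi>0[OF that] dv_eq_0_outside[OF \<psi>0 that] by (simp add: F_def)
    have plateau: "X x = 1" "X' x = 0" if "2 \<le> x" "x \<le> 2 * T + 2" for x
      using that e1[of "x - 1"] e1[of "2 * T + 3 - x"] e1'[of "x - 1"] e1'[of "2 * T + 3 - x"]
      by (auto simp: X_def X'_def)
    have side: "F x \<le> (K1\<^sup>2 + \<omega>) * tail T" if "T \<le> \<bar>x - y\<bar>" for x
    proof -
      let ?s = "soliton (x - y)"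
      have s0: "0 < ?s" by (rule soliton_pos)
      have s': "\<bar>soliton' (x - y)\<bar> \<le> sqrt \<omega> * ?s"
      proof -
        have "\<bar>soliton' (x - y)\<bar> = sqrt \<omega> * \<bar>tanh (\<beta> * (x - y))\<bar> * ?s"
          using omega s0 by (simp add: soliton'_def abs_mult)
        also have "\<dots> \<le> sqrt \<omega> * 1 * ?s"
          using omega s0 tanh_real_bounds[of "\<beta> * (x - y)"]
          by (intro mult_right_mono mult_left_mono) (auto simp: abs_le_iff)
        finally show ?thesis by simp
      qed
      have "\<bar>X' x * ?s\<bar> \<le> 2 * K * ?s" unfolding abs_mult using s0 X'b by (auto intro!: mult_mono)
      moreover have "\<bar>X x * soliton' (x - y)\<bar> \<le> 1 * (sqrt \<omega> * ?s)"
        unfolding abs_mult using Xb[of x] s' by (intro mult_mono) auto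
      ultimately have "\<bar>W' x\<bar> \<le> K1 * ?s" unfolding W'_def K1_def by (simp add: algebra_simps)
      from power_mono[OF this, of 2] have 1: "(W' x)\<^sup>2 \<le> K1\<^sup>2 * ?s\<^sup>2" by (simp add: power_mult_distrib)
      have "\<bar>W x\<bar> \<le> 1 * ?s" unfolding W_def abs_mult using Xb[of x] s0 by (intro mult_mono) auto
      from power_mono[OF this, of 2] have 2: "\<omega> * (W x)\<^sup>2 \<le> \<omega> * ?s\<^sup>2" using omega by simp
      have "F x \<le> (K1\<^sup>2 + \<omega>) * ?s\<^sup>2" unfolding F using 1 2 by (simp add: distrib_right)
      also have "\<dots> \<le> (K1\<^sup>2 + \<omega>) * tail T"
        using that T omega by (intro mult_left_mono soliton_tail) auto
      finally show ?thesis .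
    qed
    have cm: "continuous_on {-T..T} (\<lambda>z. (soliton' z)\<^sup>2 + \<omega> * (soliton z)\<^sup>2)"
      by (intro continuous_intros soliton_continuous soliton'_continuous)
    have yT: "y - T = 2" "y + T = 2 * T + 2" by (auto simp: y_def)
    have "integral\<^sup>L halfline F = integral {1..2 * T + 3} F"
      by (rule halfline_integral_Icc(2)[OF zero_less_one contF F0])
    also have "\<dots> = integral {1..2} F + integral {2..2 * T + 3} F"
      by (rule Henstock_Kurzweil_Integration.integral_combine[symmetric])
        (use T in \<open>auto intro: integrable_continuous_real contF\<close>)
    also have "integral {2..2 * T + 3} F = integral {2..2 * T + 2} F + integral {2 * T + 2..2 * T + 3} F"
      by (rule Henstock_Kurzweil_Integration.integral_combine[symmetric])
        (use T in \<open>auto intro: integrable_continuous_real contF\<close>)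
    also have "integral {2..2 * T + 2} F = integral {y - T..y + T} (\<lambda>x. (soliton' (x - y))\<^sup>2 + \<omega> * (soliton (x - y))\<^sup>2)"
      unfolding yT
    proof (rule Henstock_Kurzweil_Integration.integral_cong)
      fix x assume "x \<in> {2..2 * T + 2}"
      then have "2 \<le> x" "x \<le> 2 * T + 2" by auto
      from plateau[OF this] show "F x = (soliton' (x - y))\<^sup>2 + \<omega> * (soliton (x - y))\<^sup>2"
        by (simp add: F W_def W'_def)
    qed
    also have "\<dots> = integral {-T..T} (\<lambda>z. (soliton' z)\<^sup>2 + \<omega> * (soliton z)\<^sup>2)"
      by (rule integral_soliton_shift[OF cm])
    also have "\<dots> \<le> (p + 1) / 2 * \<omega> * gn_K + \<omega> * gn_k * tail T"
      using T by (intro soliton_integrals(2)) simp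
    also have "integral {1..2} F \<le> (2 - 1) * ((K1\<^sup>2 + \<omega>) * tail T)"
      by (intro integral_le_const contF side) (auto simp: y_def)
    also have "integral {2 * T + 2..2 * T + 3} F \<le> (2 * T + 3 - (2 * T + 2)) * ((K1\<^sup>2 + \<omega>) * tail T)"
      by (intro integral_le_const contF side) (auto simp: y_def)
    finally have Fle: "integral\<^sup>L halfline F \<le> (p + 1) / 2 * \<omega> * gn_K + C1 * tail T"
      by (simp add: C1_def algebra_simps)
    have FQ: "integral\<^sup>L halfline F = sqi (dv \<psi>) + \<omega> * sqi \<psi>"
      unfolding F_def sqi_def using test_sq_integrable[OF t] by simp
    have gain: "2 * ((soliton 1)\<^sup>2 / (T + 3)\<^sup>2) \<le> sqi (\<lambda>x. \<psi> x / of_real x)"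
    proof -
      have cont: "continuous_on {y - 1..y + 1} (\<lambda>x. (cmod (\<psi> x))\<^sup>2 / x\<^sup>2)"
        by (rule continuous_on_quotient_test[OF t]) (use T in \<open>simp add: y_def\<close>)
      have "(y + 1 - (y - 1)) * ((soliton 1)\<^sup>2 / (T + 3)\<^sup>2) \<le> integral {y - 1..y + 1} (\<lambda>x. (cmod (\<psi> x))\<^sup>2 / x\<^sup>2)"
      proof (rule integral_ge_const[OF _ cont])
        fix x assume x: "y - 1 \<le> x" "x \<le> y + 1"
        have "2 \<le> x" "x \<le> 2 * T + 2" using x T by (auto simp: y_def)
        from plateau(1)[OF this] have "cmod (\<psi> x) = soliton (x - y)"
          using soliton_pos[of "x - y"] by (simp add: \<psi>_def W_def)
        moreover have "soliton 1 \<le> soliton (x - y)"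
        proof -
          have "cosh \<bar>\<beta> * (x - y)\<bar> \<le> cosh (\<beta> * 1)"
          proof (subst cosh_real_nonneg_le_iff)
            have "\<bar>\<beta> * (x - y)\<bar> = \<beta> * \<bar>x - y\<bar>" using alpha_beta by (simp add: abs_mult)
            also have "\<dots> \<le> \<beta> * 1" using x alpha_beta by (intro mult_left_mono) auto
            finally show "\<bar>\<beta> * (x - y)\<bar> \<le> \<beta> * 1" .
          qed (use alpha_beta in auto)
          then have "cosh (\<beta> * (x - y)) \<le> cosh (\<beta> * 1)" by (simp only: cosh_real_abs)
          then show ?thesis
            unfolding soliton_def using alpha_beta cosh_real_pos[of "\<beta> * (x - y)"] by (intro powr_mono2') auto
        qed
        ultimately have "(soliton 1)\<^sup>2 \<le> (cmod (\<psi> x))\<^sup>2"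
          using soliton_pos[of 1] by (intro power_mono) auto
        moreover have "x\<^sup>2 \<le> (T + 3)\<^sup>2" "0 < x\<^sup>2"
          using x T by (auto simp: y_def intro!: power_mono)
        ultimately show "(soliton 1)\<^sup>2 / (T + 3)\<^sup>2 \<le> (cmod (\<psi> x))\<^sup>2 / x\<^sup>2"
          by (intro frac_le) auto
      qed simp
      also have "\<dots> = (\<integral>x. indicator {y - 1..y + 1} x * ((cmod (\<psi> x))\<^sup>2 / x\<^sup>2) \<partial>halfline)"
        by (rule halfline_integral_indicator_Icc(2)[symmetric, OF _ cont]) (use T in \<open>simp add: y_def\<close>)
      also have "\<dots> \<le> (\<integral>x. (cmod (\<psi> x))\<^sup>2 / x\<^sup>2 \<partial>halfline)"
        by (rule integral_indicator_le(1)[OF test_Hardy_integrable[OF t]]) auto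
      also have "\<dots> = sqi (\<lambda>x. \<psi> x / of_real x)"
        by (simp add: sqi_def norm_divide power_divide)
      finally show ?thesis by simp
    qed
    have "Q \<psi> = integral\<^sup>L halfline F - c * sqi (\<lambda>x. \<psi> x / of_real x)"
      unfolding Q_test[OF t] FQ by simp
    also have "\<dots> \<le> (p + 1) / 2 * \<omega> * gn_K + C1 * tail T - c * (2 * ((soliton 1)\<^sup>2 / (T + 3)\<^sup>2))"
      using Fle mult_left_mono[OF gain less_imp_le[OF c_pos]] by linarith
    finally have Qle: "Q \<psi> \<le> \<dots>" .
    have cP: "continuous_on A (\<lambda>x. cmod (\<psi> x) powr (p + 1))" for A
      using p_gt by (intro test_powr_continuous t) simp
    have "gn_K - gn_k * tail T \<le> integral {-T..T} (\<lambda>z. soliton z powr (p + 1))"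
      using T by (intro soliton_integrals(1)) simp
    also have "\<dots> = integral {y - T..y + T} (\<lambda>x. soliton (x - y) powr (p + 1))"
      by (rule integral_soliton_shift[OF soliton_powr_continuous, symmetric])
    also have "\<dots> = integral {2..2 * T + 2} (\<lambda>x. cmod (\<psi> x) powr (p + 1))"
      unfolding yT
    proof (rule Henstock_Kurzweil_Integration.integral_cong)
      fix x assume "x \<in> {2..2 * T + 2}"
      then have "2 \<le> x" "x \<le> 2 * T + 2" by auto
      from plateau(1)[OF this] show "soliton (x - y) powr (p + 1) = cmod (\<psi> x) powr (p + 1)"
        using soliton_pos[of "x - y"] by (simp add: \<psi>_def W_def)
    qed
    also have "\<dots> = (\<integral>x. indicator {2..2 * T + 2} x * cmod (\<psi> x) powr (p + 1) \<partial>halfline)"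
      by (rule halfline_integral_indicator_Icc(2)[symmetric, OF _ cP]) simp
    also have "\<dots> \<le> P \<psi>"
      unfolding pint_def
      by (rule integral_indicator_le(1)[OF test_pint_integrable[OF t]]) (use p_gt in auto)
    finally have "gn_K - gn_k * tail T \<le> P \<psi>" .
    with Qle t show ?thesis by blast
  qed
  then show ?thesis by (rule that)
qed

lemma tail_tendsto: "((\<lambda>T. tail T * (T + 3)\<^sup>2) \<longlongrightarrow> 0) at_top"
proof -
  define k where "k = 2 * sqrt \<omega>"
  have k: "0 < k" using omega by (simp add: k_def)
  have "filterlim (\<lambda>T. k * T) at_top at_top"
    by (rule filterlim_tendsto_pos_mult_at_top[OF tendsto_const k filterlim_ident])
  from filterlim_compose[OF tendsto_power_div_exp_0[of 2] this]
  have 1: "((\<lambda>T. (16 * (2 powr \<alpha>)\<^sup>2 / k\<^sup>2) * ((k * T)\<^sup>2 / exp (k * T))) \<longlongrightarrow> (16 * (2 powr \<alpha>)\<^sup>2 / k\<^sup>2) * 0) at_top"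
    by (rule tendsto_mult_left)
  show ?thesis
  proof (rule Lim_null_comparison[rotated])
    show "((\<lambda>T. (16 * (2 powr \<alpha>)\<^sup>2 / k\<^sup>2) * ((k * T)\<^sup>2 / exp (k * T))) \<longlongrightarrow> 0) at_top" using 1 by simp
    show "\<forall>\<^sub>F T in at_top. norm (tail T * (T + 3)\<^sup>2) \<le> (16 * (2 powr \<alpha>)\<^sup>2 / k\<^sup>2) * ((k * T)\<^sup>2 / exp (k * T))"
      using eventually_ge_at_top[of 1]
    proof eventually_elim
      case (elim T)
      have "norm (tail T * (T + 3)\<^sup>2) = tail T * (T + 3)\<^sup>2" using tail_nonneg[of T] by simp
      also have "\<dots> \<le> tail T * (4 * T)\<^sup>2"
        using elim tail_nonneg by (intro mult_left_mono power_mono) auto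
      also have "\<dots> = (16 * (2 powr \<alpha>)\<^sup>2 / k\<^sup>2) * ((k * T)\<^sup>2 / exp (k * T))"
        using k by (simp add: tail_def k_def[symmetric] exp_minus power_mult_distrib divide_inverse)
      finally show ?case .
    qed
  qed
qed

lemma soliton_trial:
  obtains \<psi> where "\<psi> \<in> test_funs" "0 < P \<psi>" "Q \<psi> < gn_C * P \<psi> powr \<theta>"
proof -
  obtain C1 where C1: "\<And>T. 1 \<le> T \<Longrightarrow> \<exists>\<psi>\<in>test_funs.
     Q \<psi> \<le> (p + 1) / 2 * \<omega> * gn_K + C1 * tail T - c * (2 * ((soliton 1)\<^sup>2 / (T + 3)\<^sup>2)) \<and>
     gn_K - gn_k * tail T \<le> P \<psi>"
    by (rule trial_family) blast
  \<comment> \<open>The second summand accounts for the loss in \<open>P\<close>: it is the amount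
    by which \<open>(p + 1) / 2 * \<omega> * z\<close> falls short of its limit, with
    \<open>z\<close> the lower bound for \<open>P \<psi>\<close> below.\<close>
  define C2 where "C2 = C1 + (p + 1) / 2 * \<omega> * gn_k"
  have lim: "((\<lambda>T. C * (tail T * (T + 3)\<^sup>2)) \<longlongrightarrow> 0) at_top" for C
    using tendsto_mult_left[OF tail_tendsto, of C] by simp
  have pos: "0 < c * (2 * (soliton 1)\<^sup>2)" using c_pos soliton_pos[of 1] by simp
  have "\<forall>\<^sub>F T in at_top. C2 * (tail T * (T + 3)\<^sup>2) < c * (2 * (soliton 1)\<^sup>2) \<and>
     gn_k * (tail T * (T + 3)\<^sup>2) < gn_K \<and> 1 \<le> T"
    by (intro eventually_conj order_tendstoD(2)[OF lim] pos gn_K eventually_ge_at_top)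
  then obtain T where T: "C2 * (tail T * (T + 3)\<^sup>2) < c * (2 * (soliton 1)\<^sup>2)"
    "gn_k * (tail T * (T + 3)\<^sup>2) < gn_K" "1 \<le> T"
    using eventually_happens'[OF trivial_limit_at_top_linorder] by blast
  have gk: "0 \<le> gn_k" using p_gt omega by (simp add: gn_k_def)
  have T3: "1 \<le> (T + 3)\<^sup>2" using T(3) by (simp add: one_le_power)
  obtain \<psi> where \<psi>: "\<psi> \<in> test_funs"
    "Q \<psi> \<le> (p + 1) / 2 * \<omega> * gn_K + C1 * tail T - c * (2 * ((soliton 1)\<^sup>2 / (T + 3)\<^sup>2))"
    "gn_K - gn_k * tail T \<le> P \<psi>"
    using C1[OF T(3)] by blast
  have "tail T * 1 \<le> tail T * (T + 3)\<^sup>2" by (rule mult_left_mono[OF T3 tail_nonneg])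
  from mult_left_mono[OF this gk] have "gn_k * tail T < gn_K" using T(2) by simp
  define z where "z = gn_K - gn_k * tail T"
  have z: "0 < z" "z \<le> gn_K" "z \<le> P \<psi>"
    using \<open>gn_k * tail T < gn_K\<close> \<psi>(3) gk tail_nonneg[of T] by (auto simp: z_def)
  have "C2 * tail T < c * (2 * (soliton 1)\<^sup>2) / (T + 3)\<^sup>2"
    using T(1) T3 by (subst pos_less_divide_eq) (auto simp: mult.assoc)
  then have Q: "Q \<psi> < (p + 1) / 2 * \<omega> * z"
  proof -
    define A where "A = (p + 1) / 2 * \<omega>"
    have 1: "A * z = A * gn_K - A * gn_k * tail T" by (simp add: z_def right_diff_distrib mult.assoc)
    have 2: "C2 * tail T = C1 * tail T + A * gn_k * tail T" by (simp add: C2_def A_def distrib_right)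
    have 3: "c * (2 * ((soliton 1)\<^sup>2 / (T + 3)\<^sup>2)) = c * (2 * (soliton 1)\<^sup>2) / (T + 3)\<^sup>2" by simp
    show ?thesis
      using \<psi>(2) \<open>C2 * tail T < _\<close> unfolding A_def[symmetric] 1 2 3 by linarith
  qed
  have "(p + 1) / 2 * \<omega> * z = gn_C * gn_K powr \<theta> * (z / gn_K)"
  proof -
    have "gn_K powr (1 - \<theta>) * gn_K powr \<theta> = gn_K" using gn_K by (simp flip: powr_add)
    then have eq: "gn_C * gn_K powr \<theta> = (p + 1) / 2 * \<omega> * gn_K" by (simp add: gn_C_def)
    show ?thesis unfolding eq using gn_K by simp
  qed
  \<comment> \<open>Truncation costs at most some of \<open>P\<close>, so
    \<open>z \<le> gn_K\<close>, and a ratio in \<open>(0, 1]\<close> is raised by the exponent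
    \<open>\<theta> < 1\<close>.\<close>
  also have "\<dots> \<le> gn_C * gn_K powr \<theta> * (z / gn_K) powr \<theta>"
  proof -
    have "(z / gn_K) powr 1 \<le> (z / gn_K) powr \<theta>"
      using z gn_K theta by (intro powr_mono') auto
    then show ?thesis using z gn_K gn_C by (intro mult_left_mono) auto
  qed
  also have "\<dots> = gn_C * z powr \<theta>"
    using z gn_K by (simp add: powr_divide)
  also have "\<dots> \<le> gn_C * P \<psi> powr \<theta>"
    using z gn_C theta by (intro mult_left_mono powr_mono2) auto
  finally show ?thesis using that[OF \<psi>(1)] Q z by simp
qed

end

section \<open>Existence of a minimizer\<close>

lemma cmod_combination_sq:
  "(cmod (of_real a * z + of_real b * w))\<^sup>2 = a\<^sup>2 * (cmod z)\<^sup>2 + 2 * a * b * (z \<bullet> w) + b\<^sup>2 * (cmod w)\<^sup>2"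
  unfolding power2_norm_eq_inner scaleR_conv_of_real[symmetric]
  by (simp add: inner_add_left inner_add_right inner_commute power2_eq_square algebra_simps)

text \<open>The pair \<open>sech\<close>, \<open>tanh\<close> has squares summing to one and
  derivatives that are polynomials in the pair itself. Compact support is not an issue, since these
  functions only multiply test functions.\<close>

definition cut_in :: "real \<Rightarrow> real \<Rightarrow> real" where "cut_in R x = 1 / cosh (x / R)"

definition cut_out :: "real \<Rightarrow> real \<Rightarrow> real" where "cut_out R x = tanh (x / R)"

lemma cut_smooth: "smooth_fun (\<lambda>x. of_real (cut_in R x))" "smooth_fun (\<lambda>x. of_real (cut_out R x))"
proof -
  have c: "cosh t > 0" for t :: real by (rule cosh_real_pos)
  have "smooth_fun (\<lambda>x. of_real (poly 1 (tanh ((1 / R) * x + 0)) * cosh ((1 / R) * x + 0) powr (- 1)))"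
    by (rule smooth_fun_affine[OF smooth_fun_tanh_cosh])
  then show "smooth_fun (\<lambda>x. of_real (cut_in R x))"
    using c by (simp add: cut_in_def[abs_def] powr_minus_divide less_imp_le)
  have "smooth_fun (\<lambda>x. of_real (poly [:0, 1:] (tanh ((1 / R) * x + 0)) * cosh ((1 / R) * x + 0) powr (- 0)))"
    by (rule smooth_fun_affine[OF smooth_fun_tanh_cosh])
  then show "smooth_fun (\<lambda>x. of_real (cut_out R x))"
    using c by (simp add: cut_out_def[abs_def] less_imp_neq[THEN not_sym])
qed

lemma cut_sq: "(cut_in R x)\<^sup>2 + (cut_out R x)\<^sup>2 = 1"
proof -
  have c: "cosh (x / R) > 0" by (rule cosh_real_pos)
  have s: "(sinh (x / R))\<^sup>2 = (cosh (x / R))\<^sup>2 - 1" using cosh_square_eq[of "x / R"] by simp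
  show ?thesis
    unfolding cut_in_def cut_out_def tanh_def power_divide s using c
    by (simp add: diff_divide_distrib)
qed

definition "cut_in' R x = - (cut_in R x * cut_out R x) / R"

definition "cut_out' R x = (cut_in R x)\<^sup>2 / R"

lemma cut_deriv:
  assumes "0 < R"
  shows "(cut_in R has_real_derivative cut_in' R x) (at x)" "(cut_out R has_real_derivative cut_out' R x) (at x)"
proof -
  have c: "cosh (x / R) \<noteq> 0" using cosh_real_pos[of "x / R"] by simp
  have d: "((\<lambda>x. x / R) has_real_derivative 1 / R) (at x)"
    by (rule DERIV_cdivide[OF DERIV_ident])
  have "((\<lambda>x. cosh (x / R)) has_real_derivative sinh (x / R) * (1 / R)) (at x)"
    by (rule DERIV_chain2[OF _ d]) (auto intro!: derivative_eq_intros)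
  from DERIV_inverse_fun[OF this c]
  have "((\<lambda>x. inverse (cosh (x / R))) has_real_derivative - (sinh (x / R) * (1 / R) * inverse ((cosh (x / R))\<^sup>2))) (at x)"
    by (simp add: numeral_2_eq_2)
  then show "(cut_in R has_real_derivative cut_in' R x) (at x)"
    by (simp add: cut_in_def[abs_def] cut_in'_def cut_in_def cut_out_def tanh_def inverse_eq_divide power2_eq_square mult_ac)
  have "((\<lambda>x. tanh (x / R)) has_real_derivative (1 - (tanh (x / R))\<^sup>2) * (1 / R)) (at x)"
    by (rule DERIV_chain2[OF _ d]) (use c in \<open>auto intro!: derivative_eq_intros\<close>)
  moreover have "1 - (tanh (x / R))\<^sup>2 = (cut_in R x)\<^sup>2" using cut_sq[of R x] by (simp add: cut_out_def)
  ultimately show "(cut_out R has_real_derivative cut_out' R x) (at x)"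
    by (simp add: cut_out_def[abs_def] cut_out'_def)
qed

lemma dv_real_mult:
  assumes "(f has_real_derivative f') (at x)" "\<phi> \<in> test_funs"
  shows "dv (\<lambda>x. of_real (f x) * \<phi> x) x = of_real (f x) * dv \<phi> x + of_real f' * \<phi> x"
  by (intro vector_derivative_at has_vector_derivative_mult has_vector_derivative_of_real test_fun_deriv assms)

lemma integral_split_at:
  fixes F :: "real \<Rightarrow> real"
  assumes F: "integrable halfline F" "\<And>x. 0 \<le> F x" and R: "0 \<le> R"
  shows "integral\<^sup>L halfline F = (\<integral>x. indicator {0..R} x * F x \<partial>halfline) + (\<integral>x. indicator {R..} x * F x \<partial>halfline)"
proof -
  have i: "integrable halfline (\<lambda>x. indicator {0..R} x * F x)" "integrable halfline (\<lambda>x. indicator {R..} x * F x)"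
    by (rule integral_indicator_le(2)[OF F], simp)+
  have "AE x in lebesgue. x \<noteq> R"
    using AE_not_in[of "{R}" lebesgue] by (simp add: negligible_iff_null_sets[symmetric])
  then have "AE x in halfline. x \<noteq> R" by (auto simp: AE_restrict_space_iff elim: eventually_mono)
  then have "AE x in halfline. F x = indicator {0..R} x * F x + indicator {R..} x * F x"
    using AE_space
  proof eventually_elim
    case (elim x)
    then show ?case by (auto simp: indicator_def space_restrict_space)
  qed
  then have "integral\<^sup>L halfline F = (\<integral>x. indicator {0..R} x * F x + indicator {R..} x * F x \<partial>halfline)"
    using F i by (intro integral_cong_AE) auto
  also have "\<dots> = (\<integral>x. indicator {0..R} x * F x \<partial>halfline) + (\<integral>x. indicator {R..} x * F x \<partial>halfline)"
    by (rule Bochner_Integration.integral_add[OF i])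
  finally show ?thesis .
qed

text \<open>Serves to find arbitrarily large radii at which a limit function that vanishes almost
  everywhere is actually zero.\<close>

lemma AE_halfline_obtains_gt:
  assumes "AE x in halfline. P' x" "0 \<le> (m::real)"
  obtains x where "m < x" "P' x"
proof -
  have "\<exists>x>m. P' x"
  proof (rule ccontr)
    assume "\<not> (\<exists>x>m. P' x)"
    then have n: "\<not> P' x" if "m < x" for x using that by blast
    have "AE x in lebesgue. x \<in> {0<..} \<longrightarrow> P' x" using assms(1) by (simp add: AE_restrict_space_iff)
    then have "AE x in lebesgue. x \<notin> {m<..<m + 1}"
      by eventually_elim (use n assms(2) in auto)
    then have "{m<..<m + 1} \<in> null_sets lebesgue"
      using AE_iff_null_sets[of "{m<..<m + 1}" lebesgue] by simp
    then have "emeasure lebesgue {m<..<m + 1} = 0" by (rule null_setsD1)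
    then show False by simp
  qed
  then show ?thesis using that by blast
qed

context hardy_nls
begin

text \<open>Taken over test functions, for which point values, cut-offs and the one-dimensional
  inequalities are available; \<open>Iinf_le_H10\<close> extends the resulting inequality to
  \<open>H10\<close> by density.\<close>

definition "Iinf = Inf (Q ` {\<phi> \<in> test_funs. P \<phi> = 1})"

lemma normalize:
  assumes "\<psi> \<in> H10" "0 < P \<psi>"
  obtains a where "0 < a" "P (\<lambda>x. of_real a * \<psi> x) = 1" "Q (\<lambda>x. of_real a * \<psi> x) * P \<psi> powr \<theta> = Q \<psi>"
proof -
  define a where "a = P \<psi> powr (- (1 / (p + 1)))"
  have a: "0 < a" using assms by (simp add: a_def)
  have e: "- (1 / (p + 1)) * (p + 1) = - 1" using p_gt by simp
  have "a powr (p + 1) = P \<psi> powr (- 1)" unfolding a_def powr_powr e ..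
  then have 1: "P (\<lambda>x. of_real a * \<psi> x) = 1"
    using assms a by (simp add: P_scale powr_minus_divide)
  have "a\<^sup>2 = a powr 2" using a by simp
  also have "\<dots> = P \<psi> powr (- \<theta>)" unfolding a_def powr_powr by (simp add: \<theta>_def)
  finally have "a\<^sup>2 * P \<psi> powr \<theta> = 1" using assms(2) by (simp flip: powr_add)
  moreover have "Q (\<lambda>x. of_real a * \<psi> x) = a\<^sup>2 * Q \<psi>" using assms by (simp add: Q_scale)
  ultimately have "Q (\<lambda>x. of_real a * \<psi> x) * P \<psi> powr \<theta> = Q \<psi>" by (simp add: mult_ac)
  with a 1 show ?thesis by (rule that)
qed

lemma Q_test_nonneg: "\<phi> \<in> test_funs \<Longrightarrow> 0 \<le> Q \<phi>"
  using Q_nonneg test_fun_H10(1) by blast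

lemma Iinf_bdd: "bdd_below (Q ` {\<phi> \<in> test_funs. P \<phi> = 1})"
  by (rule bdd_belowI2[of _ 0]) (simp add: Q_test_nonneg)

lemma Iinf_le:
  assumes "\<phi> \<in> test_funs"
  shows "Iinf * P \<phi> powr \<theta> \<le> Q \<phi>"
proof (cases "P \<phi> = 0")
  case True
  then show ?thesis using Q_test_nonneg[OF assms] by simp
next
  case False
  then have pos: "0 < P \<phi>" using pint_nonneg[of "p + 1" \<phi>] unfolding less_le by simp
  obtain a where a: "P (\<lambda>x. of_real a * \<phi> x) = 1" "Q (\<lambda>x. of_real a * \<phi> x) * P \<phi> powr \<theta> = Q \<phi>"
    using normalize[OF test_fun_H10(1)[OF assms] pos] by metis
  have "Iinf \<le> Q (\<lambda>x. of_real a * \<phi> x)"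
    unfolding Iinf_def by (rule cInf_lower[OF imageI Iinf_bdd]) (use a test_fun_scale[OF assms] in auto)
  then show ?thesis unfolding a(2)[symmetric] by (rule mult_right_mono) simp
qed

lemma Iinf_nonempty: "{\<phi> \<in> test_funs. P \<phi> = 1} \<noteq> {}" and Iinf_less: "Iinf < gn_C"
proof -
  obtain \<psi> where \<psi>: "\<psi> \<in> test_funs" "0 < P \<psi>" "Q \<psi> < gn_C * P \<psi> powr \<theta>"
    by (rule soliton_trial)
  obtain a where "P (\<lambda>x. of_real a * \<psi> x) = 1"
    using normalize[OF test_fun_H10(1)[OF \<psi>(1)] \<psi>(2)] by metis
  then show "{\<phi> \<in> test_funs. P \<phi> = 1} \<noteq> {}" using test_fun_scale[OF \<psi>(1)] by auto
  have "Iinf * P \<psi> powr \<theta> < gn_C * P \<psi> powr \<theta>" using Iinf_le[OF \<psi>(1)] \<psi>(3) by linarith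
  then show "Iinf < gn_C" using \<psi>(2) by simp
qed

lemma Iinf_pos: "0 < Iinf"
proof -
  have "\<kappa> \<le> Iinf"
    unfolding Iinf_def
  proof (rule cINF_greatest[OF Iinf_nonempty])
    fix \<phi> assume "\<phi> \<in> {\<phi> \<in> test_funs. P \<phi> = 1}"
    then have \<phi>: "\<phi> \<in> test_funs" "P \<phi> = 1" by auto
    have "1 \<le> sqi \<phi> + sqi (dv \<phi>)" using test_Sobolev[OF \<phi>(1)] \<phi>(2) by simp
    then have "\<kappa> * 1 \<le> \<kappa> * (sqi \<phi> + sqi (dv \<phi>))"
      using kappa(1) by (intro mult_left_mono) auto
    then show "\<kappa> \<le> Q \<phi>" using Q_test_coercive[OF \<phi>(1)] by linarith
  qed
  then show ?thesis using kappa(1) by simp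
qed

section \<open>Minimizing sequences, localization and tails\<close>

lemma minimizing_sequence:
  obtains \<phi> where "\<And>n. \<phi> n \<in> test_funs" "\<And>n. P (\<phi> n) = 1" "\<And>n. Q (\<phi> n) \<le> Iinf + 1" "(\<lambda>n. Q (\<phi> n)) \<longlonglongrightarrow> Iinf"
proof -
  have "\<exists>\<phi>\<in>{\<phi> \<in> test_funs. P \<phi> = 1}. Q \<phi> < Iinf + inverse (real (Suc n))" for n
    using cInf_lessD[of "Q ` {\<phi> \<in> test_funs. P \<phi> = 1}" "Iinf + inverse (real (Suc n))"] Iinf_nonempty
    by (auto simp: Iinf_def[symmetric])
  then obtain \<phi> where \<phi>: "\<And>n. \<phi> n \<in> {\<phi> \<in> test_funs. P \<phi> = 1}" "\<And>n. Q (\<phi> n) < Iinf + inverse (real (Suc n))"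
    by metis
  have lb: "Iinf \<le> Q (\<phi> n)" for n using Iinf_le[of "\<phi> n"] \<phi>(1)[of n] by simp
  have "(\<lambda>n. Q (\<phi> n)) \<longlonglongrightarrow> Iinf"
  proof (rule tendsto_sandwich[OF _ _ tendsto_const])
    show "(\<lambda>n. Iinf + inverse (real (Suc n))) \<longlonglongrightarrow> Iinf"
      using tendsto_add[OF tendsto_const[of Iinf] LIMSEQ_inverse_real_of_nat] by simp
  qed (use lb \<phi>(2) in \<open>auto intro!: always_eventually less_imp_le\<close>)
  moreover have "Q (\<phi> n) \<le> Iinf + 1" for n
  proof -
    have "inverse (real (Suc n)) \<le> 1" by (simp add: inverse_le_1_iff)
    then show ?thesis using \<phi>(2)[of n] by linarith
  qed
  ultimately show ?thesis using that[of \<phi>] \<phi>(1) by blast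
qed

text \<open>A diagonal choice gives convergence at rational points, and the uniform Hoelder estimate
  carries it to every real point.\<close>

lemma pointwise_subsequence:
  assumes t: "\<And>n. \<phi> n \<in> test_funs" and B: "\<And>n. sqi (\<phi> n) + sqi (dv (\<phi> n)) \<le> B"
  obtains k U where "strict_mono (k :: nat \<Rightarrow> nat)" "\<And>x. (\<lambda>n. \<phi> (k n) x) \<longlonglongrightarrow> U x"
proof -
  have B0: "0 \<le> B" using B[of 0] sqi_nonneg[of "\<phi> 0"] sqi_nonneg[of "dv (\<phi> 0)"] by linarith
  have le: "cmod (\<phi> n x) \<le> sqrt B" for n x
    using order_trans[OF test_sup_le[OF t] B] by (rule real_le_rsqrt)
  obtain k where k: "strict_mono (k :: nat \<Rightarrow> nat)" "\<And>x. x \<in> \<rat> \<Longrightarrow> \<exists>l. (\<lambda>n. \<phi> (k n) x) \<longlonglongrightarrow> l"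
    by (rule function_convergent_subsequence[of "\<rat> :: real set" \<phi> "sqrt B"]) (use le countable_rat in auto)
  have conv: "convergent (\<lambda>n. \<phi> (k n) x)" for x
  proof (cases "x \<le> 0")
    case True
    then have "(\<lambda>n. \<phi> (k n) x) = (\<lambda>n. 0)" using test_fun_nonpos[OF t] by blast
    then show ?thesis by (simp add: convergent_const)
  next
    case False
    show ?thesis
    proof (rule Cauchy_convergent, rule metric_CauchyI)
      fix e :: real assume e: "0 < e"
      \<comment> \<open>Chosen so that \<open>sqrt d * (B + 1) = e / 3\<close>, the Hoelder bound
        over a distance \<open>d\<close>.\<close>
      define d where "d = (e / (3 * (B + 1)))\<^sup>2"
      have d: "0 < d" using e B0 by (simp add: d_def)
      obtain r where r: "r \<in> \<rat>" "x < r" "r < x + d"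
        using Rats_dense_in_real[of x "x + d"] d by auto
      have near: "cmod (\<phi> n r - \<phi> n x) < e / 3" for n
      proof -
        have "cmod (\<phi> n r - \<phi> n x) \<le> sqrt (r - x) * (sqi (dv (\<phi> n)) + 1)"
          using False r by (intro test_Hoelder t) auto
        also have "\<dots> \<le> sqrt (r - x) * (B + 1)"
        proof -
          have "sqi (dv (\<phi> n)) \<le> B" using B[of n] sqi_nonneg[of "\<phi> n"] by linarith
          then show ?thesis using r by (intro mult_left_mono) auto
        qed
        also have "\<dots> < sqrt d * (B + 1)"
          using r B0 by (intro mult_strict_right_mono) auto
        also have "sqrt d = e / (3 * (B + 1))" using e B0 by (simp add: d_def)
        also have "e / (3 * (B + 1)) * (B + 1) = e / 3" using B0 by (simp add: field_simps)
        finally show ?thesis .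
      qed
      obtain l where "(\<lambda>n. \<phi> (k n) r) \<longlonglongrightarrow> l" using k(2)[OF r(1)] by blast
      then have "Cauchy (\<lambda>n. \<phi> (k n) r)" by (rule LIMSEQ_imp_Cauchy)
      then obtain N where N: "\<And>m n. m \<ge> N \<Longrightarrow> n \<ge> N \<Longrightarrow> dist (\<phi> (k m) r) (\<phi> (k n) r) < e / 3"
        using metric_CauchyD[of _ "e / 3"] e by (metis divide_pos_pos zero_less_numeral)
      have "dist (\<phi> (k m) x) (\<phi> (k n) x) < e" if "m \<ge> N" "n \<ge> N" for m n
      proof -
        have "dist (\<phi> (k m) x) (\<phi> (k n) x) \<le> dist (\<phi> (k m) x) (\<phi> (k m) r) + dist (\<phi> (k m) r) (\<phi> (k n) r) + dist (\<phi> (k n) r) (\<phi> (k n) x)"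
          using dist_triangle[of "\<phi> (k m) x" "\<phi> (k n) x" "\<phi> (k m) r"] dist_triangle[of "\<phi> (k m) r" "\<phi> (k n) x" "\<phi> (k n) r"] by linarith
        also have "\<dots> < e / 3 + e / 3 + e / 3"
          using near[of "k m"] near[of "k n"] N[OF that] by (simp add: dist_norm norm_minus_commute)
        finally show ?thesis by simp
      qed
      then show "\<exists>M. \<forall>m\<ge>M. \<forall>n\<ge>M. dist (\<phi> (k m) x) (\<phi> (k n) x) < e" by blast
    qed
  qed
  show ?thesis
    by (rule that[OF k(1), of "\<lambda>x. lim (\<lambda>n. \<phi> (k n) x)"]) (use conv in \<open>simp add: convergent_LIMSEQ_iff\<close>)
qed

text \<open>The IMS localization formula: since \<open>sech\<^sup>2 + tanh\<^sup>2 = 1\<close>, the cross terms cancel.\<close>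

lemma Q_localization:
  assumes \<phi>: "\<phi> \<in> test_funs" and R: "0 < R"
  shows "Q (\<lambda>x. of_real (cut_in R x) * \<phi> x) + Q (\<lambda>x. of_real (cut_out R x) * \<phi> x) \<le> Q \<phi> + sqi \<phi> / R\<^sup>2"
proof -
  let ?f = "\<lambda>x. of_real (cut_in R x) * \<phi> x" and ?g = "\<lambda>x. of_real (cut_out R x) * \<phi> x"
  have t: "?f \<in> test_funs" "?g \<in> test_funs" by (intro test_fun_mult cut_smooth \<phi>)+
  have sq1: "(cmod (?f x))\<^sup>2 + (cmod (?g x))\<^sup>2 = (cmod (\<phi> x))\<^sup>2" for x
  proof -
    have "(cmod (?f x))\<^sup>2 + (cmod (?g x))\<^sup>2 = ((cut_in R x)\<^sup>2 + (cut_out R x)\<^sup>2) * (cmod (\<phi> x))\<^sup>2"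
      by (simp add: norm_mult power_mult_distrib distrib_right)
    then show ?thesis by (simp add: cut_sq)
  qed
  have 1: "sqi ?f + sqi ?g = sqi \<phi>"
  proof -
    have "sqi ?f + sqi ?g = (\<integral>x. (cmod (?f x))\<^sup>2 + (cmod (?g x))\<^sup>2 \<partial>halfline)"
      unfolding sqi_def by (rule Bochner_Integration.integral_add[symmetric]) (intro test_sq_integrable t)+
    then show ?thesis by (simp only: sq1 sqi_def)
  qed
  have 2: "sqi (\<lambda>x. ?f x / of_real x) + sqi (\<lambda>x. ?g x / of_real x) = sqi (\<lambda>x. \<phi> x / of_real x)"
  proof -
    have "sqi (\<lambda>x. ?f x / of_real x) + sqi (\<lambda>x. ?g x / of_real x)
       = (\<integral>x. (cmod (?f x / of_real x))\<^sup>2 + (cmod (?g x / of_real x))\<^sup>2 \<partial>halfline)"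
      unfolding sqi_def by (rule Bochner_Integration.integral_add[symmetric]) (intro L2_D(2) test_Hardy_L2 t)+
    also have "\<dots> = (\<integral>x. (cmod (\<phi> x / of_real x))\<^sup>2 \<partial>halfline)"
      by (simp only: norm_divide power_divide add_divide_distrib[symmetric] sq1)
    finally show ?thesis by (simp only: sqi_def)
  qed
  have 3: "sqi (dv ?f) + sqi (dv ?g) \<le> sqi (dv \<phi>) + sqi \<phi> / R\<^sup>2"
  proof -
    have sq2: "(cmod (dv ?f x))\<^sup>2 + (cmod (dv ?g x))\<^sup>2 \<le> (cmod (dv \<phi> x))\<^sup>2 + (cmod (\<phi> x))\<^sup>2 / R\<^sup>2" for x
    proof -
      let ?a = "cut_in R x" and ?b = "cut_out R x"
      have "(cmod (dv ?f x))\<^sup>2 + (cmod (dv ?g x))\<^sup>2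
        = (?a\<^sup>2 + ?b\<^sup>2) * (cmod (dv \<phi> x))\<^sup>2
          + 2 * (?a * cut_in' R x + ?b * cut_out' R x) * (dv \<phi> x \<bullet> \<phi> x)
          + ((cut_in' R x)\<^sup>2 + (cut_out' R x)\<^sup>2) * (cmod (\<phi> x))\<^sup>2"
        unfolding dv_real_mult[OF cut_deriv(1)[OF R] \<phi>] dv_real_mult[OF cut_deriv(2)[OF R] \<phi>] cmod_combination_sq
        by (simp add: algebra_simps)
      also have "?a * cut_in' R x + ?b * cut_out' R x = 0"
        by (simp add: cut_in'_def cut_out'_def power2_eq_square)
      also have "(cut_in' R x)\<^sup>2 + (cut_out' R x)\<^sup>2 = ?a\<^sup>2 * (?a\<^sup>2 + ?b\<^sup>2) / R\<^sup>2"
        by (simp add: cut_in'_def cut_out'_def power_divide power_mult_distrib add_divide_distrib[symmetric] algebra_simps power2_eq_square)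
      also have "\<dots> = ?a\<^sup>2 / R\<^sup>2" by (simp add: cut_sq)
      finally have "(cmod (dv ?f x))\<^sup>2 + (cmod (dv ?g x))\<^sup>2 = (cmod (dv \<phi> x))\<^sup>2 + ?a\<^sup>2 / R\<^sup>2 * (cmod (\<phi> x))\<^sup>2"
        by (simp add: cut_sq)
      moreover have "?a\<^sup>2 / R\<^sup>2 * (cmod (\<phi> x))\<^sup>2 \<le> 1 / R\<^sup>2 * (cmod (\<phi> x))\<^sup>2"
      proof (intro mult_right_mono divide_right_mono)
        show "?a\<^sup>2 \<le> 1" using cut_sq[of R x] zero_le_power2[of ?b] by linarith
      qed auto
      ultimately show ?thesis by simp
    qed
    have "sqi (dv ?f) + sqi (dv ?g) = (\<integral>x. (cmod (dv ?f x))\<^sup>2 + (cmod (dv ?g x))\<^sup>2 \<partial>halfline)"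
      unfolding sqi_def by (rule Bochner_Integration.integral_add[symmetric]) (intro test_sq_integrable t)+
    also have "\<dots> \<le> (\<integral>x. (cmod (dv \<phi> x))\<^sup>2 + (cmod (\<phi> x))\<^sup>2 / R\<^sup>2 \<partial>halfline)"
      by (intro integral_mono sq2 Bochner_Integration.integrable_add integrable_divide test_sq_integrable t \<phi>)
    also have "\<dots> = sqi (dv \<phi>) + sqi \<phi> / R\<^sup>2"
      unfolding sqi_def using test_sq_integrable[OF \<phi>] by simp
    finally show ?thesis .
  qed
  have "Q ?f + Q ?g = (sqi (dv ?f) + sqi (dv ?g)) - c * (sqi (\<lambda>x. ?f x / of_real x) + sqi (\<lambda>x. ?g x / of_real x))
     + \<omega> * (sqi ?f + sqi ?g)"
    unfolding Q_test[OF t(1)] Q_test[OF t(2)] by (simp add: algebra_simps)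
  then show ?thesis unfolding 1 2 Q_test[OF \<phi>] using 3 by linarith
qed

text \<open>On \<open>[0, R]\<close> the local Hardy inequality lets the kinetic energy absorb the
  potential, because \<open>4 * c < 1\<close>; beyond \<open>R\<close> the potential is at most
  \<open>c / R\<^sup>2\<close>. What remains is the energy without potential on
  \<open>[R, \<infinity>)\<close>, to which \<open>test_GN_tail\<close> applies.\<close>

lemma Q_tail:
  assumes \<phi>: "\<phi> \<in> test_funs" and R: "0 < R"
  shows "gn_C * (P \<phi> - (\<integral>x. indicator {0..R} x * cmod (\<phi> x) powr (p + 1) \<partial>halfline)) powr \<theta>
    \<le> Q \<phi> + c / R\<^sup>2 * sqi \<phi> + sqrt \<omega> * (cmod (\<phi> R))\<^sup>2"
proof -
  let ?k = "\<lambda>x. (cmod (dv \<phi> x))\<^sup>2" and ?n = "\<lambda>x. (cmod (\<phi> x))\<^sup>2" and ?h = "\<lambda>x. (cmod (\<phi> x))\<^sup>2 / x\<^sup>2"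
  let ?I = "\<lambda>A F. \<integral>x. indicator A x * F x \<partial>halfline"
  note i = test_sq_integrable[OF \<phi>] test_Hardy_integrable[OF \<phi>]
  have hq: "sqi (\<lambda>x. \<phi> x / of_real x) = integral\<^sup>L halfline ?h" by (simp add: sqi_def norm_divide power_divide)
  have k: "sqi (dv \<phi>) = ?I {0..R} ?k + ?I {R..} ?k"
    unfolding sqi_def by (rule integral_split_at) (use i R in auto)
  have n: "sqi \<phi> = ?I {0..R} ?n + ?I {R..} ?n"
    unfolding sqi_def by (rule integral_split_at) (use i R in auto)
  have h: "sqi (\<lambda>x. \<phi> x / of_real x) = ?I {0..R} ?h + ?I {R..} ?h"
    unfolding hq by (rule integral_split_at) (use i R in auto)
  have P: "P \<phi> = ?I {0..R} (\<lambda>x. cmod (\<phi> x) powr (p + 1)) + ?I {R..} (\<lambda>x. cmod (\<phi> x) powr (p + 1))"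
    unfolding pint_def by (rule integral_split_at) (use test_pint_integrable[OF \<phi>] p_gt R in auto)
  have in_R: "integrable halfline (\<lambda>x. indicator {R..} x * ?n x)" and ik_R: "integrable halfline (\<lambda>x. indicator {R..} x * ?k x)"
    and ih_R: "integrable halfline (\<lambda>x. indicator {R..} x * ?h x)"
    by (rule integral_indicator_le(2)[OF i(1)] integral_indicator_le(2)[OF i(2)] integral_indicator_le(2)[OF i(3)]; simp)+
  have k0: "0 \<le> ?I {0..R} ?k" by (intro integral_nonneg_AE) auto
  have n0: "0 \<le> ?I {0..R} ?n" by (intro integral_nonneg_AE) auto
  have "c * ?I {0..R} ?h \<le> c * (4 * ?I {0..R} ?k)"
    by (rule mult_left_mono[OF test_Hardy[OF \<phi> R]]) (use c_pos in simp)
  also have "\<dots> \<le> 1 * ?I {0..R} ?k"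
    using mult_right_mono[OF less_imp_le[OF c_less] k0] by simp
  finally have a: "c * ?I {0..R} ?h \<le> ?I {0..R} ?k" by simp
  have "?I {R..} ?h \<le> (\<integral>x. 1 / R\<^sup>2 * (indicator {R..} x * ?n x) \<partial>halfline)"
  proof (rule integral_mono[OF ih_R integrable_mult_right[OF in_R]])
    fix x
    show "indicator {R..} x * ?h x \<le> 1 / R\<^sup>2 * (indicator {R..} x * ?n x)"
    proof (cases "R \<le> x")
      case True
      then have "?n x / x\<^sup>2 \<le> ?n x / R\<^sup>2" using R by (intro divide_left_mono power_mono mult_pos_pos) auto
      then show ?thesis using True by simp
    qed simp
  qed
  also have "\<dots> = 1 / R\<^sup>2 * ?I {R..} ?n" by (rule integral_mult_right_zero)
  also have "\<dots> \<le> 1 / R\<^sup>2 * sqi \<phi>" using n n0 by (intro mult_left_mono) auto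
  finally have b: "c * ?I {R..} ?h \<le> c / R\<^sup>2 * sqi \<phi>"
    using mult_left_mono[of _ _ c] c_pos by fastforce
  have "?I {R..} (\<lambda>x. ?k x + \<omega> * ?n x) = (\<integral>x. indicator {R..} x * ?k x + \<omega> * (indicator {R..} x * ?n x) \<partial>halfline)"
    by (intro Bochner_Integration.integral_cong) (auto simp: algebra_simps)
  also have "\<dots> = ?I {R..} ?k + \<omega> * ?I {R..} ?n"
    by (subst Bochner_Integration.integral_add[OF ik_R integrable_mult_right[OF in_R]]) (simp only: integral_mult_right_zero)
  finally have e: "?I {R..} (\<lambda>x. ?k x + \<omega> * ?n x) = ?I {R..} ?k + \<omega> * ?I {R..} ?n" .
  have "gn_C * (?I {R..} (\<lambda>x. cmod (\<phi> x) powr (p + 1))) powr \<theta> \<le> ?I {R..} ?k + \<omega> * ?I {R..} ?n + sqrt \<omega> * (cmod (\<phi> R))\<^sup>2"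
    using test_GN_tail[OF \<phi> less_imp_le[OF R]] unfolding e .
  moreover have "?I {R..} ?k + \<omega> * ?I {R..} ?n \<le> Q \<phi> + c / R\<^sup>2 * sqi \<phi>"
  proof -
    have w: "0 \<le> \<omega> * ?I {0..R} ?n" using omega n0 by simp
    have "Q \<phi> = ?I {0..R} ?k + ?I {R..} ?k - (c * ?I {0..R} ?h + c * ?I {R..} ?h) + (\<omega> * ?I {0..R} ?n + \<omega> * ?I {R..} ?n)"
      unfolding Q_test[OF \<phi>] k h by (subst n) (simp only: distrib_left)
    then show ?thesis using a b w by linarith
  qed
  moreover have "P \<phi> - ?I {0..R} (\<lambda>x. cmod (\<phi> x) powr (p + 1)) = ?I {R..} (\<lambda>x. cmod (\<phi> x) powr (p + 1))"
    using P by simp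
  ultimately show ?thesis by simp
qed

lemma Q_parallelogram:
  assumes "\<phi> \<in> test_funs" "\<psi> \<in> test_funs"
  shows "Q (\<lambda>x. \<phi> x + \<psi> x) + Q (\<lambda>x. \<phi> x - \<psi> x) = 2 * Q \<phi> + 2 * Q \<psi>"
proof -
  have sq: "sqi (\<lambda>x. f x + g x) + sqi (\<lambda>x. f x - g x) = 2 * sqi f + 2 * sqi g" if fg: "f \<in> L2" "g \<in> L2" for f g
  proof -
    have "sqi (\<lambda>x. f x + g x) + sqi (\<lambda>x. f x - g x) = (\<integral>x. (cmod (f x + g x))\<^sup>2 + (cmod (f x - g x))\<^sup>2 \<partial>halfline)"
      unfolding sqi_def by (rule Bochner_Integration.integral_add[symmetric]) (intro L2_D(2) L2_add L2_diff fg)+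
    also have "\<dots> = (\<integral>x. 2 * (cmod (f x))\<^sup>2 + 2 * (cmod (g x))\<^sup>2 \<partial>halfline)"
      unfolding power2_norm_eq_inner
      by (intro Bochner_Integration.integral_cong) (auto simp: inner_add_left inner_add_right inner_diff_left inner_diff_right)
    also have "\<dots> = 2 * sqi f + 2 * sqi g"
      unfolding sqi_def using L2_D(2)[OF fg(1)] L2_D(2)[OF fg(2)] by simp
    finally show ?thesis .
  qed
  have L: "\<phi> \<in> L2" "\<psi> \<in> L2" "dv \<phi> \<in> L2" "dv \<psi> \<in> L2"
    by (intro test_fun_L2 test_fun_dv assms)+
  have d: "dv (\<lambda>x. \<phi> x + \<psi> x) = (\<lambda>x. dv \<phi> x + dv \<psi> x)" "dv (\<lambda>x. \<phi> x - \<psi> x) = (\<lambda>x. dv \<phi> x - dv \<psi> x)"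
    using dv_add[OF assms] dv_diff[OF assms] by blast+
  note sums = sq[OF L(1,2)] sq[OF L(3,4)] sq[OF test_Hardy_L2(1)[OF assms(1)] test_Hardy_L2(1)[OF assms(2)]]
  have "Q (\<lambda>x. \<phi> x + \<psi> x) + Q (\<lambda>x. \<phi> x - \<psi> x)
    = (sqi (\<lambda>x. dv \<phi> x + dv \<psi> x) + sqi (\<lambda>x. dv \<phi> x - dv \<psi> x))
      - c * (sqi (\<lambda>x. \<phi> x / of_real x + \<psi> x / of_real x) + sqi (\<lambda>x. \<phi> x / of_real x - \<psi> x / of_real x))
      + \<omega> * (sqi (\<lambda>x. \<phi> x + \<psi> x) + sqi (\<lambda>x. \<phi> x - \<psi> x))"
    unfolding Q_test[OF test_fun_add[OF assms]] Q_test[OF test_fun_diff[OF assms]] d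
      add_divide_distrib diff_divide_distrib by (simp add: algebra_simps)
  also have "\<dots> = 2 * Q \<phi> + 2 * Q \<psi>"
    unfolding sums Q_test[OF assms(1)] Q_test[OF assms(2)] by (simp add: algebra_simps)
  finally show ?thesis .
qed

text \<open>On \<open>[0, R * s]\<close> the inner function is at least \<open>1 / cosh s\<close>,
  and beyond \<open>R * L\<close> the outer one is at least \<open>tanh L\<close>. For small
  \<open>s\<close> and large \<open>L\<close> both factors are close to \<open>1\<close>; only the
  part between the two radii is given away.\<close>

lemma P_cut_ge:
  assumes \<phi>: "\<phi> \<in> test_funs" "P \<phi> = 1" and R: "0 < R" and s: "0 \<le> s" "0 \<le> L"
  defines "a \<equiv> \<lambda>r. \<integral>x. indicator {0..r} x * cmod (\<phi> x) powr (p + 1) \<partial>halfline"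
  shows "(1 / cosh s)\<^sup>2 * a (R * s) powr \<theta> \<le> P (\<lambda>x. of_real (cut_in R x) * \<phi> x) powr \<theta>"
    "(tanh L)\<^sup>2 * (1 - a (R * L)) powr \<theta> \<le> P (\<lambda>x. of_real (cut_out R x) * \<phi> x) powr \<theta>"
proof -
  let ?f = "\<lambda>x. cmod (\<phi> x) powr (p + 1)"
  have q: "0 < p + 1" using p_gt by simp
  have i: "integrable halfline ?f" by (rule test_pint_integrable[OF \<phi>(1) q])
  have ia: "integrable halfline (\<lambda>x. indicator {0..r} x * ?f x)" for r
    by (rule integral_indicator_le(2)[OF i]) auto
  have a0: "0 \<le> a r" for r unfolding a_def by (intro integral_nonneg_AE) auto
  have a1: "a r \<le> 1" for r
    unfolding a_def using integral_indicator_le(1)[OF i, of "{0..r}"] \<phi>(2) by (simp add: pint_def)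
  have pow: "(t powr (p + 1) * z) powr \<theta> = t\<^sup>2 * z powr \<theta>" if "0 \<le> t" "0 \<le> z" for t z
  proof -
    have "(t powr (p + 1)) powr \<theta> = t\<^sup>2" unfolding powr_powr p1_theta using that by simp
    then show ?thesis using that by (simp add: powr_mult)
  qed
  have t: "(\<lambda>x. of_real (cut_in R x) * \<phi> x) \<in> test_funs" "(\<lambda>x. of_real (cut_out R x) * \<phi> x) \<in> test_funs"
    by (intro test_fun_mult cut_smooth \<phi>)+
  have c: "0 < cosh z" for z :: real by (rule cosh_real_pos)
  have P_mult: "cmod (of_real r * \<phi> x) powr (p + 1) = \<bar>r\<bar> powr (p + 1) * ?f x" for r x
    by (simp add: norm_mult powr_mult)
  have "(1 / cosh s) powr (p + 1) * a (R * s) = (\<integral>x. (1 / cosh s) powr (p + 1) * (indicator {0..R * s} x * ?f x) \<partial>halfline)"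
    unfolding a_def by (rule integral_mult_right_zero[symmetric])
  also have "\<dots> \<le> P (\<lambda>x. of_real (cut_in R x) * \<phi> x)"
    unfolding pint_def
  proof (rule integral_mono[OF integrable_mult_right[OF ia] test_pint_integrable[OF t(1) q]])
    fix x
    show "(1 / cosh s) powr (p + 1) * (indicator {0..R * s} x * ?f x) \<le> cmod (of_real (cut_in R x) * \<phi> x) powr (p + 1)"
    proof (cases "x \<in> {0..R * s}")
      case True
      then have "0 \<le> x / R" "x / R \<le> s" using R by (auto simp: field_simps)
      then have "cosh (x / R) \<le> cosh s" by (subst cosh_real_nonneg_le_iff) auto
      then have "1 / cosh s \<le> \<bar>cut_in R x\<bar>"
        using c[of "x / R"] c[of s] by (simp add: cut_in_def frac_le)
      then have "(1 / cosh s) powr (p + 1) \<le> \<bar>cut_in R x\<bar> powr (p + 1)"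
        using c[of s] q by (intro powr_mono2) auto
      then show ?thesis using True unfolding P_mult by (simp add: mult_right_mono)
    qed simp
  qed
  finally have "((1 / cosh s) powr (p + 1) * a (R * s)) powr \<theta> \<le> P (\<lambda>x. of_real (cut_in R x) * \<phi> x) powr \<theta>"
    using a0 theta by (intro powr_mono2 mult_nonneg_nonneg) auto
  then show "(1 / cosh s)\<^sup>2 * a (R * s) powr \<theta> \<le> P (\<lambda>x. of_real (cut_in R x) * \<phi> x) powr \<theta>"
    using pow[OF _ a0, of "1 / cosh s"] c[of s] by simp
  have "(\<integral>x. (tanh L) powr (p + 1) * (?f x - indicator {0..R * L} x * ?f x) \<partial>halfline)
      = (tanh L) powr (p + 1) * (\<integral>x. ?f x - indicator {0..R * L} x * ?f x \<partial>halfline)"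
    by (rule integral_mult_right_zero)
  also have "(\<integral>x. ?f x - indicator {0..R * L} x * ?f x \<partial>halfline) = 1 - a (R * L)"
    unfolding a_def using Bochner_Integration.integral_diff[OF i ia] \<phi>(2) by (simp add: pint_def)
  finally have "(tanh L) powr (p + 1) * (1 - a (R * L)) = (\<integral>x. (tanh L) powr (p + 1) * (?f x - indicator {0..R * L} x * ?f x) \<partial>halfline)" ..
  also have "\<dots> \<le> P (\<lambda>x. of_real (cut_out R x) * \<phi> x)"
    unfolding pint_def
  proof (rule integral_mono[OF integrable_mult_right[OF Bochner_Integration.integrable_diff[OF i ia]] test_pint_integrable[OF t(2) q]])
    fix x assume "x \<in> space halfline"
    then have x: "0 < x" by (simp add: space_restrict_space)
    show "(tanh L) powr (p + 1) * (?f x - indicator {0..R * L} x * ?f x) \<le> cmod (of_real (cut_out R x) * \<phi> x) powr (p + 1)"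
    proof (cases "x \<in> {0..R * L}")
      case False
      then have "L \<le> x / R" using x R by (auto simp: field_simps)
      then have "tanh L \<le> \<bar>cut_out R x\<bar>"
        unfolding cut_out_def by (intro order_trans[OF _ abs_ge_self]) (simp only: tanh_real_le_iff)
      then have "(tanh L) powr (p + 1) \<le> \<bar>cut_out R x\<bar> powr (p + 1)"
        using s q by (intro powr_mono2) auto
      then show ?thesis using False unfolding P_mult by (simp add: mult_right_mono)
    qed simp
  qed
  finally have "((tanh L) powr (p + 1) * (1 - a (R * L))) powr \<theta> \<le> P (\<lambda>x. of_real (cut_out R x) * \<phi> x) powr \<theta>"
    using a1 theta s by (intro powr_mono2 mult_nonneg_nonneg) auto
  then show "(tanh L)\<^sup>2 * (1 - a (R * L)) powr \<theta> \<le> P (\<lambda>x. of_real (cut_out R x) * \<phi> x) powr \<theta>"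
    using pow[of "tanh L" "1 - a (R * L)"] a1[of "R * L"] s by simp
qed

lemma localization_inequality:
  assumes \<phi>: "\<phi> \<in> test_funs" "P \<phi> = 1" and R: "0 < R" and s: "0 \<le> s" "0 \<le> L"
  defines "a \<equiv> \<lambda>r. \<integral>x. indicator {0..r} x * cmod (\<phi> x) powr (p + 1) \<partial>halfline"
  shows "Iinf * ((1 / cosh s)\<^sup>2 * a (R * s) powr \<theta> + (tanh L)\<^sup>2 * (1 - a (R * L)) powr \<theta>) \<le> Q \<phi> + sqi \<phi> / R\<^sup>2"
proof -
  note P = P_cut_ge[OF \<phi> R s]
  have t: "(\<lambda>x. of_real (cut_in R x) * \<phi> x) \<in> test_funs" "(\<lambda>x. of_real (cut_out R x) * \<phi> x) \<in> test_funs"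
    by (intro test_fun_mult cut_smooth \<phi>)+
  have "Iinf * ((1 / cosh s)\<^sup>2 * a (R * s) powr \<theta> + (tanh L)\<^sup>2 * (1 - a (R * L)) powr \<theta>)
    \<le> Iinf * (P (\<lambda>x. of_real (cut_in R x) * \<phi> x) powr \<theta> + P (\<lambda>x. of_real (cut_out R x) * \<phi> x) powr \<theta>)"
    unfolding a_def using Iinf_pos by (intro mult_left_mono add_mono P) auto
  also have "\<dots> \<le> Q (\<lambda>x. of_real (cut_in R x) * \<phi> x) + Q (\<lambda>x. of_real (cut_out R x) * \<phi> x)"
    using Iinf_le[OF t(1)] Iinf_le[OF t(2)] by (simp add: distrib_left)
  also have "\<dots> \<le> Q \<phi> + sqi \<phi> / R\<^sup>2" by (rule Q_localization[OF \<phi>(1) R])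
  finally show ?thesis .
qed

text \<open>On a bounded interval the uniform sup bound is an integrable majorant; no such majorant
  exists on the whole half-line, where part of \<open>P\<close> may escape.\<close>

lemma local_P_tendsto:
  assumes t: "\<And>n. \<psi> n \<in> test_funs" and b: "\<And>n x. cmod (\<psi> n x) \<le> B" and lim: "\<And>x. (\<lambda>n. \<psi> n x) \<longlonglongrightarrow> U x"
  shows "(\<lambda>n. \<integral>x. indicator {0..r} x * cmod (\<psi> n x) powr (p + 1) \<partial>halfline)
    \<longlonglongrightarrow> (\<integral>x. indicator {0..r} x * cmod (U x) powr (p + 1) \<partial>halfline)"
    and "integrable halfline (\<lambda>x. indicator {0..r} x * cmod (U x) powr (p + 1))"
proof -
  have q: "0 < p + 1" using p_gt by simp
  have m\<psi>[measurable]: "\<psi> n \<in> borel_measurable halfline" for n by (rule L2_D(1)[OF test_fun_L2[OF t]])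
  have mU[measurable]: "U \<in> borel_measurable halfline"
    by (rule borel_measurable_LIMSEQ_metric[of \<psi>]) (use m\<psi> lim in auto)
  have mi[measurable]: "(indicator {0..r} :: real \<Rightarrow> real) \<in> borel_measurable halfline"
    by (rule measurable_restrict_space1[OF measurable_completion]) simp
  have w: "integrable halfline (\<lambda>x. indicator {0..r} x * B powr (p + 1))"
    by (rule halfline_integral_indicator_Icc(1)) auto
  have l: "AE x in halfline. (\<lambda>n. indicator {0..r} x * cmod (\<psi> n x) powr (p + 1)) \<longlonglongrightarrow> indicator {0..r} x * cmod (U x) powr (p + 1)"
    using q by (intro always_eventually allI tendsto_mult tendsto_const tendsto_powr' tendsto_norm lim) auto
  have le: "AE x in halfline. norm (indicator {0..r} x * cmod (\<psi> n x) powr (p + 1)) \<le> indicator {0..r} x * B powr (p + 1)" for n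
    using q b by (intro always_eventually allI) (auto simp: indicator_def intro!: powr_mono2)
  have m1: "(\<lambda>x. indicator {0..r} x * cmod (U x) powr (p + 1)) \<in> borel_measurable halfline" by measurable
  have m2: "(\<lambda>x. indicator {0..r} x * cmod (\<psi> n x) powr (p + 1)) \<in> borel_measurable halfline" for n by measurable
  show "(\<lambda>n. \<integral>x. indicator {0..r} x * cmod (\<psi> n x) powr (p + 1) \<partial>halfline)
    \<longlonglongrightarrow> (\<integral>x. indicator {0..r} x * cmod (U x) powr (p + 1) \<partial>halfline)"
    by (rule integral_dominated_convergence[OF m1 m2 w l le])
  show "integrable halfline (\<lambda>x. indicator {0..r} x * cmod (U x) powr (p + 1))"
    by (rule integrable_dominated_convergence[OF m1 m2 w l le])
qed

lemma powr_gt_self: "0 < a \<Longrightarrow> a < 1 \<Longrightarrow> a < a powr \<theta>"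
  using powr_less_mono'[of a \<theta> 1] theta by simp

lemma exists_minimizer:
  obtains u where "u \<in> H10" "P u = 1" "Q u = Iinf"
proof -
  obtain \<phi>0 where \<phi>0: "\<And>n. \<phi>0 n \<in> test_funs" "\<And>n. P (\<phi>0 n) = 1" "\<And>n. Q (\<phi>0 n) \<le> Iinf + 1" "(\<lambda>n. Q (\<phi>0 n)) \<longlonglongrightarrow> Iinf"
    by (rule minimizing_sequence) blast
  define B where "B = (Iinf + 1) / \<kappa>"
  have B0: "0 < B" using Iinf_pos kappa(1) by (simp add: B_def)
  have h0: "sqi (\<phi>0 n) + sqi (dv (\<phi>0 n)) \<le> B" for n
  proof -
    have "\<kappa> * (sqi (\<phi>0 n) + sqi (dv (\<phi>0 n))) \<le> Iinf + 1"
      using Q_test_coercive[OF \<phi>0(1)] \<phi>0(3) order_trans by blast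
    then show ?thesis unfolding B_def using kappa(1) by (simp add: pos_le_divide_eq mult.commute)
  qed
  obtain k U where k: "strict_mono (k :: nat \<Rightarrow> nat)" and U: "\<And>x. (\<lambda>n. \<phi>0 (k n) x) \<longlonglongrightarrow> U x"
    by (rule pointwise_subsequence[of \<phi>0 B, OF \<phi>0(1) h0]) blast
  define \<phi> where "\<phi> n = \<phi>0 (k n)" for n
  have \<phi>: "\<And>n. \<phi> n \<in> test_funs" "\<And>n. P (\<phi> n) = 1" "\<And>n. sqi (\<phi> n) + sqi (dv (\<phi> n)) \<le> B" "\<And>x. (\<lambda>n. \<phi> n x) \<longlonglongrightarrow> U x"
    using \<phi>0 h0 U by (simp_all add: \<phi>_def)
  have Qlim: "(\<lambda>n. Q (\<phi> n)) \<longlonglongrightarrow> Iinf"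
    using LIMSEQ_subseq_LIMSEQ[OF \<phi>0(4) k] by (simp add: \<phi>_def o_def)
  have sB: "sqi (\<phi> n) \<le> B" for n using \<phi>(3)[of n] sqi_nonneg[of "dv (\<phi> n)"] by linarith
  have bd: "cmod (\<phi> n x) \<le> sqrt B" for n x
    using order_trans[OF test_sup_le[OF \<phi>(1)] \<phi>(3)] by (rule real_le_rsqrt)
  have q: "0 < p + 1" using p_gt by simp
  define a where "a n r = (\<integral>x. indicator {0..r} x * cmod (\<phi> n x) powr (p + 1) \<partial>halfline)" for n r
  define A where "A r = (\<integral>x. indicator {0..r} x * cmod (U x) powr (p + 1) \<partial>halfline)" for r
  have aA: "(\<lambda>n. a n r) \<longlonglongrightarrow> A r" for r
    unfolding a_def A_def by (rule local_P_tendsto(1)[OF \<phi>(1) bd \<phi>(4)])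
  have iU: "integrable halfline (\<lambda>x. indicator {0..r} x * cmod (U x) powr (p + 1))" for r
    by (rule local_P_tendsto(2)[OF \<phi>(1) bd \<phi>(4)])
  have a01: "0 \<le> a n r" "a n r \<le> 1" for n r
  proof -
    show "0 \<le> a n r" unfolding a_def by (intro integral_nonneg_AE) auto
    show "a n r \<le> 1"
      unfolding a_def using integral_indicator_le(1)[OF test_pint_integrable[OF \<phi>(1)[of n] q], of "{0..r}"] \<phi>(2)[of n]
      by (simp add: pint_def)
  qed
  have A01: "0 \<le> A r" "A r \<le> 1" for r
    using LIMSEQ_le_const[OF aA] LIMSEQ_le_const2[OF aA] a01 by blast+
  have Amono: "A r \<le> A s" if "r \<le> s" for r s
    unfolding A_def by (rule integral_mono[OF iU iU], rule mult_right_mono) (use that in \<open>auto simp: indicator_def\<close>)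
  \<comment> \<open>\<open>\<alpha>\<close> is the part of \<open>P\<close> retained by the
    pointwise limit \<open>U\<close>; the name is local here and does not denote the exponent of the
    soliton.\<close>
  have "incseq (\<lambda>k. A (real k))" by (intro incseq_SucI Amono) simp
  then obtain \<alpha> where \<alpha>: "(\<lambda>k. A (real k)) \<longlonglongrightarrow> \<alpha>" "\<And>k. A (real k) \<le> \<alpha>"
    by (rule incseq_convergent[where B=1]) (use A01 in auto)
  have A_le: "A r \<le> \<alpha>" for r
  proof -
    obtain k where "r \<le> real k" using real_arch_simple by blast
    then show ?thesis using Amono \<alpha>(2) order_trans by blast
  qed
  have \<alpha>01: "0 \<le> \<alpha>" "\<alpha> \<le> 1"
  proof -
    show "0 \<le> \<alpha>" using A_le[of 0] A01(1)[of 0] by linarith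
    show "\<alpha> \<le> 1" by (rule LIMSEQ_le_const2[OF \<alpha>(1)]) (use A01(2) in blast)
  qed
  have powr_lim: "(\<lambda>n. f n powr \<theta>) \<longlonglongrightarrow> l powr \<theta>" if "f \<longlonglongrightarrow> l" "\<And>n. 0 \<le> f n" for f :: "nat \<Rightarrow> real" and l
    using that theta by (intro tendsto_powr') auto

  have split: "\<alpha> powr \<theta> + (1 - \<alpha>) powr \<theta> \<le> 1"
  proof -
    have step: "Iinf * ((1 / cosh (1 / real (Suc k)))\<^sup>2 * A (real (Suc k)) powr \<theta> + (tanh (real (Suc k)))\<^sup>2 * (1 - \<alpha>) powr \<theta>)
        \<le> Iinf + B / ((real (Suc k))\<^sup>2)\<^sup>2" for k
    proof -
      \<comment> \<open>With \<open>s = 1 / (k + 1)\<close>, \<open>L = k + 1\<close> and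
        \<open>R = (k + 1)\<^sup>2\<close>, the radius \<open>R * s\<close> still tends to infinity
        while \<open>s\<close> tends to \<open>0\<close>; so both cut-off factors tend to
        \<open>1\<close> and the localization error to \<open>0\<close>.\<close>
      define R where "R = (real (Suc k))\<^sup>2"
      define s where "s = 1 / real (Suc k)"
      define L where "L = real (Suc k)"
      have R: "0 < R" "0 \<le> s" "0 \<le> L" "R * s = real (Suc k)"
        by (auto simp: R_def s_def L_def power2_eq_square)
      have "Iinf * ((1 / cosh s)\<^sup>2 * a n (R * s) powr \<theta> + (tanh L)\<^sup>2 * (1 - a n (R * L)) powr \<theta>) \<le> Q (\<phi> n) + B / R\<^sup>2" for n
        using localization_inequality[OF \<phi>(1)[of n] \<phi>(2)[of n] R(1-3), folded a_def] divide_right_mono[OF sB[of n], of "R\<^sup>2"] by simp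
      moreover have "(\<lambda>n. Iinf * ((1 / cosh s)\<^sup>2 * a n (R * s) powr \<theta> + (tanh L)\<^sup>2 * (1 - a n (R * L)) powr \<theta>))
          \<longlonglongrightarrow> Iinf * ((1 / cosh s)\<^sup>2 * A (R * s) powr \<theta> + (tanh L)\<^sup>2 * (1 - A (R * L)) powr \<theta>)"
        by (intro tendsto_mult tendsto_add tendsto_const powr_lim tendsto_diff aA) (use a01 in auto)
      moreover have "(\<lambda>n. Q (\<phi> n) + B / R\<^sup>2) \<longlonglongrightarrow> Iinf + B / R\<^sup>2"
        by (intro tendsto_add Qlim tendsto_const)
      ultimately have le: "Iinf * ((1 / cosh s)\<^sup>2 * A (R * s) powr \<theta> + (tanh L)\<^sup>2 * (1 - A (R * L)) powr \<theta>) \<le> Iinf + B / R\<^sup>2"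
        using LIMSEQ_le by blast
      have "(1 - \<alpha>) powr \<theta> \<le> (1 - A (R * L)) powr \<theta>"
        using A_le \<alpha>01 theta by (intro powr_mono2) auto
      then have "Iinf * ((1 / cosh s)\<^sup>2 * A (R * s) powr \<theta> + (tanh L)\<^sup>2 * (1 - \<alpha>) powr \<theta>)
         \<le> Iinf * ((1 / cosh s)\<^sup>2 * A (R * s) powr \<theta> + (tanh L)\<^sup>2 * (1 - A (R * L)) powr \<theta>)"
        using Iinf_pos by (intro mult_left_mono add_left_mono) auto
      with le have "Iinf * ((1 / cosh s)\<^sup>2 * A (R * s) powr \<theta> + (tanh L)\<^sup>2 * (1 - \<alpha>) powr \<theta>) \<le> Iinf + B / R\<^sup>2"
        by linarith
      then show ?thesis unfolding R(4) by (simp only: R_def s_def L_def)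
    qed
    have inv: "(\<lambda>k. 1 / real (Suc k)) \<longlonglongrightarrow> 0"
      using LIMSEQ_inverse_real_of_nat by (simp add: inverse_eq_divide)
    have c1: "(\<lambda>k. (1 / cosh (1 / real (Suc k)))\<^sup>2) \<longlonglongrightarrow> (1 / cosh 0)\<^sup>2"
      by (intro tendsto_intros tendsto_cosh inv) simp
    have t1: "(\<lambda>k. (tanh (real (Suc k)))\<^sup>2) \<longlonglongrightarrow> 1\<^sup>2"
      by (intro tendsto_power filterlim_compose[OF tanh_real_at_top] filterlim_compose[OF filterlim_real_sequentially] filterlim_Suc)
    have b1: "(\<lambda>k. Iinf + B / ((real (Suc k))\<^sup>2)\<^sup>2) \<longlonglongrightarrow> Iinf + B * (0\<^sup>2)\<^sup>2"
    proof -
      have "(\<lambda>k. Iinf + B * ((1 / real (Suc k))\<^sup>2)\<^sup>2) \<longlonglongrightarrow> Iinf + B * (0\<^sup>2)\<^sup>2"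
        by (intro tendsto_add tendsto_mult tendsto_power tendsto_const inv)
      then show ?thesis by (simp add: power_divide)
    qed
    have "Iinf * ((1 / cosh 0)\<^sup>2 * \<alpha> powr \<theta> + 1\<^sup>2 * (1 - \<alpha>) powr \<theta>) \<le> Iinf + B * (0\<^sup>2)\<^sup>2"
    proof (rule LIMSEQ_le[OF _ b1])
      show "(\<lambda>k. Iinf * ((1 / cosh (1 / real (Suc k)))\<^sup>2 * A (real (Suc k)) powr \<theta> + (tanh (real (Suc k)))\<^sup>2 * (1 - \<alpha>) powr \<theta>))
         \<longlonglongrightarrow> Iinf * ((1 / cosh 0)\<^sup>2 * \<alpha> powr \<theta> + 1\<^sup>2 * (1 - \<alpha>) powr \<theta>)"
        by (intro tendsto_mult tendsto_add tendsto_const powr_lim c1 t1 LIMSEQ_Suc[OF \<alpha>(1)] A01)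
    qed (use step in blast)
    then show ?thesis using Iinf_pos by simp
  qed

  have not0: "\<alpha> \<noteq> 0"
  proof
    assume \<alpha>0: "\<alpha> = 0"
    have A0: "A r = 0" for r using A_le[of r] A01(1)[of r] \<alpha>0 by simp
    have "AE x in halfline. \<forall>m. indicator {0..real m} x * cmod (U x) powr (p + 1) = 0"
    proof (subst AE_all_countable, intro allI)
      fix m
      show "AE x in halfline. indicator {0..real m} x * cmod (U x) powr (p + 1) = 0"
        using A0[of "real m"] unfolding A_def by (subst (asm) integral_nonneg_eq_0_iff_AE[OF iU]) auto
    qed
    then have U0: "AE x in halfline. U x = 0"
      using AE_space
    proof eventually_elim
      case (elim x)
      obtain m where "x \<le> real m" using real_arch_simple by blast
      then have "indicator {0..real m} x = (1::real)" using elim(2) by (simp add: space_restrict_space)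
      with elim(1)[rule_format, of m] show ?case using q by simp
    qed
    \<comment> \<open>A radius with \<open>U R = 0\<close> removes the boundary term of
      \<open>Q_tail\<close> in the limit, and by \<open>A0\<close> no part of \<open>P\<close> stays
      in \<open>[0, R]\<close>. Letting the radius grow gives \<open>gn_C \<le> Iinf\<close>, which
      the trial function excludes.\<close>
    have step: "gn_C \<le> Iinf + c / (real (Suc m))\<^sup>2 * B" for m
    proof -
      obtain R where R: "real (Suc m) < R" "U R = 0"
        by (rule AE_halfline_obtains_gt[OF U0, of "real (Suc m)"]) auto
      have R0: "0 < R" using R(1) by linarith
      have "gn_C * (1 - a n R) powr \<theta> \<le> Q (\<phi> n) + c / R\<^sup>2 * B + sqrt \<omega> * (cmod (\<phi> n R))\<^sup>2" for n
        using Q_tail[OF \<phi>(1)[of n] R0] mult_left_mono[OF sB[of n], of "c / R\<^sup>2"] c_pos unfolding \<phi>(2) a_def by simp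
      moreover have "(\<lambda>n. gn_C * (1 - a n R) powr \<theta>) \<longlonglongrightarrow> gn_C * (1 - A R) powr \<theta>"
        by (intro tendsto_mult tendsto_const powr_lim tendsto_diff aA) (use a01 in auto)
      moreover have "(\<lambda>n. Q (\<phi> n) + c / R\<^sup>2 * B + sqrt \<omega> * (cmod (\<phi> n R))\<^sup>2) \<longlonglongrightarrow> Iinf + c / R\<^sup>2 * B + sqrt \<omega> * (cmod (U R))\<^sup>2"
        by (intro tendsto_add tendsto_mult tendsto_power tendsto_norm tendsto_const Qlim \<phi>(4))
      ultimately have "gn_C * (1 - A R) powr \<theta> \<le> Iinf + c / R\<^sup>2 * B + sqrt \<omega> * (cmod (U R))\<^sup>2"
        using LIMSEQ_le by blast
      then have "gn_C \<le> Iinf + c / R\<^sup>2 * B" by (simp add: A0 R(2))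
      also have "c / R\<^sup>2 \<le> c / (real (Suc m))\<^sup>2"
        using R c_pos by (intro divide_left_mono power_mono mult_pos_pos) auto
      finally show ?thesis using B0 by (simp add: mult_right_mono)
    qed
    have "(\<lambda>m. Iinf + c / (real (Suc m))\<^sup>2 * B) \<longlonglongrightarrow> Iinf + c * 0\<^sup>2 * B"
    proof -
      have "(\<lambda>m. Iinf + c * (inverse (real (Suc m)))\<^sup>2 * B) \<longlonglongrightarrow> Iinf + c * 0\<^sup>2 * B"
        by (intro tendsto_add tendsto_mult tendsto_power tendsto_const LIMSEQ_inverse_real_of_nat)
      then show ?thesis by (simp add: divide_inverse power_inverse)
    qed
    then have "gn_C \<le> Iinf + c * 0\<^sup>2 * B" by (rule LIMSEQ_le_const) (use step in blast)
    then show False using Iinf_less by simp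
  qed
  \<comment> \<open>Strict subadditivity: since \<open>\<theta> < 1\<close>, a genuine splitting
    makes \<open>\<alpha> powr \<theta> + (1 - \<alpha>) powr \<theta>\<close> exceed
    \<open>1\<close>.\<close>
  have \<alpha>1: "\<alpha> = 1"
  proof (rule ccontr)
    assume "\<alpha> \<noteq> 1"
    then have "0 < \<alpha>" "\<alpha> < 1" using \<alpha>01 not0 by auto
    then have "\<alpha> < \<alpha> powr \<theta>" "1 - \<alpha> < (1 - \<alpha>) powr \<theta>" by (auto intro!: powr_gt_self)
    then show False using split by linarith
  qed

  \<comment> \<open>Suppose pairs of arbitrarily late members stay apart. Their sums converge
    pointwise to \<open>2 * U\<close>, so in the limit \<open>P\<close> of the sum is at least
    nearly \<open>2 powr (p + 1)\<close>, and \<open>Q\<close> of the sum at least nearly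
    \<open>4 * Iinf\<close>. The parallelogram identity leaves nothing for the difference, against
    coercivity.\<close>
  have Cauchy: "\<exists>N. \<forall>m\<ge>N. \<forall>n\<ge>N. sqi (\<lambda>x. \<phi> m x - \<phi> n x) + sqi (\<lambda>x. dv (\<phi> m) x - dv (\<phi> n) x) \<le> e" if e: "0 < e" for e
  proof (rule ccontr)
    assume nC: "\<not> ?thesis"
    define D where "D m n = sqi (\<lambda>x. \<phi> m x - \<phi> n x) + sqi (\<lambda>x. dv (\<phi> m) x - dv (\<phi> n) x)" for m n
    have "\<not> (\<exists>N. \<forall>m\<ge>N. \<forall>n\<ge>N. D m n \<le> e)"
      unfolding D_def by (rule nC)
    then have "\<forall>N. \<exists>mn. N \<le> fst mn \<and> N \<le> snd mn \<and> e < D (fst mn) (snd mn)"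
      by (simp add: not_le)
    from choice[OF this] obtain ij0 where ij0: "\<And>N. N \<le> fst (ij0 N) \<and> N \<le> snd (ij0 N) \<and> e < D (fst (ij0 N)) (snd (ij0 N))"
      by blast
    define i j where "i N = fst (ij0 N)" and "j N = snd (ij0 N)" for N
    have ij: "\<And>N. N \<le> i N" "\<And>N. N \<le> j N" "\<And>N. e < D (i N) (j N)"
      using ij0 by (simp_all add: i_def j_def)
    have fi: "filterlim i sequentially sequentially" "filterlim j sequentially sequentially"
      using ij(1,2) by (auto intro!: filterlim_at_top_mono[OF filterlim_ident])
    have sub: "(\<lambda>n. f (i n)) \<longlonglongrightarrow> l" "(\<lambda>n. f (j n)) \<longlonglongrightarrow> l" if "f \<longlonglongrightarrow> l" for f :: "nat \<Rightarrow> 'z::topological_space" and l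
      by (rule filterlim_compose[OF that fi(1)], rule filterlim_compose[OF that fi(2)])
    define \<psi> where "\<psi> N x = \<phi> (i N) x + \<phi> (j N) x" for N x
    have t\<psi>: "\<psi> N \<in> test_funs" for N unfolding \<psi>_def[abs_def] by (intro test_fun_add \<phi>)
    have b\<psi>: "cmod (\<psi> N x) \<le> 2 * sqrt B" for N x
      unfolding \<psi>_def using norm_triangle_ineq[of "\<phi> (i N) x" "\<phi> (j N) x"] bd[of "i N" x] bd[of "j N" x] by linarith
    have l\<psi>: "(\<lambda>N. \<psi> N x) \<longlonglongrightarrow> 2 * U x" for x
      unfolding \<psi>_def using tendsto_add[OF sub(1)[OF \<phi>(4)] sub(2)[OF \<phi>(4)], of x x] by simp
    have le: "\<kappa> * e \<le> 4 * Iinf - Iinf * (4 * A (real r) powr \<theta>)" for r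
    proof -
      let ?b = "\<lambda>N. \<integral>x. indicator {0..real r} x * cmod (\<psi> N x) powr (p + 1) \<partial>halfline"
      have bl: "?b \<longlonglongrightarrow> (\<integral>x. indicator {0..real r} x * cmod (2 * U x) powr (p + 1) \<partial>halfline)"
        by (rule local_P_tendsto(1)[OF t\<psi> b\<psi> l\<psi>])
      have "(\<integral>x. indicator {0..real r} x * cmod (2 * U x) powr (p + 1) \<partial>halfline)
         = (\<integral>x. 2 powr (p + 1) * (indicator {0..real r} x * cmod (U x) powr (p + 1)) \<partial>halfline)"
        by (intro Bochner_Integration.integral_cong) (auto simp: norm_mult powr_mult)
      also have "\<dots> = 2 powr (p + 1) * A (real r)" unfolding A_def by (rule integral_mult_right_zero)
      finally have bl': "?b \<longlonglongrightarrow> 2 powr (p + 1) * A (real r)" using bl by simp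
      have pw: "(2 powr (p + 1) * A (real r)) powr \<theta> = 4 * A (real r) powr \<theta>"
      proof -
        have "(2 powr (p + 1)) powr \<theta> = (4::real)" unfolding powr_powr p1_theta by simp
        then show ?thesis using A01 by (simp add: powr_mult)
      qed
      have ineq: "\<kappa> * e \<le> 2 * Q (\<phi> (i N)) + 2 * Q (\<phi> (j N)) - Iinf * ?b N powr \<theta>" for N
      proof -
        let ?d = "\<lambda>x. \<phi> (i N) x - \<phi> (j N) x"
        have d: "dv ?d = (\<lambda>x. dv (\<phi> (i N)) x - dv (\<phi> (j N)) x)" using dv_diff[OF \<phi>(1) \<phi>(1)] by blast
        have "\<kappa> * e \<le> \<kappa> * (sqi ?d + sqi (dv ?d))"
          unfolding d D_def[symmetric] using less_imp_le[OF ij(3)] kappa(1) by (intro mult_left_mono) auto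
        also have "\<dots> \<le> Q ?d" by (rule Q_test_coercive) (intro test_fun_diff \<phi>)
        also have "\<dots> = 2 * Q (\<phi> (i N)) + 2 * Q (\<phi> (j N)) - Q (\<psi> N)"
          unfolding \<psi>_def[abs_def] using Q_parallelogram[OF \<phi>(1) \<phi>(1), of "i N" "j N"] by simp
        finally have 1: "\<kappa> * e \<le> \<dots>" .
        have ip: "integrable halfline (\<lambda>x. cmod (\<psi> N x) powr (p + 1))" by (rule test_pint_integrable[OF t\<psi> q])
        have "0 \<le> ?b N" by (intro integral_nonneg_AE) auto
        moreover have "?b N \<le> P (\<psi> N)"
          unfolding pint_def by (rule integral_indicator_le(1)[OF ip]) auto
        ultimately have "?b N powr \<theta> \<le> P (\<psi> N) powr \<theta>" using theta by (intro powr_mono2) auto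
        then have "Iinf * ?b N powr \<theta> \<le> Iinf * P (\<psi> N) powr \<theta>" using Iinf_pos by (intro mult_left_mono) auto
        also have "\<dots> \<le> Q (\<psi> N)" by (rule Iinf_le[OF t\<psi>])
        finally show ?thesis using 1 by linarith
      qed
      have "(\<lambda>N. 2 * Q (\<phi> (i N)) + 2 * Q (\<phi> (j N)) - Iinf * ?b N powr \<theta>)
         \<longlonglongrightarrow> 2 * Iinf + 2 * Iinf - Iinf * (2 powr (p + 1) * A (real r)) powr \<theta>"
        by (intro tendsto_diff tendsto_add tendsto_mult tendsto_const sub[OF Qlim] powr_lim bl')
          (auto intro!: integral_nonneg_AE)
      then have "\<kappa> * e \<le> 2 * Iinf + 2 * Iinf - Iinf * (2 powr (p + 1) * A (real r)) powr \<theta>"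
        by (rule LIMSEQ_le_const) (use ineq in blast)
      then show ?thesis unfolding pw by simp
    qed
    have "(\<lambda>r. 4 * Iinf - Iinf * (4 * A (real r) powr \<theta>)) \<longlonglongrightarrow> 4 * Iinf - Iinf * (4 * \<alpha> powr \<theta>)"
      by (intro tendsto_diff tendsto_mult tendsto_const powr_lim \<alpha>(1) A01)
    then have "\<kappa> * e \<le> 4 * Iinf - Iinf * (4 * \<alpha> powr \<theta>)"
      by (rule LIMSEQ_le_const) (use le in blast)
    then have "\<kappa> * e \<le> 0" using \<alpha>1 by simp
    then show False using e kappa(1) by (simp add: mult_le_0_iff)
  qed
  have C1: "\<exists>N. \<forall>m\<ge>N. \<forall>n\<ge>N. sqi (\<lambda>x. \<phi> m x - \<phi> n x) \<le> e" if "0 < e" for e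
  proof -
    obtain N where N: "\<And>m n. m \<ge> N \<Longrightarrow> n \<ge> N \<Longrightarrow> sqi (\<lambda>x. \<phi> m x - \<phi> n x) + sqi (\<lambda>x. dv (\<phi> m) x - dv (\<phi> n) x) \<le> e"
      using Cauchy[OF \<open>0 < e\<close>] by blast
    have "sqi (\<lambda>x. \<phi> m x - \<phi> n x) \<le> e" if "m \<ge> N" "n \<ge> N" for m n
      using N[OF that] sqi_nonneg[of "\<lambda>x. dv (\<phi> m) x - dv (\<phi> n) x"] by linarith
    then show ?thesis by blast
  qed
  have C2: "\<exists>N. \<forall>m\<ge>N. \<forall>n\<ge>N. sqi (\<lambda>x. dv (\<phi> m) x - dv (\<phi> n) x) \<le> e" if "0 < e" for e
  proof -
    obtain N where N: "\<And>m n. m \<ge> N \<Longrightarrow> n \<ge> N \<Longrightarrow> sqi (\<lambda>x. \<phi> m x - \<phi> n x) + sqi (\<lambda>x. dv (\<phi> m) x - dv (\<phi> n) x) \<le> e"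
      using Cauchy[OF \<open>0 < e\<close>] by blast
    have "sqi (\<lambda>x. dv (\<phi> m) x - dv (\<phi> n) x) \<le> e" if "m \<ge> N" "n \<ge> N" for m n
      using N[OF that] sqi_nonneg[of "\<lambda>x. \<phi> m x - \<phi> n x"] by linarith
    then show ?thesis by blast
  qed
  obtain u v where uv: "H1_lim \<phi> u v"
    by (rule H1_complete[OF \<phi>(1) C1 C2])
  have "Q u = Iinf" by (rule LIMSEQ_unique[OF Q_lim[OF uv] Qlim])
  moreover have "P u = 1"
    using LIMSEQ_unique[OF P_lim[OF uv], of 1] by (simp add: \<phi>(2))
  ultimately show ?thesis using that H1_lim_D(1)[OF uv] by blast
qed

lemma Iinf_le_H10:
  assumes "v \<in> H10"
  shows "Iinf * P v powr \<theta> \<le> Q v"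
proof -
  obtain \<phi> where \<phi>: "H1_lim \<phi> v (wderiv v)" by (rule H10_lim[OF assms])
  have "(\<lambda>n. Iinf * P (\<phi> n) powr \<theta>) \<longlonglongrightarrow> Iinf * P v powr \<theta>"
    using theta by (intro tendsto_mult tendsto_const tendsto_powr' P_lim[OF \<phi>]) auto
  then show ?thesis
    by (rule LIMSEQ_le[OF _ Q_lim[OF \<phi>]]) (use Iinf_le H1_lim_unfold(1)[OF \<phi>] in blast)
qed

end

section \<open>The Euler--Lagrange equation\<close>

lemma L2_inner_integrable:
  assumes "f \<in> L2" "g \<in> L2"
  shows "integrable halfline (\<lambda>x. f x \<bullet> g x)"
proof -
  have "integrable halfline (\<lambda>x. Re (f x * cnj (g x)))"
    by (rule integrable_Re[OF L2_mult_integrable[OF assms(1) L2_cnj[OF assms(2)]]])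
  then show ?thesis by (simp add: inner_complex_def)
qed

lemma sqi_combination:
  assumes "f \<in> L2" "g \<in> L2"
  shows "sqi (\<lambda>x. f x + of_real t * g x) = sqi f + 2 * t * (\<integral>x. f x \<bullet> g x \<partial>halfline) + t\<^sup>2 * sqi g"
proof -
  have "sqi (\<lambda>x. f x + of_real t * g x) = (\<integral>x. (cmod (f x))\<^sup>2 + 2 * t * (f x \<bullet> g x) + t\<^sup>2 * (cmod (g x))\<^sup>2 \<partial>halfline)"
    unfolding sqi_def by (intro Bochner_Integration.integral_cong) (use cmod_combination_sq[of 1 _ t] in auto)
  also have "\<dots> = sqi f + 2 * t * (\<integral>x. f x \<bullet> g x \<partial>halfline) + t\<^sup>2 * sqi g"
    unfolding sqi_def using L2_D(2)[OF assms(1)] L2_D(2)[OF assms(2)] L2_inner_integrable[OF assms] by simp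
  finally show ?thesis .
qed

text \<open>The tangent inequality for the convex function \<open>z \<mapsto> cmod z powr q\<close>.
  Cauchy-Schwarz reduces it to the moduli \<open>a\<close> and \<open>b\<close>, where it is
  Bernoulli's inequality for \<open>(a / b) powr q\<close> with exponent
  \<open>1 / q\<close>.\<close>

lemma tangent_powr:
  assumes "2 \<le> q"
  shows "cmod z powr q + q * (cmod z powr (q - 2) * (z \<bullet> w)) \<le> cmod (z + w) powr q"
proof (cases "z = 0")
  case True
  then show ?thesis by simp
next
  case False
  define a b where "a = cmod (z + w)" and "b = cmod z"
  have b: "0 < b" using False by (simp add: b_def)
  have a: "0 \<le> a" by (simp add: a_def)
  have "b\<^sup>2 + z \<bullet> w = z \<bullet> (z + w)" by (simp add: b_def power2_norm_eq_inner inner_add_right)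
  also have "\<dots> \<le> b * a" unfolding a_def b_def by (rule inner_le_cmod)
  finally have zw: "z \<bullet> w \<le> b * (a - b)" by (simp add: power2_eq_square right_diff_distrib)
  have "b powr q + q * (b powr (q - 2) * (z \<bullet> w)) \<le> b powr q + q * (b powr (q - 2) * (b * (a - b)))"
    using zw assms by (intro add_left_mono mult_left_mono) auto
  also have "b powr (q - 2) * (b * (a - b)) = b powr (q - 1) * (a - b)"
  proof -
    have "b powr (q - 2) * b powr 1 = b powr (q - 1)" by (subst powr_add[symmetric]) simp
    then show ?thesis using b by (simp add: mult.assoc[symmetric])
  qed
  also have "b powr q + q * (b powr (q - 1) * (a - b)) \<le> a powr q"
  proof -
    define r where "r = (a / b) powr q"
    have r0: "0 \<le> r" by (simp add: r_def)
    have "r powr (1 / q) \<le> 1 + (1 / q) * (r - 1)"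
      using assms by (intro Bernoulli_powr r0) auto
    moreover have "r powr (1 / q) = a / b" using assms a b by (simp add: r_def powr_powr)
    ultimately have "a / b \<le> 1 + (1 / q) * (r - 1)" by simp
    then have "q * (a / b - 1) \<le> q * ((1 / q) * (r - 1))" using assms by (intro mult_left_mono) auto
    then have "q * (a / b - 1) \<le> r - 1" using assms by simp
    then have "b powr q * (q * (a / b - 1)) \<le> b powr q * (r - 1)" by (rule mult_left_mono) simp
    moreover have "b powr q * r = a powr q" using a b by (simp add: r_def powr_divide)
    moreover have "b powr q * (q * (a / b - 1)) = q * (b powr (q - 1) * (a - b))"
    proof -
      have "b powr q = b powr (q - 1) * b" using b by (simp add: powr_diff)
      then show ?thesis using b by (simp add: field_simps)
    qed
    ultimately show ?thesis by (simp add: right_diff_distrib)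
  qed
  finally show ?thesis by (simp add: a_def b_def)
qed

lemma Re_integral_mult_cnj:
  assumes "f \<in> L2" "g \<in> L2"
  shows "Re (\<integral>x. f x * cnj (g x) \<partial>halfline) = (\<integral>x. f x \<bullet> g x \<partial>halfline)"
proof -
  have "Re (\<integral>x. f x * cnj (g x) \<partial>halfline) = (\<integral>x. Re (f x * cnj (g x)) \<partial>halfline)"
    by (rule integral_Re[OF L2_mult_integrable[OF assms(1) L2_cnj[OF assms(2)]], symmetric])
  then show ?thesis by (simp add: inner_complex_def)
qed

lemma deriv_pairing_AE:
  assumes "u \<in> H10" "w \<in> H10" "AE x in halfline. wderiv w x = f x" "f \<in> L2"
  shows "deriv_pairing (wderiv u) w = - (\<integral>x. wderiv u x * f x \<partial>halfline)"
proof -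
  have "(\<integral>x. wderiv u x * wderiv w x \<partial>halfline) = (\<integral>x. wderiv u x * f x \<partial>halfline)"
  proof (rule integral_cong_AE)
    show "AE x in halfline. wderiv u x * wderiv w x = wderiv u x * f x"
      using assms(3) by eventually_elim simp
  qed (intro borel_measurable_times L2_D(1) H10_L2(2) assms)+
  then show ?thesis by (simp add: deriv_pairing_def)
qed

section \<open>First variation of the quadratic form and of the power term\<close>

context hardy_nls
begin

text \<open>The real symmetric bilinear form whose diagonal is \<open>Q\<close>.\<close>

definition "Bform u v = (\<integral>x. wderiv u x \<bullet> wderiv v x \<partial>halfline)
   - c * (\<integral>x. (u x / of_real x) \<bullet> (v x / of_real x) \<partial>halfline) + \<omega> * (\<integral>x. u x \<bullet> v x \<partial>halfline)"

text \<open>The directional derivative of \<open>P\<close> at \<open>u\<close> along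
  \<open>v\<close>, divided by \<open>p + 1\<close>.\<close>

definition "Lform u v = (\<integral>x. cmod (u x) powr (p - 1) * (u x \<bullet> v x) \<partial>halfline)"

text \<open>The left-hand side of the equation as a functional: \<open>solves_in_Hm1\<close> says
  that it vanishes on \<open>H10\<close>.\<close>

definition "residual u w = deriv_pairing (wderiv u) w
     + pairing (\<lambda>x. complex_of_real (c / x\<^sup>2) * u x) w
     - complex_of_real \<omega> * pairing u w
     + pairing (\<lambda>x. complex_of_real (cmod (u x) powr (p - 1)) * u x) w"

lemma nonlinearity_L2:
  assumes "u \<in> H10"
  shows "(\<lambda>x. complex_of_real (cmod (u x) powr (p - 1)) * u x) \<in> L2"
proof -
  obtain B where B: "0 < B" "AE x in halfline. cmod (u x) \<le> B" by (rule H10_bound[OF assms])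
  note [measurable] = L2_D(1)[OF H10_L2(1)[OF assms]]
  show ?thesis
  proof (rule L2_dominated[OF H10_L2(1)[OF assms]])
    show "(\<lambda>x. complex_of_real (cmod (u x) powr (p - 1)) * u x) \<in> borel_measurable halfline" by measurable
    show "AE x in halfline. cmod (complex_of_real (cmod (u x) powr (p - 1)) * u x) \<le> B powr (p - 1) * cmod (u x)"
      using B(2)
    proof eventually_elim
      case (elim x)
      then have "cmod (u x) powr (p - 1) \<le> B powr (p - 1)" using p_gt by (intro powr_mono2) auto
      then show ?case by (simp add: norm_mult mult_right_mono)
    qed
  qed
qed

lemma potential_pairing:
  "pairing (\<lambda>x. complex_of_real (c / x\<^sup>2) * u x) w = of_real c * (\<integral>x. (u x / of_real x) * (w x / of_real x) \<partial>halfline)"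
proof -
  have "pairing (\<lambda>x. complex_of_real (c / x\<^sup>2) * u x) w = (\<integral>x. of_real c * ((u x / of_real x) * (w x / of_real x)) \<partial>halfline)"
    unfolding pairing_def by (intro Bochner_Integration.integral_cong) (auto simp: power2_eq_square)
  also have "\<dots> = of_real c * (\<integral>x. (u x / of_real x) * (w x / of_real x) \<partial>halfline)"
    by (rule integral_mult_right_zero)
  finally show ?thesis .
qed

text \<open>The pairings carry no conjugation, so testing with \<open>cnj v\<close> turns their real
  parts into real inner products, which is the form in which variations of \<open>Q\<close> and
  \<open>P\<close> appear.\<close>

lemma residual_cnj:
  assumes u: "u \<in> H10" and v: "v \<in> H10"
  shows "Re (residual u (\<lambda>x. cnj (v x))) = Lform u v - Bform u v"
proof -
  note Lu = H10_L2[OF u] and Lv = H10_L2[OF v]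
  have 1: "Re (deriv_pairing (wderiv u) (\<lambda>x. cnj (v x))) = - (\<integral>x. wderiv u x \<bullet> wderiv v x \<partial>halfline)"
    unfolding deriv_pairing_AE[OF u H10_cnj[OF v] wderiv_cnj[OF v] L2_cnj[OF Lv(2)]]
    using Re_integral_mult_cnj[OF Lu(2) Lv(2)] by simp
  have 2: "Re (pairing (\<lambda>x. complex_of_real (c / x\<^sup>2) * u x) (\<lambda>x. cnj (v x))) = c * (\<integral>x. (u x / of_real x) \<bullet> (v x / of_real x) \<partial>halfline)"
    unfolding potential_pairing
    using Re_integral_mult_cnj[OF H10_Hardy(1)[OF u] H10_Hardy(1)[OF v]] by simp
  have 3: "Re (complex_of_real \<omega> * pairing u (\<lambda>x. cnj (v x))) = \<omega> * (\<integral>x. u x \<bullet> v x \<partial>halfline)"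
    unfolding pairing_def using Re_integral_mult_cnj[OF Lu(1) Lv(1)] by simp
  have 4: "Re (pairing (\<lambda>x. complex_of_real (cmod (u x) powr (p - 1)) * u x) (\<lambda>x. cnj (v x))) = Lform u v"
  proof -
    have "Re (pairing (\<lambda>x. complex_of_real (cmod (u x) powr (p - 1)) * u x) (\<lambda>x. cnj (v x)))
       = (\<integral>x. (complex_of_real (cmod (u x) powr (p - 1)) * u x) \<bullet> v x \<partial>halfline)"
      unfolding pairing_def by (rule Re_integral_mult_cnj[OF nonlinearity_L2[OF u] Lv(1)])
    then show ?thesis
      unfolding Lform_def by (simp only: scaleR_conv_of_real[symmetric] inner_scaleR_left)
  qed
  show ?thesis
    unfolding residual_def Bform_def plus_complex.sel minus_complex.sel 1 2 3 4 by simp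
qed

text \<open>Variations give only the real part of the equation; testing with \<open>\<i> * w\<close>
  recovers the imaginary part.\<close>

lemma residual_imaginary_unit:
  assumes u: "u \<in> H10" and w: "w \<in> H10"
  shows "residual u (\<lambda>x. \<i> * w x) = \<i> * residual u w"
proof -
  note Lu = H10_L2[OF u] and Lw = H10_L2[OF w]
  have 1: "deriv_pairing (wderiv u) (\<lambda>x. \<i> * w x) = \<i> * deriv_pairing (wderiv u) w"
  proof -
    have "deriv_pairing (wderiv u) (\<lambda>x. \<i> * w x) = - (\<integral>x. wderiv u x * (\<i> * wderiv w x) \<partial>halfline)"
      by (rule deriv_pairing_AE[OF u H10_scale[OF w] wderiv_scale[OF w] L2_scale[OF Lw(2)]])
    also have "\<dots> = \<i> * deriv_pairing (wderiv u) w"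
      unfolding deriv_pairing_def mult.left_commute[of _ \<i>] by simp
    finally show ?thesis .
  qed
  have 2: "pairing f (\<lambda>x. \<i> * w x) = \<i> * pairing f w" for f
    unfolding pairing_def mult.left_commute[of _ \<i>] by simp
  show ?thesis unfolding residual_def 1 2 by (simp add: algebra_simps)
qed

lemma Bform_self: "u \<in> H10 \<Longrightarrow> Bform u u = Q u"
  by (simp add: Bform_def Q_def H_fun_eq sqi_def power2_norm_eq_inner)

lemma Lform_self: "Lform u u = P u"
proof -
  have "cmod (u x) powr (p - 1) * (u x \<bullet> u x) = cmod (u x) powr (p + 1)" for x
    using powr_split_sq[of "cmod (u x)" "p + 1"] p_gt by (simp add: power2_norm_eq_inner mult.commute)
  then show ?thesis by (simp only: Lform_def pint_def)
qed

lemma Q_combination: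
  assumes "u \<in> H10" "v \<in> H10"
  shows "Q (\<lambda>x. u x + of_real t * v x) = Q u + 2 * t * Bform u v + t\<^sup>2 * Q v"
proof -
  note Lu = H10_L2[OF assms(1)] and Lv = H10_L2[OF assms(2)]
  have tv: "(\<lambda>x. of_real t * v x) \<in> H10" by (rule H10_scale[OF assms(2)])
  have w: "(\<lambda>x. u x + of_real t * v x) \<in> H10" by (rule H10_add[OF assms(1) tv])
  have "AE x in halfline. wderiv (\<lambda>x. u x + of_real t * v x) x = wderiv u x + of_real t * wderiv v x"
    using wderiv_add[OF assms(1) tv] wderiv_scale[OF assms(2), of "of_real t"] by eventually_elim simp
  then have 1: "sqi (wderiv (\<lambda>x. u x + of_real t * v x)) = sqi (\<lambda>x. wderiv u x + of_real t * wderiv v x)"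
    by (rule sqi_wderiv_cong[OF w]) (intro L2_D(1) L2_add L2_scale Lu Lv)
  have 2: "sqi (\<lambda>x. (u x + of_real t * v x) / of_real x) = sqi (\<lambda>x. u x / of_real x + of_real t * (v x / of_real x))"
    by (simp add: add_divide_distrib)
  show ?thesis
    unfolding Q_def H_fun_eq[OF w] H_fun_eq[OF assms(1)] H_fun_eq[OF assms(2)] 1 2
      sqi_combination[OF Lu(2) Lv(2)] sqi_combination[OF Lu(1) Lv(1)]
      sqi_combination[OF H10_Hardy(1)[OF assms(1)] H10_Hardy(1)[OF assms(2)]] Bform_def
    by (simp add: algebra_simps)
qed

text \<open>A one-sided bound suffices for the Euler--Lagrange equation, since \<open>P\<close>
  enters only through the lower bound \<open>Iinf * P powr \<theta> \<le> Q\<close>; convexity thus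
  replaces differentiation of \<open>P\<close> under the integral.\<close>

lemma P_tangent:
  assumes "u \<in> H10" "v \<in> H10"
  shows "P u + t * ((p + 1) * Lform u v) \<le> P (\<lambda>x. u x + of_real t * v x)"
proof -
  note Lu = H10_L2[OF assms(1)] and Lv = H10_L2[OF assms(2)]
  have w: "(\<lambda>x. u x + of_real t * v x) \<in> H10" by (intro H10_add H10_scale assms)
  have q: "2 \<le> p + 1" using p_gt by simp
  have i: "integrable halfline (\<lambda>x. cmod (u x) powr (p - 1) * (u x \<bullet> v x))"
    using L2_inner_integrable[OF nonlinearity_L2[OF assms(1)] Lv(1)]
    by (simp only: scaleR_conv_of_real[symmetric] inner_scaleR_left)
  have iu: "integrable halfline (\<lambda>x. cmod (u x) powr (p + 1))" by (rule H10_pint_integrable[OF assms(1) q])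
  have it: "integrable halfline (\<lambda>x. t * (p + 1) * (cmod (u x) powr (p - 1) * (u x \<bullet> v x)))"
    by (rule integrable_mult_right[OF i])
  have "P u + t * ((p + 1) * Lform u v) = P u + (\<integral>x. t * (p + 1) * (cmod (u x) powr (p - 1) * (u x \<bullet> v x)) \<partial>halfline)"
    unfolding Lform_def integral_mult_right_zero by simp
  also have "\<dots> = (\<integral>x. cmod (u x) powr (p + 1) + t * (p + 1) * (cmod (u x) powr (p - 1) * (u x \<bullet> v x)) \<partial>halfline)"
    unfolding pint_def by (rule Bochner_Integration.integral_add[OF iu it, symmetric])
  also have "\<dots> \<le> P (\<lambda>x. u x + of_real t * v x)"
    unfolding pint_def
  proof (rule integral_mono[OF Bochner_Integration.integrable_add[OF iu it] H10_pint_integrable[OF w q]])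
    fix x
    have "u x \<bullet> (of_real t * v x) = t * (u x \<bullet> v x)"
      by (simp flip: scaleR_conv_of_real)
    then show "cmod (u x) powr (p + 1) + t * (p + 1) * (cmod (u x) powr (p - 1) * (u x \<bullet> v x))
       \<le> cmod (u x + of_real t * v x) powr (p + 1)"
      using tangent_powr[OF q, of "u x" "of_real t * v x"] by (simp add: mult_ac)
  qed
  finally show ?thesis .
qed

section \<open>Minimizers on the Nehari manifold and ground states\<close>

text \<open>The least value of \<open>P\<close> on the Nehari manifold \<open>Q = P\<close>.\<close>

definition "P0 = Iinf powr ((p + 1) / (p - 1))"

lemma P0_pos: "0 < P0" using Iinf_pos by (simp add: P0_def)

lemma one_minus_theta: "1 - \<theta> = (p - 1) / (p + 1)"
  using p_gt by (simp add: \<theta>_def field_simps)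

lemma powr_one_minus_theta:
  assumes "0 < z"
  shows "(z powr (1 - \<theta>)) powr ((p + 1) / (p - 1)) = z"
  using assms p_gt by (simp add: powr_powr one_minus_theta)

text \<open>\<open>P0\<close> is the positive value at which
  \<open>Q = Iinf * P powr \<theta>\<close> and \<open>Q = P\<close> hold together.\<close>

lemma P0_fixed: "Iinf * P0 powr \<theta> = P0"
proof -
  have "P0 powr (1 - \<theta>) = Iinf"
    using Iinf_pos p_gt by (simp add: P0_def powr_powr one_minus_theta)
  then have "Iinf * P0 powr \<theta> = P0 powr (1 - \<theta>) * P0 powr \<theta>" by simp
  also have "\<dots> = P0" using P0_pos by (simp flip: powr_add)
  finally show ?thesis .
qed

lemma nehari_ge:
  assumes "v \<in> H10_nonzero" "Q v = P v"
  shows "P0 \<le> P v"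
proof -
  have v: "v \<in> H10" using assms(1) by (simp add: H10_nonzero_def)
  have pos: "0 < P v" by (rule nonzero_pos(3)[OF assms(1)])
  have "Iinf * P v powr \<theta> \<le> P v powr (1 - \<theta>) * P v powr \<theta>"
    using Iinf_le_H10[OF v] assms(2) pos by (simp flip: powr_add)
  then have "Iinf \<le> P v powr (1 - \<theta>)" using pos by simp
  then have "P0 \<le> (P v powr (1 - \<theta>)) powr ((p + 1) / (p - 1))"
    unfolding P0_def using Iinf_pos p_gt by (intro powr_mono2) auto
  then show ?thesis using powr_one_minus_theta[OF pos] by simp
qed

definition "nehari_minimizer u \<longleftrightarrow> u \<in> H10_nonzero \<and> Q u = P0 \<and> P u = P0"

lemma nehari_minimizer_exists: "\<exists>u. nehari_minimizer u"
proof -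
  obtain u where u: "u \<in> H10" "P u = 1" "Q u = Iinf" by (rule exists_minimizer)
  \<comment> \<open>\<open>a powr (p - 1) = Iinf\<close> makes \<open>a^2 * Iinf\<close>, the new
    \<open>Q\<close>, agree with \<open>a powr (p + 1)\<close>, the new \<open>P\<close>.\<close>
  define a where "a = Iinf powr (1 / (p - 1))"
  have a: "0 < a" using Iinf_pos by (simp add: a_def)
  have 1: "a powr (p + 1) = P0" by (simp add: a_def P0_def powr_powr)
  have "a\<^sup>2 * Iinf = Iinf powr (2 / (p - 1)) * Iinf powr 1"
  proof -
    have "a\<^sup>2 = a powr 2" using a by simp
    also have "\<dots> = Iinf powr (2 / (p - 1))" by (simp add: a_def powr_powr)
    finally show ?thesis using Iinf_pos by simp
  qed
  also have "\<dots> = Iinf powr (2 / (p - 1) + 1)" by (rule powr_add[symmetric])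
  also have "2 / (p - 1) + 1 = (p + 1) / (p - 1)" using p_gt by (simp add: field_simps)
  finally have 2: "a\<^sup>2 * Iinf = P0" by (simp add: P0_def)
  let ?v = "\<lambda>x. of_real a * u x"
  have v: "?v \<in> H10" by (rule H10_scale[OF u(1)])
  have P: "P ?v = P0" using P_scale[OF u(1), of "of_real a"] u a 1 by simp
  have "Q ?v = P0" using Q_scale[OF u(1), of "of_real a"] u 2 by simp
  moreover have "?v \<in> H10_nonzero" by (rule P_pos_nonzero[OF v]) (use P P0_pos in simp)
  ultimately show ?thesis using P unfolding nehari_minimizer_def by blast
qed

lemma S_eq: "u \<in> H10 \<Longrightarrow> S_fun c \<omega> p u = 1 / 2 * Q u - 1 / (p + 1) * P u"
  using p_gt by (simp add: S_fun_def Q_def Lnorm_2 Lnorm_powr algebra_simps)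

lemma J_eq: "u \<in> H10 \<Longrightarrow> J_fun c \<omega> p u = Q u - P u"
  using p_gt by (simp add: J_fun_def Q_def Lnorm_2 Lnorm_powr)

text \<open>On the constraint \<open>J = 0\<close> the action is a fixed positive multiple of
  \<open>P\<close>, so minimizing it means reaching the value \<open>P0\<close>.\<close>

lemma m_inf_eq: "m_inf c \<omega> p = (1 / 2 - 1 / (p + 1)) * P0"
proof -
  have S: "S_fun c \<omega> p u = (1 / 2 - 1 / (p + 1)) * P u" if "u \<in> H10_nonzero" "J_fun c \<omega> p u = 0" for u
    using that S_eq[of u] J_eq[of u] by (simp add: H10_nonzero_def left_diff_distrib)
  have k: "0 \<le> 1 / 2 - 1 / (p + 1)" using p_gt by (simp add: field_simps)
  obtain u where u: "nehari_minimizer u" using nehari_minimizer_exists by blast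
  have u': "u \<in> H10_nonzero" "J_fun c \<omega> p u = 0" "P u = P0"
    using u J_eq[of u] by (auto simp: nehari_minimizer_def H10_nonzero_def)
  show ?thesis
    unfolding m_inf_def
  proof (rule cInf_eq_minimum)
    show "(1 / 2 - 1 / (p + 1)) * P0 \<in> S_fun c \<omega> p ` {u \<in> H10_nonzero. J_fun c \<omega> p u = 0}"
      using S[OF u'(1,2)] u' by (intro image_eqI[of _ _ u]) auto
    fix s assume "s \<in> S_fun c \<omega> p ` {u \<in> H10_nonzero. J_fun c \<omega> p u = 0}"
    then obtain v where v: "v \<in> H10_nonzero" "J_fun c \<omega> p v = 0" "s = S_fun c \<omega> p v" by auto
    have "P0 \<le> P v" using nehari_ge[OF v(1)] v J_eq[of v] by (simp add: H10_nonzero_def)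
    then show "(1 / 2 - 1 / (p + 1)) * P0 \<le> s"
      unfolding v(3) S[OF v(1,2)] using k by (rule mult_left_mono)
  qed
qed

text \<open>Along \<open>u + t v\<close> the function \<open>Q - Iinf * P powr \<theta>\<close> is
  nonnegative and vanishes at \<open>t = 0\<close>. Replacing \<open>P\<close> by its tangent only
  enlarges it and keeps the value at \<open>0\<close>, but makes it explicitly
  differentiable.\<close>

lemma Bform_eq_Lform:
  assumes "nehari_minimizer u" "v \<in> H10"
  shows "Bform u v = Lform u v"
proof -
  have u: "u \<in> H10" "Q u = P0" "P u = P0" using assms(1) by (auto simp: nehari_minimizer_def H10_nonzero_def)
  define l where "l = (p + 1) * Lform u v"
  \<comment> \<open>\<open>P0 + t * l\<close> is the tangent from \<open>P_tangent\<close>; it is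
    positive near \<open>t = 0\<close>, so that the power can be compared and differentiated
    there.\<close>
  define f where "f t = P0 + 2 * t * Bform u v + t\<^sup>2 * Q v - Iinf * (P0 + t * l) powr \<theta>" for t
  have f0: "f 0 = 0" using P0_fixed by (simp add: f_def)
  have d: "(f has_real_derivative 2 * Bform u v - Iinf * (\<theta> * P0 powr (\<theta> - 1) * l)) (at 0)"
  proof -
    have pw: "((\<lambda>t. (P0 + t * l) powr \<theta>) has_real_derivative (\<theta> * (P0 + 0 * l) powr (\<theta> - 1)) * l) (at 0)"
      by (rule DERIV_chain2[where f="\<lambda>y. y powr \<theta>"])
        (use P0_pos in \<open>auto intro!: has_real_derivative_powr derivative_eq_intros\<close>)
    show ?thesis
      unfolding f_def[abs_def]
      by (rule derivative_eq_intros pw refl)+ simp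
  qed
  have lim: "((\<lambda>t. P0 + t * l) \<longlongrightarrow> P0 + 0 * l) (nhds 0)"
    by (intro tendsto_intros filterlim_ident)
  have "\<forall>\<^sub>F t in nhds 0. 0 < P0 + t * l"
    by (rule order_tendstoD(1)[OF lim]) (use P0_pos in simp)
  then obtain e where e: "0 < e" "\<And>t. \<bar>t\<bar> < e \<Longrightarrow> 0 < P0 + t * l"
    unfolding eventually_nhds_metric by (auto simp: dist_real_def)
  have "f 0 \<le> f t" if "\<bar>0 - t\<bar> < e" for t
  proof -
    have w: "(\<lambda>x. u x + of_real t * v x) \<in> H10" by (intro H10_add H10_scale u assms)
    have "(P0 + t * l) powr \<theta> \<le> P (\<lambda>x. u x + of_real t * v x) powr \<theta>"
      using P_tangent[OF u(1) assms(2), of t] e(2)[of t] that u theta by (intro powr_mono2) (auto simp: l_def)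
    then have "Iinf * (P0 + t * l) powr \<theta> \<le> Iinf * P (\<lambda>x. u x + of_real t * v x) powr \<theta>"
      using Iinf_pos by (intro mult_left_mono) auto
    also have "\<dots> \<le> Q (\<lambda>x. u x + of_real t * v x)" by (rule Iinf_le_H10[OF w])
    also have "\<dots> = P0 + 2 * t * Bform u v + t\<^sup>2 * Q v" unfolding Q_combination[OF u(1) assms(2)] u(2) ..
    finally show ?thesis unfolding f0 by (simp add: f_def)
  qed
  with DERIV_local_min[OF d e(1)] have z: "2 * Bform u v - Iinf * (\<theta> * P0 powr (\<theta> - 1) * l) = 0" by blast
  have "Iinf * P0 powr (\<theta> - 1) = 1"
    using P0_fixed P0_pos by (simp add: powr_diff)
  moreover have "\<theta> * l = 2 * Lform u v"
    using p1_theta by (simp add: l_def mult.assoc[symmetric] mult.commute[of \<theta>])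
  ultimately have "Iinf * (\<theta> * P0 powr (\<theta> - 1) * l) = 2 * Lform u v"
    by (metis (no_types, opaque_lifting) mult.assoc mult.commute mult.right_neutral)
  then show ?thesis using z by simp
qed

lemma nehari_minimizer_solution:
  assumes "nehari_minimizer u"
  shows "u \<in> solution_set c \<omega> p"
proof -
  have u: "u \<in> H10" "u \<in> H10_nonzero" using assms by (auto simp: nehari_minimizer_def H10_nonzero_def)
  have Re0: "Re (residual u w) = 0" if "w \<in> H10" for w
    using residual_cnj[OF u(1) H10_cnj[OF that]] Bform_eq_Lform[OF assms H10_cnj[OF that]] by simp
  have "residual u w = 0" if w: "w \<in> H10" for w
  proof (rule complex_eqI)
    show "Re (residual u w) = Re 0" using Re0[OF w] by simp
    have "Re (\<i> * residual u w) = 0" using Re0[OF H10_scale[OF w, of \<i>]] residual_imaginary_unit[OF u(1) w] by simp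
    then show "Im (residual u w) = Im 0" by simp
  qed
  then have "solves_in_Hm1 c \<omega> p u" unfolding solves_in_Hm1_def residual_def by blast
  then show ?thesis using u by (simp add: solution_set_def)
qed

text \<open>Testing the equation with the conjugate of the solution itself.\<close>

lemma solution_nehari:
  assumes "u \<in> solution_set c \<omega> p"
  shows "Q u = P u"
proof -
  have u: "u \<in> H10" "solves_in_Hm1 c \<omega> p u" using assms by (auto simp: solution_set_def H10_nonzero_def)
  have "residual u (\<lambda>x. cnj (u x)) = 0"
    using u(2) H10_cnj[OF u(1)] unfolding solves_in_Hm1_def residual_def by blast
  then show ?thesis using residual_cnj[OF u(1) u(1)] by (simp add: Bform_self[OF u(1)] Lform_self)
qed

text \<open>Every solution satisfies \<open>Q = P\<close>, so its action is the same positive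
  multiple of \<open>P\<close> and \<open>P0 \<le> P\<close>. Since a Nehari minimizer exists and is
  itself a solution, the least action among solutions is the Nehari value.\<close>

lemma ground_state_iff: "u \<in> ground_states c \<omega> p \<longleftrightarrow> nehari_minimizer u"
proof -
  have k: "0 < 1 / 2 - 1 / (p + 1)" using p_gt by (simp add: field_simps)
  have S: "S_fun c \<omega> p v = (1 / 2 - 1 / (p + 1)) * P v" if "v \<in> solution_set c \<omega> p" for v
    using that S_eq[of v] solution_nehari[OF that] by (simp add: solution_set_def H10_nonzero_def left_diff_distrib)
  have ge: "P0 \<le> P v" if "v \<in> solution_set c \<omega> p" for v
    using nehari_ge[of v] solution_nehari[OF that] that by (simp add: solution_set_def)
  show ?thesis
  proof
    assume u: "u \<in> ground_states c \<omega> p"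
    then have us: "u \<in> solution_set c \<omega> p" by (simp add: ground_states_def)
    obtain v where v: "nehari_minimizer v" using nehari_minimizer_exists by blast
    have vs: "v \<in> solution_set c \<omega> p" by (rule nehari_minimizer_solution[OF v])
    have "S_fun c \<omega> p u \<le> S_fun c \<omega> p v" using u vs by (simp add: ground_states_def)
    then have "P u \<le> P v" unfolding S[OF us] S[OF vs] using k by simp
    then have "P u = P0" using ge[OF us] v by (simp add: nehari_minimizer_def)
    then show "nehari_minimizer u"
      using us solution_nehari[OF us] by (simp add: nehari_minimizer_def solution_set_def)
  next
    assume u: "nehari_minimizer u"
    have us: "u \<in> solution_set c \<omega> p" by (rule nehari_minimizer_solution[OF u])
    have "S_fun c \<omega> p u \<le> S_fun c \<omega> p v" if "v \<in> solution_set c \<omega> p" for v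
      unfolding S[OF us] S[OF that] using u ge[OF that] k
      by (intro mult_left_mono) (auto simp: nehari_minimizer_def)
    then show "u \<in> ground_states c \<omega> p" using us by (simp add: ground_states_def)
  qed
qed

section \<open>Minimization at fixed mass\<close>

text \<open>By \<open>m_inf_eq\<close> this is \<open>m_inf c \<omega> p\<close> in closed form, and
  \<open>mass\<close> is then the prescribed value \<open>\<mu>\<close>.\<close>

definition "m = (1 / 2 - 1 / (p + 1)) * P0"
definition "mass = m / \<omega> * ((p + 3) / (p - 1))"

lemma m_pos: "0 < m" using p_gt P0_pos by (simp add: m_def field_simps)

lemma mass_pos: "0 < mass" using m_pos p_gt omega by (simp add: mass_def)

lemma p_identities:
  "m = (p - 1) / (2 * (p + 1)) * P0" "\<omega> * mass = (p + 3) / (2 * (p + 1)) * P0" "m + \<omega> * mass = P0"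
proof -
  show 1: "m = (p - 1) / (2 * (p + 1)) * P0" using p_gt by (simp add: m_def field_simps)
  show 2: "\<omega> * mass = (p + 3) / (2 * (p + 1)) * P0"
    using p_gt omega by (simp add: mass_def 1)
  have "p - 1 + (p + 3) = 2 * (p + 1)" by simp
  then show "m + \<omega> * mass = P0"
    unfolding 1 2 distrib_right[symmetric] add_divide_distrib[symmetric] using p_gt by simp
qed

lemma dilated_bound:
  assumes "u \<in> H10" "0 < l"
  shows "Iinf * (P u / l) powr \<theta> \<le> l * H_fun c u + \<omega> * sqi u / l"
proof -
  have "Q (\<lambda>x. u (l * x)) = l * H_fun c u + \<omega> * sqi u / l"
    unfolding Q_def dilate_identities(1)[OF assms] dilate_identities(3)[OF assms] by simp
  moreover have "P (\<lambda>x. u (l * x)) = P u / l"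
    using p_gt by (intro dilate_identities(2)[OF assms]) simp
  ultimately show ?thesis using Iinf_le_H10[OF H10_dilate[OF assms]] by simp
qed

text \<open>A Pohozaev identity: the minimizer is critical along the dilations \<open>u(l x)\<close>.\<close>

lemma nehari_minimizer_mass:
  assumes "nehari_minimizer u"
  shows "sqi u = mass"
proof -
  have u: "u \<in> H10" "Q u = P0" "P u = P0" using assms by (auto simp: nehari_minimizer_def H10_nonzero_def)
  define H where "H = H_fun c u"
  define N where "N = sqi u"
  have HN: "H + \<omega> * N = P0" using u(2) by (simp add: Q_def H_def N_def)
  define f where "f l = l * H + \<omega> * N / l - P0 * l powr (- \<theta>)" for l
  have f1: "f 1 = 0" using HN by (simp add: f_def)
  have fge: "0 \<le> f l" if "0 < l" for l
  proof -
    have "Iinf * (P0 / l) powr \<theta> = P0 * l powr (- \<theta>)"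
    proof -
      have "Iinf * (P0 / l) powr \<theta> = (Iinf * P0 powr \<theta>) * l powr (- \<theta>)"
        using that P0_pos by (simp add: powr_divide powr_minus_divide)
      then show ?thesis by (simp add: P0_fixed)
    qed
    then show ?thesis using dilated_bound[OF u(1) that] by (simp add: f_def u(3) H_def N_def)
  qed
  have d: "(f has_real_derivative H - \<omega> * N + \<theta> * P0) (at 1)"
    unfolding f_def[abs_def]
    by (auto intro!: derivative_eq_intros has_real_derivative_powr simp: algebra_simps)
  have "H - \<omega> * N + \<theta> * P0 = 0"
    by (rule DERIV_local_min[OF d zero_less_one]) (use fge f1 in auto)
  then have "2 * (\<omega> * N) = (1 + \<theta>) * P0" using HN by (simp add: algebra_simps)
  moreover have "1 + \<theta> = (p + 3) / (p + 1)" using p_gt by (simp add: \<theta>_def field_simps)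
  ultimately have "\<omega> * N = \<omega> * mass" using p_gt by (simp add: p_identities(2) field_simps)
  then show ?thesis using omega by (simp add: N_def)
qed

text \<open>With mass prescribed, the only free quantity besides \<open>P\<close> is
  \<open>H = m * s\<close>. The inequality for a suitably dilated \<open>u\<close> bounds
  \<open>P u\<close> by \<open>P0 * s powr t\<close>, while \<open>S \<ge> m\<close> asks only for
  the larger affine bound \<open>P0 * (1 + t * (s - 1))\<close>.\<close>

lemma fixed_mass_bound:
  assumes u: "u \<in> H10" "sqi u = mass"
  shows "m \<le> S_fun c \<omega> p u" "S_fun c \<omega> p u = m \<Longrightarrow> nehari_minimizer u"
proof -
  have nz: "u \<in> H10_nonzero"
  proof -
    have "\<not> (AE x in halfline. u x = 0)"
    proof
      assume "AE x in halfline. u x = 0"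
      then have "AE x in halfline. (cmod (u x))\<^sup>2 = 0" by eventually_elim simp
      then have "sqi u = 0" unfolding sqi_def by (rule integral_eq_zero_AE)
      then show False using u(2) mass_pos by simp
    qed
    then show ?thesis using u by (simp add: H10_nonzero_def)
  qed
  note pos = nonzero_pos[OF nz]
  define H where "H = H_fun c u"
  have H: "0 < H" using pos(1) by (simp add: H_def)
  define s where "s = H / m"
  have s: "0 < s" "H = m * s" using H m_pos by (auto simp: s_def)
  define t where "t = (p - 1) / 4"
  \<comment> \<open>\<open>t < 1\<close> is the condition \<open>p < 5\<close>, under which
    Bernoulli's inequality applies and is strict away from \<open>s = 1\<close>.\<close>
  have t: "0 < t" "t < 1" using p_gt p_less by (auto simp: t_def)
  \<comment> \<open>The dilation with \<open>l * H = m / l\<close>: the dilated function then has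
    the same ratio of \<open>H\<close> to \<open>\<omega>\<close> times the mass as a minimizer, so
    its \<open>Q\<close> is \<open>P0 / l\<close>.\<close>
  define l where "l = s powr (- (1 / 2))"
  have l: "0 < l" using s by (simp add: l_def)
  have l2: "l * H = m / l"
  proof -
    have "l * l = s powr (- 1)" unfolding l_def by (simp flip: powr_add)
    then have "l * l * s = 1" using s by (simp add: powr_minus_divide)
    then show ?thesis using l s by (simp add: field_simps)
  qed
  have "Iinf * (P u / l) powr \<theta> \<le> P0 / l"
    using dilated_bound[OF u(1) l] unfolding H_def[symmetric] l2 u(2)
    by (simp add: p_identities(3)[symmetric] add_divide_distrib)
  also have "P0 / l = Iinf * P0 powr \<theta> / l" by (simp add: P0_fixed)
  finally have "Iinf * (P u / l) powr \<theta> \<le> Iinf * (P0 powr \<theta> / l)" by simp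
  then have "(P u / l) powr \<theta> \<le> P0 powr \<theta> / l"
    using mult_le_cancel_left_pos[OF Iinf_pos] by blast
  then have "((P u / l) powr \<theta>) powr (1 / \<theta>) \<le> (P0 powr \<theta> / l) powr (1 / \<theta>)"
    using theta by (intro powr_mono2) auto
  then have "P u / l \<le> P0 / l powr (1 / \<theta>)"
    using theta pos l P0_pos by (simp add: powr_powr powr_divide)
  then have "P u \<le> P0 * (l / l powr (1 / \<theta>))" using l by (simp add: field_simps)
  also have "l / l powr (1 / \<theta>) = l powr (1 - 1 / \<theta>)" using l by (simp add: powr_diff)
  \<comment> \<open>Substituting \<open>l = s powr (- 1/2)\<close>, the exponent becomes
    \<open>(1 / \<theta> - 1) / 2 = (p - 1) / 4\<close>.\<close>
  also have "\<dots> = s powr t"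
  proof -
    have "- (1 / 2) * (1 - 1 / \<theta>) = t" using p_gt by (simp add: \<theta>_def t_def field_simps)
    then show ?thesis unfolding l_def powr_powr by simp
  qed
  finally have P1: "P u \<le> P0 * s powr t" .
  have P2: "P0 * s powr t \<le> P0 * (1 + t * (s - 1))"
    using P0_pos s t by (intro mult_left_mono Bernoulli_powr) auto
  \<comment> \<open>The action at fixed mass is \<open>m\<close> plus a multiple of the gap between
    the tangent line and \<open>P u\<close>; the slope fits because
    \<open>P0 * t / (p + 1) = m / 2\<close>.\<close>
  have S: "S_fun c \<omega> p u = m + 1 / (p + 1) * (P0 * (1 + t * (s - 1)) - P u)"
  proof -
    have "S_fun c \<omega> p u = 1 / 2 * (m * s + \<omega> * mass) - 1 / (p + 1) * P u"
      unfolding S_eq[OF u(1)] Q_def u(2) H_def[symmetric] s(2) ..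
    moreover have "1 / 2 * (m * s + \<omega> * mass) = m + 1 / (p + 1) * (P0 * (1 + t * (s - 1)))"
    proof -
      have 1: "1 / (p + 1) * (P0 * t) = m / 2" using p_gt by (simp add: p_identities(1) t_def field_simps)
      have "1 / (p + 1) * (P0 * (1 + t * (s - 1))) = 1 / (p + 1) * P0 + 1 / (p + 1) * (P0 * t) * (s - 1)"
        by (simp only: distrib_left mult.assoc mult_1_right)
      also have "\<dots> = 1 / (p + 1) * P0 + m / 2 * (s - 1)" unfolding 1 ..
      finally have 2: "1 / (p + 1) * (P0 * (1 + t * (s - 1))) = 1 / (p + 1) * P0 + m / 2 * (s - 1)" .
      have 3: "1 / (p + 1) * P0 = P0 / 2 - m" by (simp add: m_def left_diff_distrib)
      have 4: "m / 2 * (s - 1) = (m * s) / 2 - m / 2" by (simp add: right_diff_distrib)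
      have "X = y / 2 - n / 2 \<Longrightarrow> n + w = z \<Longrightarrow> 1 / 2 * (y + w) = n + (z / 2 - n + X)"
        for X y w z n :: real by (simp add: field_simps)
      from this[OF 4 p_identities(3)] show ?thesis unfolding 2 3 .
    qed
    ultimately show ?thesis by (simp add: right_diff_distrib)
  qed
  have p1: "0 < 1 / (p + 1)" using p_gt by simp
  have "0 \<le> 1 / (p + 1) * (P0 * (1 + t * (s - 1)) - P u)"
    using p1 P1 P2 by (intro mult_nonneg_nonneg) auto
  then show "m \<le> S_fun c \<omega> p u" unfolding S by simp
  assume "S_fun c \<omega> p u = m"
  then have "P0 * (1 + t * (s - 1)) = P u" using p1 unfolding S by simp
  \<comment> \<open>\<open>P u\<close> lies below the power and the power below the tangent, so
    equality of the outer terms forces equality throughout.\<close>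
  then have e: "P0 * s powr t = P0 * (1 + t * (s - 1))" "P u = P0 * s powr t" using P1 P2 by auto
  then have "s powr t = 1 + t * (s - 1)" using P0_pos by simp
  then have s1: "s = 1" by (rule Bernoulli_powr_eq[OF s(1) t])
  then have "P u = P0" using e(2) by simp
  moreover have "Q u = P0"
    unfolding Q_def u(2) H_def[symmetric] s(2) s1 using p_identities(3) by simp
  ultimately show "nehari_minimizer u" using nz by (simp add: nehari_minimizer_def)
qed

lemma nehari_minimizer_S: "nehari_minimizer u \<Longrightarrow> S_fun c \<omega> p u = m"
  using S_eq[of u] by (simp add: nehari_minimizer_def H10_nonzero_def m_def left_diff_distrib)

lemma fixed_mass_Inf: "Inf (S_fun c \<omega> p ` {v \<in> H10. sqi v = mass}) = m"
proof -
  obtain u where u: "nehari_minimizer u" using nehari_minimizer_exists by blast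
  show ?thesis
  proof (rule cInf_eq_minimum)
    show "m \<in> S_fun c \<omega> p ` {v \<in> H10. sqi v = mass}"
      using nehari_minimizer_S[OF u] nehari_minimizer_mass[OF u] u
      by (intro image_eqI[of _ _ u]) (auto simp: nehari_minimizer_def H10_nonzero_def)
  qed (use fixed_mass_bound(1) in auto)
qed

lemma ground_state_iff_fixed_mass:
  assumes "u \<in> H10"
  shows "u \<in> ground_states c \<omega> p \<longleftrightarrow>
    u \<in> {v \<in> H10. sqi v = mass} \<and> S_fun c \<omega> p u = Inf (S_fun c \<omega> p ` {v \<in> H10. sqi v = mass})"
  unfolding ground_state_iff fixed_mass_Inf
  using assms nehari_minimizer_S nehari_minimizer_mass fixed_mass_bound(2) by blast

end

theorem lemma3p5:
  fixes c \<omega> p \<mu> :: real and \<Gamma> :: "(real \<Rightarrow> complex) set" and u :: "real \<Rightarrow> complex"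
  assumes "0 < c" and "c < 1 / 4" and "0 < \<omega>" and "1 < p" and "p < 5"
    and "\<mu> = m_inf c \<omega> p / \<omega> * ((p + 3) / (p - 1))"
    and "\<Gamma> = {v \<in> H10. (Lnorm 2 v)\<^sup>2 = \<mu>}"
    and "u \<in> H10"
  shows "u \<in> ground_states c \<omega> p \<longleftrightarrow>
           u \<in> \<Gamma> \<and> S_fun c \<omega> p u = Inf (S_fun c \<omega> p ` \<Gamma>)"
proof -
  interpret hardy_nls c \<omega> p
    using assms by unfold_locales
  have "\<mu> = mass" unfolding assms(6) mass_def m_def m_inf_eq ..
  then show ?thesis
    unfolding assms(7) Lnorm_2 using ground_state_iff_fixed_mass[OF assms(8)] by simp
qed

end
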